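(* Let $(H,H')$ be a Ramsey finite pair of $\chi$-unavoidable connected ordered graphs, each with at least two edges. Then either one of $H,H'$ is a right star and the other is an almost increasing right caterpillar, or one of $H,H'$ is a left star and the other is an almost increasing left caterpillar.
   Context: An ordered graph is a finite simple graph together with a linear order of its vertex set. A copy of an ordered graph $H$ in $F$ is a subgraph of $F$ (with inherited order) isomorphic to $H$ via an order-preserving bijection. $R_<(H,H')$ is the set of ordered graphs $F$ such that every red/blue coloring of the edges of $F$ contains a red copy of $H$ or a blue copy of $H'$; $F\in R_<(H,H')$ is minimal if no proper subgraph lies in $R_<(H,H')$; $(H,H')$ is Ramsey finite if $R_<(H,H')$ has finitely many minimal elements (up to order-preserving isomorphism). An ordered graph $H$ is $\chi$-unavoidable if there is $k$ such that every ordered graph of chromatic number at least $k$ contains a copy of $H$. A right (left) star is an ordered star with all leaves to the right (left) of its center; $\vec S_p$ denotes the right star with $p$ edges. The concatenation $G\circ G'$ of ordered graphs is obtained from the vertex-disjoint union with all vertices of $G$ before all vertices of $G'$ by identifying the rightmost vertex of $G$ with the leftmost vertex of $G'$. For $i\ge1$ and positive integers $d_1,\ldots,d_i$, the right caterpillar with defining sequence $d_1,\ldots,d_i$ is $\vec S_{d_i}\circ\vec S_{d_{i-1}}\circ\cdots\circ\vec S_{d_1}$ (so its rightmost segment has $d_1$ edges); its segments are these $i$ right stars. A left caterpillar is the mirror image (order reversed) of a right caterpillar, and its defining sequence is that of the mirrored right caterpillar. A (left or right) caterpillar with defining sequence $d_1,\ldots,d_i$ is almost increasing if $i\le 2$,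 or $i\ge3$, $d_1\le d_3$ and $d_2\le d_3\le\cdots\le d_i$. *)

theory Defs
  imports Main
begin

text \<open>
  The linear order of the vertex set is the one inherited from the vertex type, and an edge between
  \<open>u\<close> and \<open>v\<close> with \<open>u < v\<close> is represented by the single pair \<open>(u, v)\<close>; so edges carry no
  orientation beyond the vertex order. Since all graphs are finite, every ordered graph is isomorphic
  to one with vertices of type \<^typ>\<open>nat\<close>; quantification over all ordered graphs uses that type.
\<close>

datatype 'a ograph = OGraph (verts: "'a set") (edges: "('a \<times> 'a) set")

definition ordered_graph :: "'a::linorder ograph \<Rightarrow> bool" where
  "ordered_graph G \<longleftrightarrow>
     finite (verts G) \<and> edges G \<subseteq> {(u, v). u \<in> verts G \<and> v \<in> verts G \<and> u < v}"

definition connected_ograph :: "'a::linorder ograph \<Rightarrow> bool" where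
  "connected_ograph G \<longleftrightarrow>
     verts G \<noteq> {} \<and> (\<forall>u\<in>verts G. \<forall>v\<in>verts G. (u, v) \<in> (edges G \<union> (edges G)\<inverse>)\<^sup>*)"

definition subgraph :: "'a::linorder ograph \<Rightarrow> 'a ograph \<Rightarrow> bool" where
  "subgraph G F \<longleftrightarrow> ordered_graph G \<and> verts G \<subseteq> verts F \<and> edges G \<subseteq> edges F"

definition ograph_iso :: "'a::linorder ograph \<Rightarrow> 'b::linorder ograph \<Rightarrow> bool" where
  "ograph_iso G G' \<longleftrightarrow>
     (\<exists>f. bij_betw f (verts G) (verts G') \<and> strict_mono_on (verts G) f \<and>
          edges G' = map_prod f f ` edges G)"

definition is_copy :: "'b::linorder ograph \<Rightarrow> 'a::linorder ograph \<Rightarrow> 'b ograph \<Rightarrow> bool" where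
  "is_copy C H F \<longleftrightarrow> subgraph C F \<and> ograph_iso H C"


definition proper_coloring :: "'a ograph \<Rightarrow> ('a \<Rightarrow> nat) \<Rightarrow> bool" where
  "proper_coloring G c \<longleftrightarrow> (\<forall>(u, v)\<in>edges G. c u \<noteq> c v)"

definition chromatic_number :: "'a ograph \<Rightarrow> nat" where
  "chromatic_number G = (LEAST k. \<exists>c. c ` verts G \<subseteq> {..<k} \<and> proper_coloring G c)"

definition chi_unavoidable :: "'a::linorder ograph \<Rightarrow> bool" where
  "chi_unavoidable H \<longleftrightarrow>
     (\<exists>k. \<forall>F :: nat ograph. ordered_graph F \<and> chromatic_number F \<ge> k \<longrightarrow> (\<exists>C. is_copy C H F))"


datatype color = Red | Blue

definition ramsey_graphs ::
    "'a::linorder ograph \<Rightarrow> 'b::linorder ograph \<Rightarrow> nat ograph set" where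
  "ramsey_graphs H H' =
     {F. ordered_graph F \<and>
         (\<forall>c :: nat \<times> nat \<Rightarrow> color.
            (\<exists>C. is_copy C H F \<and> (\<forall>e\<in>edges C. c e = Red)) \<or>
            (\<exists>C. is_copy C H' F \<and> (\<forall>e\<in>edges C. c e = Blue)))}"

definition minimal_ramsey_graphs ::
    "'a::linorder ograph \<Rightarrow> 'b::linorder ograph \<Rightarrow> nat ograph set" where
  "minimal_ramsey_graphs H H' =
     {F \<in> ramsey_graphs H H'. \<forall>G. subgraph G F \<and> G \<noteq> F \<longrightarrow> G \<notin> ramsey_graphs H H'}"

definition ramsey_finite :: "'a::linorder ograph \<Rightarrow> 'b::linorder ograph \<Rightarrow> bool" where
  "ramsey_finite H H' \<longleftrightarrow> finite (minimal_ramsey_graphs H H' // {(F, G). ograph_iso F G})"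


definition is_right_star :: "'a::linorder ograph \<Rightarrow> bool" where
  "is_right_star G \<longleftrightarrow> ordered_graph G \<and> (\<exists>c\<in>verts G. edges G = {c} \<times> (verts G - {c}))"

definition is_left_star :: "'a::linorder ograph \<Rightarrow> bool" where
  "is_left_star G \<longleftrightarrow> ordered_graph G \<and> (\<exists>c\<in>verts G. edges G = (verts G - {c}) \<times> {c})"

definition right_star :: "nat \<Rightarrow> nat ograph" where
  "right_star p = OGraph {0..p} ({0} \<times> {1..p})"

text \<open>
  The second graph is translated so that its leftmost vertex becomes the rightmost vertex of the
  first one. Meaningful for graphs with finite nonempty vertex sets.
\<close>

definition ograph_concat :: "nat ograph \<Rightarrow> nat ograph \<Rightarrow> nat ograph" where
  "ograph_concat G G' =
     (let f = (\<lambda>x. Max (verts G) + (x - Min (verts G')))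
      in OGraph (verts G \<union> f ` verts G') (edges G \<union> map_prod f f ` edges G'))"

definition mirror :: "nat ograph \<Rightarrow> nat ograph" where
  "mirror G =
     (let f = (\<lambda>x. Max (verts G) - x)
      in OGraph (f ` verts G) ((\<lambda>(u, v). (f v, f u)) ` edges G))"

text \<open>
  The single vertex \<open>right_star 0\<close> is neutral for concatenation, so \<open>right_caterpillar [d\<^sub>1, \<dots>, d\<^sub>i]\<close>
  is the concatenation of the right stars with \<open>d\<^sub>i, \<dots>, d\<^sub>1\<close> edges, in this order from left to right.
\<close>

fun right_caterpillar :: "nat list \<Rightarrow> nat ograph" where
  "right_caterpillar [] = right_star 0"
| "right_caterpillar (d # ds) = ograph_concat (right_caterpillar ds) (right_star d)"

definition is_right_caterpillar :: "nat list \<Rightarrow> 'a::linorder ograph \<Rightarrow> bool" where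
  "is_right_caterpillar ds G \<longleftrightarrow>
     ds \<noteq> [] \<and> (\<forall>d\<in>set ds. d \<ge> 1) \<and> ograph_iso (right_caterpillar ds) G"

definition is_left_caterpillar :: "nat list \<Rightarrow> 'a::linorder ograph \<Rightarrow> bool" where
  "is_left_caterpillar ds G \<longleftrightarrow>
     ds \<noteq> [] \<and> (\<forall>d\<in>set ds. d \<ge> 1) \<and> ograph_iso (mirror (right_caterpillar ds)) G"

text \<open>List indices start at \<open>0\<close>: the defining sequence is \<open>d\<^sub>1 = ds ! 0\<close>, \<open>d\<^sub>2 = ds ! 1\<close>, and so on.\<close>

definition almost_increasing :: "nat list \<Rightarrow> bool" where
  "almost_increasing ds \<longleftrightarrow>
     length ds \<le> 2 \<or> (length ds \<ge> 3 \<and> ds ! 0 \<le> ds ! 2 \<and> sorted (tl ds))"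

definition almost_increasing_right_caterpillar :: "'a::linorder ograph \<Rightarrow> bool" where
  "almost_increasing_right_caterpillar G \<longleftrightarrow>
     (\<exists>ds. is_right_caterpillar ds G \<and> almost_increasing ds)"

definition almost_increasing_left_caterpillar :: "'a::linorder ograph \<Rightarrow> bool" where
  "almost_increasing_left_caterpillar G \<longleftrightarrow>
     (\<exists>ds. is_left_caterpillar ds G \<and> almost_increasing ds)"

end

theory Submission
  imports Defs "HOL-Library.Product_Lexorder" "HOL-Library.Countable"
    "HOL-Library.Dual_Ordered_Lattice" "HOL-Library.Nat_Bijection"
begin

text \<open>
  If the pair is Ramsey finite, then for some \<open>N\<close> every Ramsey graph contains a Ramsey
  graph with at most \<open>N\<close> edges. Graphs of large chromatic number are Ramsey graphs of the
  pair, so one whose small subgraphs are forests yields a Ramsey forest. Three colourings of rooted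
  forests then force one of the two graphs to be, say, a right star and every vertex of the other
  one to have at most one neighbour to the left. Shift graphs and Zykov graphs (with suitable vertex
  orders) show that in the latter only the last child of a vertex can have children, which makes it
  a right caterpillar. If its defining sequence is not almost increasing, then some \<open>k \<ge> 2\<close>
  satisfies \<open>d\<^sub>k > d\<^sub>k\<^sub>+\<^sub>1\<close> or \<open>k = 2\<close> and \<open>d\<^sub>1 > d\<^sub>3\<close>; in this case
  avoiding \<open>k + 1\<close> blue segments at a vertex can be forced to create \<open>k\<close> blue segments there,
  and chains of such implications are arbitrarily large Ramsey graphs in which no link is dispensable.
\<close>


section \<open>Arrowing for edge sets\<close>

text \<open>Finiteness enters only through the number of edges, which is an isomorphism invariant.
  Refuting boundedness asks for no explicit minimal graph: it is enough to have Ramsey graphs all of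
  whose subgraphs with at most \<open>N\<close> edges fail.

  The chain rests on a budget. If a right star with \<open>p\<close> edges is to be avoided in red,
  a vertex has at most \<open>p - 1\<close> red edges to the right. A chain vertex is joined to
  \<open>p - 1\<close> vertices that are forced to start \<open>k\<close> blue segments. Avoiding
  \<open>k + 1\<close> blue segments spends the whole budget on these and on the leaves before them,
  so all its other edges are blue and make it start \<open>k\<close> segments itself. If the link to
  the previous chain vertex is cut, one red edge becomes free and the implication breaks. From there
  on the links can be left blue, and the failure of almost increasing is just what makes them
  useless for blue: there are too few leaves before a link for segment \<open>k\<close>, or, for
  \<open>k = 2\<close>, too few blue edges behind it for segment \<open>1\<close>.\<close>

definition edge_set :: "'a::linorder rel \<Rightarrow> bool" where
  "edge_set E \<longleftrightarrow> finite E \<and> (\<forall>(u, v)\<in>E. u < v)"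

text \<open>A graph without isolated vertices is identified with its edge relation, its vertex set
  being the \<open>Field\<close>. Connected graphs with at least two edges lose nothing by
  this.\<close>

definition embeds :: "'a::linorder rel \<Rightarrow> 'b::linorder rel \<Rightarrow> bool" where
  "embeds D E \<longleftrightarrow> (\<exists>f. strict_mono_on (Field D) f \<and> (\<forall>(u, v)\<in>D. (f u, f v) \<in> E))"

definition arrows :: "'c::linorder rel \<Rightarrow> 'a::linorder rel \<Rightarrow> 'b::linorder rel \<Rightarrow> bool" where
  "arrows E D D' \<longleftrightarrow> (\<forall>R\<subseteq>E. embeds D R \<or> embeds D' (E - R))"

text \<open>This is the only consequence of Ramsey finiteness that the combinatorial part uses. It
  speaks about edges alone and is stable under change of the vertex type.\<close>

definition bounded_arrowing :: "'a::linorder rel \<Rightarrow> 'b::linorder rel \<Rightarrow> bool" where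
  "bounded_arrowing D D' \<longleftrightarrow>
     (\<exists>N. \<forall>E :: nat rel. edge_set E \<and> arrows E D D' \<longrightarrow>
        (\<exists>E0\<subseteq>E. card E0 \<le> N \<and> arrows E0 D D'))"

text \<open>The colouring is bounded on the whole type, so for \<open>n = 0\<close> not even the
  empty relation is colourable.\<close>

definition colorable :: "nat \<Rightarrow> 'a rel \<Rightarrow> bool" where
  "colorable n E \<longleftrightarrow> (\<exists>c. (\<forall>v. c v < n) \<and> (\<forall>(u, v)\<in>E. c u \<noteq> c v))"

definition unavoidable :: "'a::linorder rel \<Rightarrow> bool" where
  "unavoidable D \<longleftrightarrow>
     (\<exists>k. \<forall>E :: nat rel. edge_set E \<and> \<not> colorable k E \<longrightarrow> embeds D E)"

lemma edge_set_subset: "edge_set E \<Longrightarrow> E0 \<subseteq> E \<Longrightarrow> edge_set E0"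
  by (auto simp: edge_set_def intro: finite_subset)

lemma embeds_mono: "embeds D E \<Longrightarrow> E \<subseteq> E' \<Longrightarrow> embeds D E'"
  unfolding embeds_def by fast

lemma arrows_commute:
  assumes "arrows E D D'"
  shows "arrows E D' D"
  unfolding arrows_def
proof (intro allI impI)
  fix R assume "R \<subseteq> E"
  then show "embeds D' R \<or> embeds D (E - R)"
    using assms unfolding arrows_def by (metis Diff_subset double_diff order_refl)
qed

lemma Field_map_prod: "Field (map_prod g g ` E) = g ` Field E"
  unfolding Field_def by force

lemma inj_on_map_prod_rel:
  fixes g :: "'a::linorder \<Rightarrow> 'b::linorder"
  assumes "strict_mono_on (Field E) g"
  shows "inj_on (map_prod g g) E"
proof (rule inj_on_subset)
  show "inj_on (map_prod g g) (Field E \<times> Field E)"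
    using strict_mono_on_imp_inj_on[OF assms] by (intro map_prod_inj_on)
  show "E \<subseteq> Field E \<times> Field E"
    by (auto intro: FieldI1 FieldI2)
qed

lemma embeds_map:
  assumes g: "strict_mono_on (Field E) g"
  shows "embeds D (map_prod g g ` E) \<longleftrightarrow> embeds D E"
proof
  assume "embeds D E"
  then obtain f where f: "strict_mono_on (Field D) f" "\<forall>(u, v)\<in>D. (f u, f v) \<in> E"
    unfolding embeds_def by blast
  have F: "f x \<in> Field E" if "x \<in> Field D" for x
    using that f(2) unfolding Field_def by force
  have "strict_mono_on (Field D) (g \<circ> f)"
    using f(1) g F unfolding strict_mono_on_def by simp
  moreover have "\<forall>(u, v)\<in>D. ((g \<circ> f) u, (g \<circ> f) v) \<in> map_prod g g ` E"
    using f(2) by fastforce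
  ultimately show "embeds D (map_prod g g ` E)"
    unfolding embeds_def by blast
next
  assume "embeds D (map_prod g g ` E)"
  then obtain f where f: "strict_mono_on (Field D) f" "\<forall>(u, v)\<in>D. (f u, f v) \<in> map_prod g g ` E"
    unfolding embeds_def by blast
  have inj: "inj_on g (Field E)"
    using g strict_mono_on_imp_inj_on by blast
  define h where "h = inv_into (Field E) g"
  have hg: "h (g x) = x" if "x \<in> Field E" for x
    using inj that by (simp add: h_def)
  have F: "f x \<in> g ` Field E" if "x \<in> Field D" for x
    using that f(2) unfolding Field_def by force
  have "h (f x) < h (f y)" if xy: "x \<in> Field D" "y \<in> Field D" "x < y" for x y
  proof -
    obtain a b where ab: "a \<in> Field E" "b \<in> Field E" "f x = g a" "f y = g b"
      using F[OF xy(1)] F[OF xy(2)] by blast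
    have "g a < g b" using f(1) xy ab unfolding strict_mono_on_def by metis
    then have "a < b" using g ab(1,2) unfolding strict_mono_on_def
      by (metis linorder_less_linear order_less_asym)
    then show ?thesis using ab hg by simp
  qed
  then have "strict_mono_on (Field D) (h \<circ> f)"
    unfolding strict_mono_on_def by simp
  moreover have "((h \<circ> f) u, (h \<circ> f) v) \<in> E" if uv: "(u, v) \<in> D" for u v
  proof -
    have "(f u, f v) \<in> map_prod g g ` E" using f(2) uv by auto
    then obtain a b where "(a, b) \<in> E" "f u = g a" "f v = g b" by force
    moreover then have "a \<in> Field E" "b \<in> Field E" by (auto intro: FieldI1 FieldI2)
    ultimately show ?thesis using hg by simp
  qed
  ultimately show "embeds D E"
    unfolding embeds_def by blast
qed

lemma arrows_map:
  assumes g: "strict_mono_on (Field E) g"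
  shows "arrows (map_prod g g ` E) D D' \<longleftrightarrow> arrows E D D'"
proof -
  have inj: "inj_on (map_prod g g) E"
    using inj_on_map_prod_rel[OF g] .
  have sub: "strict_mono_on (Field X) g" if "X \<subseteq> E" for X
    using g mono_Field[OF that] unfolding strict_mono_on_def by blast
  have "(\<forall>R\<subseteq>map_prod g g ` E. P R) \<longleftrightarrow> (\<forall>X\<subseteq>E. P (map_prod g g ` X))" for P
    by (metis image_mono subset_imageE)
  moreover have "map_prod g g ` E - map_prod g g ` X = map_prod g g ` (E - X)" if "X \<subseteq> E" for X
    using inj that by (simp add: inj_on_image_set_diff)
  ultimately show ?thesis
    unfolding arrows_def by (simp add: embeds_map[OF sub])
qed

lemma ex_strict_mono_nat:
  assumes "finite (A :: 'a::linorder set)"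
  shows "\<exists>g :: 'a \<Rightarrow> nat. strict_mono_on A g"
proof
  show "strict_mono_on A (\<lambda>x. card {y \<in> A. y < x})"
    using assms by (auto simp: strict_mono_on_def intro!: psubset_card_mono)
qed

lemma finite_Field_edge_set: "edge_set E \<Longrightarrow> finite (Field E)"
  by (simp add: edge_set_def finite_Field)

lemma edge_set_map:
  assumes "edge_set E" "strict_mono_on (Field E) g"
  shows "edge_set (map_prod g g ` E)"
  using assms unfolding edge_set_def strict_mono_on_def by (fastforce intro: FieldI1 FieldI2)

text \<open>The constructions live on lexicographic products and on reversed orders. A finite graph
  over any linear order has a copy over \<open>nat\<close>, and arrowing does not distinguish the
  two.\<close>

lemma bounded_arrowing_iff:
  "bounded_arrowing D D' \<Longrightarrow>
     \<exists>N. \<forall>E :: 'c::linorder rel. edge_set E \<and> arrows E D D' \<longrightarrow>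
        (\<exists>E0\<subseteq>E. card E0 \<le> N \<and> arrows E0 D D')"
proof -
  assume "bounded_arrowing D D'"
  then obtain N where N: "\<And>E :: nat rel. edge_set E \<Longrightarrow> arrows E D D' \<Longrightarrow>
      \<exists>E0\<subseteq>E. card E0 \<le> N \<and> arrows E0 D D'"
    unfolding bounded_arrowing_def by blast
  have "\<exists>E0\<subseteq>E. card E0 \<le> N \<and> arrows E0 D D'" if E: "edge_set E" "arrows E D D'" for E :: "'c rel"
  proof -
    obtain g :: "'c \<Rightarrow> nat" where g: "strict_mono_on (Field E) g"
      using ex_strict_mono_nat finite_Field_edge_set E by blast
    have "edge_set (map_prod g g ` E)" "arrows (map_prod g g ` E) D D'"
      using E g edge_set_map arrows_map by blast+
    then obtain X where X: "X \<subseteq> map_prod g g ` E" "card X \<le> N" "arrows X D D'"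
      using N by blast
    then obtain E0 where E0: "E0 \<subseteq> E" "X = map_prod g g ` E0"
      by (meson subset_imageE)
    have g0: "strict_mono_on (Field E0) g"
      using g mono_Field[OF E0(1)] unfolding strict_mono_on_def by blast
    have "inj_on (map_prod g g) E0"
      using inj_on_map_prod_rel[OF g0] .
    then have "card E0 \<le> N" using X E0 by (simp add: card_image)
    moreover have "arrows E0 D D'" using X(3) E0 g0 arrows_map by blast
    ultimately show ?thesis using E0 by blast
  qed
  then show ?thesis by blast
qed

lemma unavoidable_embeds:
  assumes "unavoidable D"
  shows "\<exists>k. \<forall>E :: 'c::linorder rel. edge_set E \<and> \<not> colorable k E \<longrightarrow> embeds D E"
proof -
  obtain k where k: "\<And>E :: nat rel. edge_set E \<Longrightarrow> \<not> colorable k E \<Longrightarrow> embeds D E"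
    using assms unfolding unavoidable_def by blast
  have "embeds D E" if E: "edge_set E" "\<not> colorable k E" for E :: "'c rel"
  proof -
    obtain g :: "'c \<Rightarrow> nat" where g: "strict_mono_on (Field E) g"
      using ex_strict_mono_nat finite_Field_edge_set E by blast
    have "\<not> colorable k (map_prod g g ` E)"
    proof
      assume "colorable k (map_prod g g ` E)"
      then obtain c where c: "\<forall>v. c v < k" "\<forall>(u, v)\<in>map_prod g g ` E. c u \<noteq> c v"
        unfolding colorable_def by blast
      then have "(\<forall>v. (c \<circ> g) v < k) \<and> (\<forall>(u, v)\<in>E. (c \<circ> g) u \<noteq> (c \<circ> g) v)" by fastforce
      then show False using E(2) unfolding colorable_def by blast
    qed
    then show ?thesis using k edge_set_map[OF E(1) g] embeds_map[OF g] by blast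
  qed
  then show ?thesis by blast
qed

text \<open>If the red part had \<open>k\<close> colours and the blue part \<open>k'\<close>, then
  pairs of colours, coded as numbers below \<open>k * k'\<close>, would colour
  \<open>E\<close>.\<close>

lemma arrows_if_not_colorable:
  assumes "\<And>E :: 'c::linorder rel. edge_set E \<Longrightarrow> \<not> colorable k E \<Longrightarrow> embeds D E"
    and "\<And>E :: 'c::linorder rel. edge_set E \<Longrightarrow> \<not> colorable k' E \<Longrightarrow> embeds D' E"
    and E: "edge_set (E :: 'c rel)" "\<not> colorable (k * k') E"
  shows "arrows E D D'"
  unfolding arrows_def
proof (intro allI impI)
  fix R assume R: "R \<subseteq> E"
  have "\<not> colorable k R \<or> \<not> colorable k' (E - R)"
  proof (rule ccontr)
    assume "\<not> ?thesis"
    then obtain c c' where c: "\<forall>v. c v < k" "\<forall>(u, v)\<in>R. c u \<noteq> c v"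
      and c': "\<forall>v. c' v < k'" "\<forall>(u, v)\<in>E - R. c' u \<noteq> c' v"
      unfolding colorable_def by blast
    define h where "h v = c v * k' + c' v" for v
    have "h v < k * k'" for v
    proof -
      have "h v < Suc (c v) * k'" using c'(1) by (simp add: h_def)
      also have "\<dots> \<le> k * k'" using c(1) by (intro mult_le_mono1) (simp add: Suc_leI)
      finally show ?thesis .
    qed
    moreover have "h u \<noteq> h v" if "(u, v) \<in> E" for u v
    proof
      assume "h u = h v"
      then have "h u div k' = h v div k'" "h u mod k' = h v mod k'" by simp_all
      moreover have "k' > 0" using c'(1) by (metis not_gr_zero not_less0)
      ultimately have "c u = c v" "c' u = c' v" using c'(1) by (simp_all add: h_def)
      then show False using that c(2) c'(2) by blast
    qed
    ultimately have "colorable (k * k') E" unfolding colorable_def by blast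
    then show False using E(2) by contradiction
  qed
  then show "embeds D R \<or> embeds D' (E - R)"
    using assms(1,2) edge_set_subset[OF E(1)] R by (meson Diff_subset)
qed

section \<open>Sparse hypergraphs of large chromatic number\<close>

definition forces_mono :: "nat \<Rightarrow> 'a set set \<Rightarrow> bool" where
  "forces_mono n F \<longleftrightarrow> (\<forall>c. (\<forall>v. c v < n) \<longrightarrow> (\<exists>e\<in>F. \<exists>a. \<forall>v\<in>e. c v = a))"

text \<open>
  Every subfamily of at most \<open>N\<close> edges is a Berge-acyclic hypergraph. The vertex or edge
  \<open>R\<close> is thought of as a root; the edge \<open>f\<close> is then a leaf at maximal distance from it.
\<close>

definition sparse :: "nat \<Rightarrow> 'a set set \<Rightarrow> bool" where
  "sparse N F \<longleftrightarrow>
     (\<forall>F0 R. F0 \<subseteq> F \<and> F0 \<noteq> {} \<and> finite F0 \<and> card F0 \<le> N \<and> (R \<in> F - F0 \<or> (\<exists>z. R = {z})) \<longrightarrow>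
        (\<exists>f\<in>F0. \<exists>z. f \<inter> (\<Union>(F0 - {f}) \<union> R) \<subseteq> {z}))"

lemma sparseD:
  assumes "sparse N F" "F0 \<subseteq> F" "F0 \<noteq> {}" "finite F0" "card F0 \<le> N" "R \<in> F - F0 \<or> (\<exists>z. R = {z})"
  obtains f z where "f \<in> F0" "f \<inter> (\<Union>(F0 - {f}) \<union> R) \<subseteq> {z}"
  using assms unfolding sparse_def by metis

text \<open>Distinct copies of \<open>F\<close> share only points of the form
  \<open>\<iota> x\<close>, and each edge has at most one of these. A small subfamily has a leaf
  because the copies it uses have a leaf in \<open>H\<close>, and inside that copy \<open>F\<close>
  provides one. The gain from \<open>N\<close> to \<open>Suc N\<close> comes from the extreme case:
  if \<open>Suc N\<close> copies besides the root copy are used, each holds a single edge, which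
  meets everything else in at most one shared point.\<close>

lemma sparse_amalgam:
  fixes \<tau> :: "'h set \<Rightarrow> 'v \<Rightarrow> 'w" and \<iota> :: "'h \<Rightarrow> 'w"
  assumes inj: "\<And>h. h \<in> H \<Longrightarrow> inj_on (\<tau> h) W" and FW: "F \<subseteq> Pow W"
    and overlap: "\<And>h h' u v. h \<in> H \<Longrightarrow> h' \<in> H \<Longrightarrow> h \<noteq> h' \<Longrightarrow> u \<in> W \<Longrightarrow> v \<in> W \<Longrightarrow>
                    \<tau> h u = \<tau> h' v \<Longrightarrow> \<exists>x\<in>h \<inter> h'. \<tau> h u = \<iota> x"
    and trans: "\<And>h e u v. h \<in> H \<Longrightarrow> e \<in> F \<Longrightarrow> u \<in> e \<Longrightarrow> v \<in> e \<Longrightarrow>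
                    \<tau> h u \<in> range \<iota> \<Longrightarrow> \<tau> h v \<in> range \<iota> \<Longrightarrow> u = v"
    and \<iota>: "inj \<iota>"
    and sF: "sparse (Suc N) F" and sH: "sparse N H"
  shows "sparse (Suc N) {\<tau> h ` e | h e. h \<in> H \<and> e \<in> F}"
  unfolding sparse_def
proof (intro allI impI, elim conjE)
  let ?A = "{\<tau> h ` e | h e. h \<in> H \<and> e \<in> F}"
  fix F0 R
  assume F0: "F0 \<subseteq> ?A" "F0 \<noteq> {}" "finite F0" "card F0 \<le> Suc N"
    and R: "R \<in> ?A - F0 \<or> (\<exists>z. R = {z})"
  have "\<forall>f\<in>F0. \<exists>h. \<exists>e. h \<in> H \<and> e \<in> F \<and> f = \<tau> h ` e" using F0(1) by blast
  then obtain hh where hh: "\<forall>f\<in>F0. \<exists>e. hh f \<in> H \<and> e \<in> F \<and> f = \<tau> (hh f) ` e"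
    using bchoice[of F0 "\<lambda>f h. \<exists>e. h \<in> H \<and> e \<in> F \<and> f = \<tau> h ` e"] by blast
  have hhE: "\<exists>e. hh f \<in> H \<and> e \<in> F \<and> f = \<tau> (hh f) ` e" if "f \<in> F0" for f
    using bspec[OF hh that] .
  have single: "\<exists>z. f \<inter> (\<Union>(F0 - {f}) \<union> R) \<subseteq> {z}"
    if f: "f \<in> F0" and sub: "f \<inter> (\<Union>(F0 - {f}) \<union> R) \<subseteq> range \<iota>" for f
  proof -
    obtain e where e: "hh f \<in> H" "e \<in> F" "f = \<tau> (hh f) ` e" using hhE[OF f] by metis
    have "x = y" if xy: "x \<in> f \<inter> range \<iota>" "y \<in> f \<inter> range \<iota>" for x y
    proof -
      obtain u v where uv: "u \<in> e" "v \<in> e" "x = \<tau> (hh f) u" "y = \<tau> (hh f) v"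
        using xy e(3) by blast
      then show ?thesis using trans[OF e(1,2) uv(1,2)] xy by simp
    qed
    then have "\<exists>z. f \<inter> range \<iota> \<subseteq> {z}" by blast
    then show ?thesis using sub by blast
  qed
  \<comment> \<open>A root outside of all copies does not matter and can be replaced.\<close>
  have main: "\<exists>f\<in>F0. \<exists>z. f \<inter> (\<Union>(F0 - {f}) \<union> R) \<subseteq> {z}"
    if h0: "h0 \<in> H" and Q: "Q \<in> F \<or> (\<exists>w. Q = {w})" and RQ: "R \<inter> \<Union>F0 \<subseteq> \<tau> h0 ` (Q \<inter> W)"
      and Qn: "\<tau> h0 ` Q \<notin> F0 \<or> (\<exists>w. Q = {w})" for h0 Q
  proof (cases "hh ` F0 \<subseteq> {h0}")
    case True
    \<comment> \<open>All edges lie in the copy that contains the root, so sparsity of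
      \<open>F\<close> applies directly after pulling back along \<open>\<tau> h0\<close>.\<close>
    define X where "X = {e \<in> F. \<tau> h0 ` e \<in> F0}"
    have FX: "F0 = (`) (\<tau> h0) ` X"
    proof (intro equalityI subsetI)
      fix f assume f: "f \<in> F0"
      then have "hh f = h0" using True by blast
      then obtain e where "e \<in> F" "f = \<tau> h0 ` e" using bspec[OF hh f] by metis
      then show "f \<in> (`) (\<tau> h0) ` X" using f unfolding X_def by blast
    qed (auto simp: X_def)
    have injX: "inj_on ((`) (\<tau> h0)) X"
      using inj[OF h0] FW unfolding X_def inj_on_def
      by (metis (no_types, lifting) Pow_iff inj[OF h0] inj_on_image_eq_iff mem_Collect_eq subsetD)
    have "finite X" using F0(3) FX injX finite_image_iff by blast
    moreover have "card X \<le> Suc N" using F0(4) FX injX by (simp add: card_image)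
    moreover have "X \<subseteq> F" "X \<noteq> {}" using FX F0(2) unfolding X_def by auto
    moreover have "Q \<in> F - X \<or> (\<exists>w. Q = {w})" using Q Qn unfolding X_def by blast
    ultimately obtain e z where e: "e \<in> X" "e \<inter> (\<Union>(X - {e}) \<union> Q) \<subseteq> {z}"
      using sparseD[OF sF] by metis
    have "x = \<tau> h0 z" if x: "x \<in> \<tau> h0 ` e \<inter> (\<Union>(F0 - {\<tau> h0 ` e}) \<union> R)" for x
    proof -
      obtain u where u: "u \<in> e" "x = \<tau> h0 u" using x by blast
      have uW: "u \<in> W" using u e(1) FW unfolding X_def by blast
      have "x \<in> \<tau> h0 ` (Q \<inter> W) \<or> (\<exists>e'\<in>X. e' \<noteq> e \<and> x \<in> \<tau> h0 ` e')"
        using x FX RQ e(1) u(1) by blast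
      then have "u \<in> Q \<or> (\<exists>e'\<in>X. e' \<noteq> e \<and> u \<in> e')"
        using inj[OF h0] uW u(2) FW unfolding X_def inj_on_def by blast
      then show ?thesis using e(2) u by blast
    qed
    then have "\<tau> h0 ` e \<inter> (\<Union>(F0 - {\<tau> h0 ` e}) \<union> R) \<subseteq> {\<tau> h0 z}" by blast
    moreover have "\<tau> h0 ` e \<in> F0" using e(1) unfolding X_def by blast
    ultimately show ?thesis by blast
  next
    case False
    define D where "D = hh ` F0 - {h0}"
    have DF: "finite D" "D \<noteq> {}" "D \<subseteq> H - {h0}" using False F0(3) hhE unfolding D_def by auto
    have cD: "card D \<le> Suc N"
      using F0(3,4) card_image_le[of F0 hh] card_mono[of "hh ` F0" D] unfolding D_def by fastforce
    have other: "x \<in> range \<iota>" if o: "f \<in> F0" "x \<in> f" "x \<in> \<tau> h ` W" "h \<in> H" "h \<noteq> hh f" for f x h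
    proof -
      obtain e where e: "hh f \<in> H" "e \<in> F" "f = \<tau> (hh f) ` e" using hhE[OF o(1)] by metis
      obtain u where u: "u \<in> e" "x = \<tau> (hh f) u" using o(2) e(3) by auto
      obtain v where v: "v \<in> W" "x = \<tau> h v" using o(3) by blast
      have "u \<in> W" using u(1) e(2) FW by blast
      then show ?thesis using overlap[OF e(1) o(4) _ _ v(1), of u] o(5) u(2) v(2) by auto
    qed
    show ?thesis
    proof (cases "card D \<le> N")
      case False
      \<comment> \<open>No two edges share a copy and none lies in the root copy, so all
        intersections consist of shared points.\<close>
      then have "card D = Suc N" using cD by simp
      then have c: "card (hh ` F0) = card F0" "card (hh ` F0) = card D"
        using F0(3,4) card_image_le[of F0 hh] card_mono[of "hh ` F0" D] unfolding D_def by fastforce+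
      have "inj_on hh F0" using c(1) F0(3) eq_card_imp_inj_on by blast
      have D: "D = hh ` F0" using c(2) F0(3) unfolding D_def by (metis Diff_subset card_subset_eq finite_imageI)
      obtain f where f: "f \<in> F0" using F0(2) by blast
      have "x \<in> range \<iota>" if x: "x \<in> f" "x \<in> \<Union>(F0 - {f}) \<union> R" for x
        using x(2)
      proof
        assume "x \<in> \<Union>(F0 - {f})"
        then obtain g where g: "g \<in> F0" "g \<noteq> f" "x \<in> g" by blast
        then have "hh g \<noteq> hh f" using \<open>inj_on hh F0\<close> f unfolding inj_on_def by blast
        moreover have "x \<in> \<tau> (hh g) ` W" "hh g \<in> H" using hhE[OF g(1)] g(3) FW by fast+
        ultimately show ?thesis using other f x(1) by blast
      next
        assume "x \<in> R"
        then have "x \<in> \<tau> h0 ` W" using RQ f x(1) by blast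
        moreover have "h0 \<noteq> hh f" using D f unfolding D_def by blast
        ultimately show ?thesis using other f x(1) h0 by blast
      qed
      then have "f \<inter> (\<Union>(F0 - {f}) \<union> R) \<subseteq> range \<iota>" by blast
      then show ?thesis using single[OF f] f by (intro bexI[of _ f])
    next
      case True
      have "h0 \<in> H - D \<or> (\<exists>z. h0 = {z})" using h0 unfolding D_def by blast
      \<comment> \<open>A leaf copy: it touches the other copies and the root copy only in
        \<open>\<iota> z\<close>. Rooting \<open>F\<close> at the preimage \<open>w\<close> of this
        point then gives a leaf edge within the copy.\<close>
      then obtain h z where h: "h \<in> D" "h \<inter> (\<Union>(D - {h}) \<union> h0) \<subseteq> {z}"
        using sparseD[OF sH _ DF(2,1) True] DF(3) by blast
      have hH: "h \<in> H" "h \<noteq> h0" using h DF(3) by blast+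
      define G where "G = {f \<in> F0. hh f = h}"
      define X where "X = {e \<in> F. \<tau> h ` e \<in> G}"
      have GX: "G = (`) (\<tau> h) ` X"
      proof (intro equalityI subsetI)
        fix f assume f: "f \<in> G"
        then have "hh f = h" "f \<in> F0" unfolding G_def by blast+
        then obtain e where "e \<in> F" "f = \<tau> h ` e" using hh by metis
        then show "f \<in> (`) (\<tau> h) ` X" using f unfolding X_def by blast
      qed (auto simp: X_def)
      have injX: "inj_on ((`) (\<tau> h)) X"
        using inj[OF hH(1)] FW unfolding X_def inj_on_def
        by (metis (no_types, lifting) Pow_iff inj[OF hH(1)] inj_on_image_eq_iff mem_Collect_eq subsetD)
      have G: "finite G" "G \<noteq> {}" "card G \<le> Suc N"
        using F0(3,4) h(1) card_mono[of F0 G] unfolding G_def D_def by fastforce+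
      have "finite X" using G(1) GX injX finite_image_iff by blast
      moreover have "card X \<le> Suc N" using G(3) GX injX by (simp add: card_image)
      moreover have "X \<subseteq> F" "X \<noteq> {}" using GX G(2) unfolding X_def by auto
      moreover obtain w where w: "\<And>u. u \<in> W \<Longrightarrow> \<tau> h u = \<iota> z \<Longrightarrow> u = w"
        using inj[OF hH(1)] unfolding inj_on_def by metis
      ultimately obtain e y where e: "e \<in> X" "e \<inter> (\<Union>(X - {e}) \<union> {w}) \<subseteq> {y}"
        using sparseD[OF sF, of X "{w}"] by metis
      have f: "\<tau> h ` e \<in> F0" "hh (\<tau> h ` e) = h" using e(1) unfolding X_def G_def by auto
      have "x = \<tau> h y" if x: "x \<in> \<tau> h ` e \<inter> (\<Union>(F0 - {\<tau> h ` e}) \<union> R)" for x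
      proof -
        obtain u where u: "u \<in> e" "x = \<tau> h u" using x by blast
        have uW: "u \<in> W" using u e(1) FW unfolding X_def by blast
        have z: "u = w" if h': "h' \<in> D - {h} \<or> h' = h0" "x \<in> \<tau> h' ` W" for h'
        proof -
          have "h' \<in> H" "h' \<noteq> h" using h' hH h0 DF(3) by blast+
          moreover obtain v where "v \<in> W" "x = \<tau> h' v" using h'(2) by blast
          ultimately obtain s where "s \<in> h \<inter> h'" "\<tau> h u = \<iota> s"
            using overlap[OF hH(1), of h' u v] uW u(2) by metis
          moreover then have "s = z" using h(2) h'(1) by blast
          ultimately show ?thesis using w uW by blast
        qed
        have "u = w \<or> (\<exists>e'\<in>X. e' \<noteq> e \<and> u \<in> e')"
        proof (cases "x \<in> R")
          case True
          then have "x \<in> \<tau> h0 ` W" using RQ f(1) x by blast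
          then show ?thesis using z by blast
        next
          case False
          then obtain g where g: "g \<in> F0" "g \<noteq> \<tau> h ` e" "x \<in> g" using x by blast
          obtain e' where e': "hh g \<in> H" "e' \<in> F" "g = \<tau> (hh g) ` e'" using hhE[OF g(1)] by metis
          have eW: "e' \<subseteq> W" using FW e'(2) by blast
          show ?thesis
          proof (cases "hh g = h")
            case True
            then have "e' \<in> X" using e' g(1) unfolding X_def G_def by auto
            moreover have "u \<in> e'"
              using inj[OF hH(1)] g(3) e'(3) True u(2) uW eW unfolding inj_on_def by blast
            moreover have "e' \<noteq> e" using g(2) e'(3) True by auto
            ultimately show ?thesis by blast
          next
            case False
            then have "hh g \<in> D - {h} \<or> hh g = h0" using g(1) unfolding D_def by blast
            moreover have "x \<in> \<tau> (hh g) ` W" using g(3) e'(3) eW by blast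
            ultimately show ?thesis using z by blast
          qed
        qed
        then show ?thesis using e(2) u by blast
      qed
      then have "\<tau> h ` e \<inter> (\<Union>(F0 - {\<tau> h ` e}) \<union> R) \<subseteq> {\<tau> h y}" by blast
      then show ?thesis using f(1) by blast
    qed
  qed
  obtain f1 where f1: "f1 \<in> F0" using F0(2) by blast
  consider (edge) h0 e0 where "h0 \<in> H" "e0 \<in> F" "R = \<tau> h0 ` e0" "R \<notin> F0"
    | (vert) z h0 w where "R = {z}" "h0 \<in> H" "w \<in> W" "z = \<tau> h0 w"
    | (out) z where "R = {z}" "\<And>h w. h \<in> H \<Longrightarrow> w \<in> W \<Longrightarrow> z \<noteq> \<tau> h w"
    using R by blast
  then show "\<exists>f\<in>F0. \<exists>z. f \<inter> (\<Union>(F0 - {f}) \<union> R) \<subseteq> {z}"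
  proof cases
    case edge
    then have "R \<inter> \<Union>F0 \<subseteq> \<tau> h0 ` (e0 \<inter> W)" using FW by blast
    then show ?thesis using main[of h0 e0] edge by blast
  next
    case vert
    then show ?thesis using main[of h0 "{w}"] by blast
  next
    case out
    have "R \<inter> \<Union>F0 = {}"
    proof (rule ccontr)
      assume "R \<inter> \<Union>F0 \<noteq> {}"
      then obtain g where g: "g \<in> F0" "z \<in> g" using out(1) by blast
      obtain e where e: "hh g \<in> H" "e \<in> F" "g = \<tau> (hh g) ` e" using hhE[OF g(1)] by metis
      then obtain u where "u \<in> e" "z = \<tau> (hh g) u" using g(2) by auto
      then show False using out(2) e FW by blast
    qed
    then show ?thesis using main[of "hh f1" "{undefined}"] hhE[OF f1] by auto
  qed
qed

section \<open>The partite construction of sparse hypergraphs\<close>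

lemma pigeonhole_subset:
  assumes "\<And>i. i < n * k + 1 \<Longrightarrow> c i < (n::nat)"
  shows "\<exists>s \<subseteq> {..<n * k + 1}. card s = k \<and> (\<exists>a. \<forall>i\<in>s. c i = a)"
proof (rule ccontr)
  assume no: "\<not> ?thesis"
  let ?A = "{..<n * k + 1}"
  have "card {i \<in> ?A. c i = a} \<le> k" for a
  proof (rule ccontr)
    assume "\<not> ?thesis"
    then obtain s where s: "s \<subseteq> {i \<in> ?A. c i = a}" "card s = k"
      using obtain_subset_with_card_n[of k "{i \<in> ?A. c i = a}"] by auto
    then have "s \<subseteq> ?A" "\<forall>i\<in>s. c i = a" by auto
    then have "\<exists>s\<subseteq>?A. card s = k \<and> (\<exists>a. \<forall>i\<in>s. c i = a)"
      using s(2) by (intro exI[of _ s] conjI exI[of _ a]) simp_all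
    then show False using no by contradiction
  qed
  moreover have "?A = (\<Union>a<n. {i \<in> ?A. c i = a})" using assms by auto
  ultimately have "card ?A \<le> (\<Sum>a<n. k)"
    by (metis (no_types, lifting) card_UN_le finite_lessThan order_trans sum_mono)
  then show False by simp
qed

text \<open>The edges are transversal to the parts, the fibres of \<open>\<pi>\<close>.
  Monochromatic edges are forced only for colourings that are constant on every part from index
  \<open>j\<close> on; raising \<open>j\<close> from \<open>0\<close> to \<open>a\<close> lifts this
  restriction one part at a time.\<close>

definition partite_system ::
    "nat \<Rightarrow> nat \<Rightarrow> nat \<Rightarrow> nat \<Rightarrow> nat \<Rightarrow> nat set \<Rightarrow> (nat \<Rightarrow> nat) \<Rightarrow> nat set set \<Rightarrow> bool" where
  "partite_system n k a N j W \<pi> F \<longleftrightarrow>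
     finite W \<and> F \<subseteq> Pow W \<and> (\<forall>v\<in>W. \<pi> v < a) \<and> (\<forall>e\<in>F. card e = k \<and> inj_on \<pi> e) \<and> sparse N F \<and>
     (\<forall>c. (\<forall>v. c v < n) \<and> (\<forall>u\<in>W. \<forall>v\<in>W. \<pi> u = \<pi> v \<and> j \<le> \<pi> u \<longrightarrow> c u = c v) \<longrightarrow>
        (\<exists>e\<in>F. \<exists>a::nat. \<forall>v\<in>e. c v = a))"

lemma partite_systemI:
  assumes "finite W" "F \<subseteq> Pow W" "\<And>v. v \<in> W \<Longrightarrow> \<pi> v < a"
    "\<And>e. e \<in> F \<Longrightarrow> card e = k \<and> inj_on \<pi> e" "sparse N F"
    "\<And>c. (\<And>v. c v < n) \<Longrightarrow>
        (\<And>u v. u \<in> W \<Longrightarrow> v \<in> W \<Longrightarrow> \<pi> u = \<pi> v \<Longrightarrow> j \<le> \<pi> u \<Longrightarrow> c u = c v) \<Longrightarrow>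
        \<exists>e\<in>F. \<exists>a::nat. \<forall>v\<in>e. c v = a"
  shows "partite_system n k a N j W \<pi> F"
  unfolding partite_system_def
proof (intro conjI allI impI ballI)
  fix c
  assume "(\<forall>v. c v < n) \<and> (\<forall>u\<in>W. \<forall>v\<in>W. \<pi> u = \<pi> v \<and> j \<le> \<pi> u \<longrightarrow> c u = c v)"
  then show "\<exists>e\<in>F. \<exists>a::nat. \<forall>v\<in>e. c v = a" using assms(6)[of c] by blast
qed (use assms in auto)

text \<open>There is one edge for each \<open>k\<close>-set of parts, and all edges are disjoint. A
  colouring constant on every part is a colouring of the parts themselves, where the pigeonhole
  principle applies.\<close>

lemma partite_system_0:
  "\<exists>W \<pi> F. partite_system n k (n * k + 1) N 0 W \<pi> F"
proof -
  let ?a = "n * k + 1"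
  define S where "S = {s. s \<subseteq> {..<?a} \<and> card s = k}"
  have finS: "finite S" unfolding S_def by simp
  obtain code :: "nat set \<Rightarrow> nat" where code: "inj_on code S"
    using finite_imp_inj_to_nat_seg[OF finS] by blast
  define E where "E s = (\<lambda>i. prod_encode (code s, i)) ` s" for s
  define \<pi> where "\<pi> x = snd (prod_decode x)" for x
  have disj: "s = t" if "s \<in> S" "t \<in> S" "x \<in> E s" "x \<in> E t" for s t x
    using that code unfolding E_def inj_on_def by auto
  have sp: "sparse N (E ` S)"
    unfolding sparse_def
  proof (intro allI impI, elim conjE)
    fix F0 R
    assume F0: "F0 \<subseteq> E ` S" "F0 \<noteq> {}" and R: "R \<in> E ` S - F0 \<or> (\<exists>z. R = {z})"
    obtain f where f: "f \<in> F0" using F0 by blast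
    have dis: "f \<inter> g = {}" if g: "g \<in> E ` S" "g \<noteq> f" for g
    proof -
      obtain s t where "s \<in> S" "t \<in> S" "f = E s" "g = E t" using f F0(1) g(1) by blast
      then show ?thesis using disj[of s t] g(2) by blast
    qed
    have "f \<inter> \<Union>(F0 - {f}) = {}" using dis F0(1) by blast
    moreover have "\<exists>z. f \<inter> R \<subseteq> {z}"
    proof (cases "\<exists>z. R = {z}")
      case False
      then have "f \<inter> R = {}" using R dis f by (intro dis) auto
      then show ?thesis by blast
    qed blast
    then obtain z where "f \<inter> R \<subseteq> {z}" by blast
    ultimately have "f \<inter> (\<Union>(F0 - {f}) \<union> R) \<subseteq> {z}" by (simp add: Int_Un_distrib)
    then show "\<exists>f\<in>F0. \<exists>z. f \<inter> (\<Union>(F0 - {f}) \<union> R) \<subseteq> {z}" using f by blast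
  qed
  have fin: "finite (\<Union>(E ` S))" using finS
    unfolding S_def E_def by (auto intro: finite_subset)
  have part: "\<pi> v < ?a" if "v \<in> \<Union>(E ` S)" for v using that unfolding S_def E_def \<pi>_def by auto
  have unif: "card e = k \<and> inj_on \<pi> e" if "e \<in> E ` S" for e
    using that unfolding S_def E_def \<pi>_def by (auto simp: inj_on_def card_image)
  have mono: "\<exists>e\<in>E ` S. \<exists>a::nat. \<forall>v\<in>e. c v = a"
    if c: "\<And>v. c v < n" "\<And>u v. u \<in> \<Union>(E ` S) \<Longrightarrow> v \<in> \<Union>(E ` S) \<Longrightarrow> \<pi> u = \<pi> v \<Longrightarrow> 0 \<le> \<pi> u \<Longrightarrow> c u = c v" for c
  proof -
    \<comment> \<open>The colour of part \<open>i\<close>, read off from any of its vertices; an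
      empty part gets some colour below \<open>n\<close>.\<close>
    define d where "d i = (if \<exists>v\<in>\<Union>(E ` S). \<pi> v = i then c (SOME v. v \<in> \<Union>(E ` S) \<and> \<pi> v = i) else c 0)" for i
    have d: "d (\<pi> v) = c v" if "v \<in> \<Union>(E ` S)" for v
    proof -
      have "(SOME u. u \<in> \<Union>(E ` S) \<and> \<pi> u = \<pi> v) \<in> \<Union>(E ` S) \<and> \<pi> (SOME u. u \<in> \<Union>(E ` S) \<and> \<pi> u = \<pi> v) = \<pi> v"
        by (rule someI[of _ v]) (use that in simp)
      then have "c (SOME u. u \<in> \<Union>(E ` S) \<and> \<pi> u = \<pi> v) = c v"
        using that by (intro c(2)) auto
      then show ?thesis using that unfolding d_def by auto
    qed
    have "d i < n" for i using c(1) unfolding d_def by simp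
    then obtain s a where s: "s \<subseteq> {..<?a}" "card s = k" "\<forall>i\<in>s. d i = a"
      using pigeonhole_subset[of n k d] by blast
    then have "s \<in> S" unfolding S_def by simp
    moreover have "c v = a" if v: "v \<in> E s" for v
    proof -
      have "\<pi> v \<in> s" using v unfolding E_def \<pi>_def by auto
      moreover have "v \<in> \<Union>(E ` S)" using v \<open>s \<in> S\<close> by blast
      ultimately show ?thesis using d[of v] s(3) by simp
    qed
    ultimately show ?thesis by (intro bexI[of _ "E s"] exI[of _ a]) auto
  qed
  have "partite_system n k ?a N 0 (\<Union>(E ` S)) \<pi> (E ` S)"
    by (rule partite_systemI[OF fin subset_Pow_Union part unif sp mono])
  then show ?thesis by blast
qed

text \<open>Part \<open>j\<close> is replaced by the vertices of a sparse hypergraph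
  \<open>H\<close> whose edges are as large as that part. Each edge \<open>h\<close> of
  \<open>H\<close> carries its own copy of the system, with part \<open>j\<close> placed on
  \<open>h\<close>. Some \<open>h\<close> is monochromatic, and on its copy the colouring is
  constant on part \<open>j\<close> as well, so the old system applies. By
  \<open>sparse_amalgam\<close>, sparsity \<open>N\<close> of \<open>H\<close> is enough.\<close>

lemma partite_system_Suc:
  assumes P: "partite_system n k a (Suc N) j W \<pi> F"
    and hyp: "\<And>m. m \<ge> 1 \<Longrightarrow> \<exists>H :: nat set set. finite H \<and> (\<forall>e\<in>H. card e = m) \<and> forces_mono n H \<and> sparse N H"
  shows "\<exists>W \<pi> F. partite_system n k a (Suc N) (Suc j) W \<pi> F"
proof -
  have P': "finite W" "F \<subseteq> Pow W" "\<forall>v\<in>W. \<pi> v < a" "\<forall>e\<in>F. card e = k \<and> inj_on \<pi> e" "sparse (Suc N) F"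
    "\<And>c. \<forall>v. c v < n \<Longrightarrow> \<forall>u\<in>W. \<forall>v\<in>W. \<pi> u = \<pi> v \<and> j \<le> \<pi> u \<longrightarrow> c u = c v \<Longrightarrow>
        \<exists>e\<in>F. \<exists>a::nat. \<forall>v\<in>e. c v = a"
    using P unfolding partite_system_def by blast+
  define X where "X = {v \<in> W. \<pi> v = j}"
  show ?thesis
  proof (cases "X = {}")
    case True
    then have j: "Suc j \<le> \<pi> v" if "v \<in> W" "j \<le> \<pi> v" for v
      using that unfolding X_def by (auto simp: le_eq_less_or_eq)
    have "partite_system n k a (Suc N) (Suc j) W \<pi> F"
    proof (rule partite_systemI)
      fix c :: "nat \<Rightarrow> nat"
      assume c: "\<And>v. c v < n"
        "\<And>u v. u \<in> W \<Longrightarrow> v \<in> W \<Longrightarrow> \<pi> u = \<pi> v \<Longrightarrow> Suc j \<le> \<pi> u \<Longrightarrow> c u = c v"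
      show "\<exists>e\<in>F. \<exists>a. \<forall>v\<in>e. c v = a"
      proof (rule P'(6))
        show "\<forall>u\<in>W. \<forall>v\<in>W. \<pi> u = \<pi> v \<and> j \<le> \<pi> u \<longrightarrow> c u = c v" using c(2) j by blast
      qed (use c(1) in blast)
    qed (use P' in auto)
    then show ?thesis by blast
  next
    case False
    have finX: "finite X" using P'(1) unfolding X_def by simp
    then have "card X \<ge> 1" using False by (simp add: Suc_leI card_gt_0_iff)
    then obtain H :: "nat set set" where H: "finite H" "\<forall>e\<in>H. card e = card X" "forces_mono n H" "sparse N H"
      using hyp by blast
    have finh: "finite h" if "h \<in> H" for h
      using H(2) that \<open>card X \<ge> 1\<close> by (metis card.infinite not_one_le_zero)
    have "\<exists>b. bij_betw b X h" if "h \<in> H" for h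
      using finite_same_card_bij[OF finX finh[OF that]] H(2) that by simp
    then obtain \<beta> where \<beta>: "\<And>h. h \<in> H \<Longrightarrow> bij_betw (\<beta> h) X h" by metis
    obtain code :: "nat set \<Rightarrow> nat" where code: "inj_on code H"
      using finite_imp_inj_to_nat_seg[OF H(1)] by blast
    \<comment> \<open>The tag \<open>0\<close> marks the shared points on part \<open>j\<close>; the
      tag \<open>Suc (code h)\<close> keeps the other vertices of different copies apart.\<close>
    define \<iota> where "\<iota> x = prod_encode (0, x)" for x
    define \<tau> where "\<tau> h v = (if \<pi> v = j then \<iota> (\<beta> h v) else prod_encode (Suc (code h), v))" for h v
    define \<pi>' where "\<pi>' x = (case prod_decode x of (i, v) \<Rightarrow> if i = 0 then j else \<pi> v)" for x
    have \<pi>': "\<pi>' (\<tau> h v) = \<pi> v" for h v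
      unfolding \<pi>'_def \<tau>_def \<iota>_def by simp
    have \<tau>\<iota>: "\<tau> h v \<in> range \<iota> \<longleftrightarrow> \<pi> v = j" for h v
      unfolding \<tau>_def \<iota>_def by auto
    have inj: "inj_on (\<tau> h) W" if "h \<in> H" for h
      using \<beta>[OF that] unfolding bij_betw_def inj_on_def X_def \<tau>_def \<iota>_def by auto
    let ?F = "{\<tau> h ` e | h e. h \<in> H \<and> e \<in> F}"
    let ?W = "\<Union>h\<in>H. \<tau> h ` W"
    have sp: "sparse (Suc N) ?F"
    proof (rule sparse_amalgam[where W = W and \<iota> = \<iota>])
      fix h h' u v
      assume *: "h \<in> H" "h' \<in> H" "h \<noteq> h'" "u \<in> W" "v \<in> W" "\<tau> h u = \<tau> h' v"
      have "code h \<noteq> code h'" using code * unfolding inj_on_def by blast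
      then have "\<pi> u = j" "\<pi> v = j" "\<beta> h u = \<beta> h' v"
        using *(6) unfolding \<tau>_def \<iota>_def by (auto split: if_splits)
      moreover then have "u \<in> X" "v \<in> X" using * unfolding X_def by auto
      then have "\<beta> h u \<in> h" "\<beta> h' v \<in> h'"
        using bij_betwE[OF \<beta>[OF *(1)]] bij_betwE[OF \<beta>[OF *(2)]] by blast+
      ultimately show "\<exists>x\<in>h \<inter> h'. \<tau> h u = \<iota> x"
        unfolding \<tau>_def by auto
    next
      fix h e u v
      assume "h \<in> H" "e \<in> F" "u \<in> e" "v \<in> e" "\<tau> h u \<in> range \<iota>" "\<tau> h v \<in> range \<iota>"
      then show "u = v" using \<tau>\<iota> P'(4) unfolding inj_on_def by metis
    next
      show "inj \<iota>" unfolding \<iota>_def inj_def by simp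
    qed (use inj P' H in auto)
    have fin: "finite ?W" using H(1) P'(1) by blast
    have sub: "?F \<subseteq> Pow ?W" using P'(2) by blast
    have part: "\<pi>' v < a" if "v \<in> ?W" for v using that \<pi>' P'(3) by auto
    have unif: "card f = k \<and> inj_on \<pi>' f" if f: "f \<in> ?F" for f
    proof -
      obtain h e where he: "h \<in> H" "e \<in> F" "f = \<tau> h ` e" using f by blast
      have "inj_on (\<tau> h) e" using inj[OF he(1)] P'(2) he(2) inj_on_subset by blast
      then have "card f = k" using P'(4) he(2,3) by (simp add: card_image)
      moreover have "inj_on \<pi>' f"
        unfolding he(3) using P'(4) he(2) \<pi>' by (auto simp: inj_on_def)
      ultimately show ?thesis by blast
    qed
    have mono: "\<exists>f\<in>?F. \<exists>a. \<forall>v\<in>f. c v = a"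
      if c: "\<And>v. c v < n" "\<And>u v. u \<in> ?W \<Longrightarrow> v \<in> ?W \<Longrightarrow> \<pi>' u = \<pi>' v \<Longrightarrow> Suc j \<le> \<pi>' u \<Longrightarrow> c u = c v" for c :: "nat \<Rightarrow> nat"
    proof -
      have "\<forall>v. (c \<circ> \<iota>) v < n" using c(1) by simp
      then obtain h b where h: "h \<in> H" "\<forall>x\<in>h. (c \<circ> \<iota>) x = b" using H(3) unfolding forces_mono_def by blast
      have "c (\<tau> h u) = c (\<tau> h v)" if uv: "u \<in> W" "v \<in> W" "\<pi> u = \<pi> v" "j \<le> \<pi> u" for u v
      proof (cases "\<pi> u = j")
        case True
        then have "\<beta> h u \<in> h" "\<beta> h v \<in> h"
          using \<beta>[OF h(1)] uv unfolding bij_betw_def X_def by auto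
        then show ?thesis using True uv h(2) unfolding \<tau>_def by simp
      next
        case False
        then have "\<pi>' (\<tau> h u) = \<pi>' (\<tau> h v)" "Suc j \<le> \<pi>' (\<tau> h u)" using uv \<pi>' by auto
        moreover have "\<tau> h u \<in> ?W" "\<tau> h v \<in> ?W" using h(1) uv by blast+
        ultimately show ?thesis using c(2) by blast
      qed
      then have "\<exists>e\<in>F. \<exists>a. \<forall>v\<in>e. c (\<tau> h v) = a"
        using c(1) by (intro P'(6)) blast+
      then obtain e b' where "e \<in> F" "\<forall>v\<in>e. c (\<tau> h v) = b'" by blast
      then show ?thesis using h(1) by (intro bexI[of _ "\<tau> h ` e"]) auto
    qed
    have "partite_system n k a (Suc N) (Suc j) ?W \<pi>' ?F"
      by (rule partite_systemI[OF fin sub part unif sp mono])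
    then show ?thesis by blast
  qed
qed

text \<open>This is the amalgamation method of Nesetril and Rodl. The induction on \<open>N\<close>
  runs over all edge sizes simultaneously, because the step uses hypergraphs whose edge sizes are
  the uncontrolled sizes of the parts.\<close>

theorem ex_sparse_hypergraph:
  assumes "k \<ge> 1"
  shows "\<exists>H :: nat set set. finite H \<and> (\<forall>e\<in>H. card e = k) \<and> forces_mono n H \<and> sparse N H"
  using assms
proof (induction N arbitrary: k)
  case 0
  define H where "H = {s. s \<subseteq> {..<n * k + 1} \<and> card s = k}"
  have "forces_mono n H"
    unfolding forces_mono_def
  proof (intro allI impI)
    fix c :: "nat \<Rightarrow> nat" assume "\<forall>v. c v < n"
    then obtain s where "s \<subseteq> {..<n * k + 1}" "card s = k" "\<exists>a. \<forall>i\<in>s. c i = a"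
      using pigeonhole_subset[of n k c] by blast
    then show "\<exists>e\<in>H. \<exists>a. \<forall>v\<in>e. c v = a" unfolding H_def by blast
  qed
  moreover have "finite H" "\<forall>e\<in>H. card e = k" unfolding H_def by auto
  \<comment> \<open>No nonempty finite family has at most \<open>0\<close> members.\<close>
  moreover have "sparse 0 H" unfolding sparse_def by auto
  ultimately show ?case by blast
next
  case (Suc N)
  note hyp = Suc.IH
  let ?a = "n * k + 1"
  have "\<exists>W \<pi> F. partite_system n k ?a (Suc N) j W \<pi> F" for j
  proof (induction j)
    case 0
    then show ?case by (rule partite_system_0)
  next
    case (Suc j)
    then obtain W \<pi> F where "partite_system n k ?a (Suc N) j W \<pi> F" by blast
    then show ?case using hyp by (rule partite_system_Suc)
  qed
  \<comment> \<open>All parts have an index below \<open>?a\<close>, so at \<open>j = ?a\<close>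
    colourings are no longer restricted.\<close>
  then obtain W \<pi> F where P: "partite_system n k ?a (Suc N) ?a W \<pi> F" by blast
  then have W: "\<forall>v\<in>W. \<pi> v < ?a" "finite W" "F \<subseteq> Pow W" "\<forall>e\<in>F. card e = k" "sparse (Suc N) F"
    unfolding partite_system_def by blast+
  have "finite F" using W(2,3) finite_subset by blast
  moreover have "forces_mono n F"
    unfolding forces_mono_def
  proof (intro allI impI)
    fix c :: "nat \<Rightarrow> nat" assume "\<forall>v. c v < n"
    moreover have "\<forall>u\<in>W. \<forall>v\<in>W. \<pi> u = \<pi> v \<and> ?a \<le> \<pi> u \<longrightarrow> c u = c v"
      using W(1) by (meson not_le)
    ultimately show "\<exists>e\<in>F. \<exists>a. \<forall>v\<in>e. c v = a"
      using P unfolding partite_system_def by blast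
  qed
  ultimately show ?case using W by blast
qed

section \<open>Locally acyclic graphs of large chromatic number\<close>

text \<open>Acyclicity in terms of leaves: every nonempty set of edges contains one with an end that
  no other edge of the set touches. This is the edge removed in inductions.\<close>

definition forest :: "'a rel \<Rightarrow> bool" where
  "forest E \<longleftrightarrow> (\<forall>E0\<subseteq>E. E0 \<noteq> {} \<longrightarrow> (\<exists>(u, v)\<in>E0. \<exists>z. {u, v} \<inter> Field (E0 - {(u, v)}) \<subseteq> {z}))"

theorem ex_locally_forest:
  "\<exists>E :: nat rel. edge_set E \<and> \<not> colorable n E \<and> (\<forall>E0\<subseteq>E. card E0 \<le> N \<longrightarrow> forest E0)"
proof -
  obtain H :: "nat set set" where H: "finite H" "\<forall>e\<in>H. card e = 2" "forces_mono n H" "sparse N H"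
    using ex_sparse_hypergraph[of 2 n N] by auto
  define E where "E = {(u, v). u < v \<and> {u, v} \<in> H}"
  define g where "g = (\<lambda>(u, v). {u, v :: nat})"
  have inj: "inj_on g E" unfolding g_def E_def inj_on_def by (auto simp: doubleton_eq_iff)
  have gE: "g ` E \<subseteq> H" unfolding g_def E_def by auto
  have finE: "finite E" using inj gE H(1) by (meson finite_imageD finite_subset)
  have "edge_set E" using finE unfolding edge_set_def E_def by auto
  moreover have "\<not> colorable n E"
  proof
    assume "colorable n E"
    then obtain c where c: "\<forall>v. c v < n" "\<forall>(u, v)\<in>E. c u \<noteq> c v" unfolding colorable_def by blast
    then obtain e a where e: "e \<in> H" "\<forall>v\<in>e. c v = a" using H(3) unfolding forces_mono_def by blast
    obtain u v where "e = {u, v}" "u \<noteq> v" using H(2) e(1) by (meson card_2_iff)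
    then obtain u v where "e = {u, v}" "u < v" by (metis insert_commute linorder_neqE_nat)
    then have "(u, v) \<in> E" "c u = a" "c v = a" using e unfolding E_def by auto
    then show False using c(2) by auto
  qed
  moreover have "forest E0" if E0: "E0 \<subseteq> E" "card E0 \<le> N" for E0
    unfolding forest_def
  proof (intro allI impI)
    fix E1 assume E1: "E1 \<subseteq> E0" "E1 \<noteq> {}"
    have fin: "finite E0" "finite E1" using finE E0 E1 by (meson finite_subset)+
    have sub: "E1 \<subseteq> E" using E1 E0 by blast
    have "card (g ` E1) \<le> N"
      using card_image_le[OF fin(2), of g] card_mono[OF fin(1) E1(1)] E0(2) by linarith
    then obtain f z where f: "f \<in> g ` E1" "f \<inter> (\<Union>(g ` E1 - {f}) \<union> {0}) \<subseteq> {z}"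
      using sparseD[OF H(4), of "g ` E1" "{0}"] gE sub E1(2) fin(2) by blast
    obtain u v where uv: "(u, v) \<in> E1" "f = {u, v}" using f(1) unfolding g_def by auto
    have "Field (E1 - {(u, v)}) \<subseteq> \<Union>(g ` E1 - {f})"
    proof
      fix x assume "x \<in> Field (E1 - {(u, v)})"
      then obtain y where y: "y \<in> E1" "y \<noteq> (u, v)" "x \<in> g y"
        unfolding Field_def g_def by force
      then have "g y \<noteq> g (u, v)" using inj sub uv(1) unfolding inj_on_def by blast
      then show "x \<in> \<Union>(g ` E1 - {f})" using y uv(2) unfolding g_def by auto
    qed
    then have "{u, v} \<inter> Field (E1 - {(u, v)}) \<subseteq> {z}" using f(2) uv(2) by blast
    then show "\<exists>(u, v)\<in>E1. \<exists>z. {u, v} \<inter> Field (E1 - {(u, v)}) \<subseteq> {z}" using uv(1) by blast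
  qed
  ultimately show ?thesis by blast
qed

section \<open>Colourings of forests\<close>

lemma arrowsD: "arrows E D D' \<Longrightarrow> R \<subseteq> E \<Longrightarrow> embeds D R \<or> embeds D' (E - R)"
  unfolding arrows_def by blast

lemma forest_subset: "forest E \<Longrightarrow> E0 \<subseteq> E \<Longrightarrow> forest E0"
  unfolding forest_def by (meson order_trans)

text \<open>A rooting of the forest: \<open>r\<close> increases from parent to child, and the last
  conjunct makes parents unique. A label is passed on by \<open>dr\<close> to a child on the right
  and by \<open>dl\<close> to a child on the left, which covers the rules behind all three
  colourings. For the proof, a leaf edge is taken off and its free end becomes a child of the other
  end.\<close>

lemma forest_labelling:
  fixes E :: "'a rel" and dl dr :: "'s \<Rightarrow> 's"
  assumes "finite E" "forest E" "irrefl E"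
  shows "\<exists>(r :: 'a \<Rightarrow> nat) s.
    (\<forall>(u, v)\<in>E. (r u < r v \<and> s v = dr (s u)) \<or> (r v < r u \<and> s u = dl (s v))) \<and>
    (\<forall>w x y. (x, w) \<in> E \<union> E\<inverse> \<longrightarrow> (y, w) \<in> E \<union> E\<inverse> \<longrightarrow> r x < r w \<longrightarrow> r y < r w \<longrightarrow> x = y)"
  using assms
proof (induction E rule: finite_psubset_induct)
  case (psubset E)
  show ?case
  proof (cases "E = {}")
    case False
    then obtain u v z where uv: "(u, v) \<in> E" "{u, v} \<inter> Field (E - {(u, v)}) \<subseteq> {z}"
      using psubset.prems(1) unfolding forest_def by blast
    define E' where "E' = E - {(u, v)}"
    have E: "E = insert (u, v) E'" "u \<noteq> v"
      using uv psubset.prems(2) unfolding E'_def irrefl_def by auto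
    have "E' \<subset> E" "forest E'" "irrefl E'"
      using uv(1) psubset.prems(2) forest_subset[OF psubset.prems(1), of "E - {(u, v)}"]
      unfolding E'_def irrefl_def by auto
    then obtain r :: "'a \<Rightarrow> nat" and s
      where rs: "\<And>a b. (a, b) \<in> E' \<Longrightarrow> (r a < r b \<and> s b = dr (s a)) \<or> (r b < r a \<and> s a = dl (s b))"
        "\<And>w x y. (x, w) \<in> E' \<union> E'\<inverse> \<Longrightarrow> (y, w) \<in> E' \<union> E'\<inverse> \<Longrightarrow> r x < r w \<Longrightarrow> r y < r w \<Longrightarrow> x = y"
      using psubset.IH[of E'] by blast
    consider (v) "v \<notin> Field E'" | (u) "u \<notin> Field E'" using uv E(2) unfolding E'_def by blast
    then show ?thesis
    proof cases
      case v
      then have v': "(x, v) \<notin> E'" "(v, x) \<notin> E'" for x by (auto intro: FieldI1 FieldI2)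
      show ?thesis
      proof (intro exI[of _ "r(v := Suc (r u))"] exI[of _ "s(v := dr (s u))"] conjI)
        show "\<forall>(a, b)\<in>E. ((r(v := Suc (r u))) a < (r(v := Suc (r u))) b \<and> (s(v := dr (s u))) b = dr ((s(v := dr (s u))) a)) \<or>
            ((r(v := Suc (r u))) b < (r(v := Suc (r u))) a \<and> (s(v := dr (s u))) a = dl ((s(v := dr (s u))) b))"
          using rs(1) v' E by fastforce
        show "\<forall>w x y. (x, w) \<in> E \<union> E\<inverse> \<longrightarrow> (y, w) \<in> E \<union> E\<inverse> \<longrightarrow>
            (r(v := Suc (r u))) x < (r(v := Suc (r u))) w \<longrightarrow> (r(v := Suc (r u))) y < (r(v := Suc (r u))) w \<longrightarrow> x = y"
        proof (intro allI impI)
          fix w x y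
          assume a: "(x, w) \<in> E \<union> E\<inverse>" "(y, w) \<in> E \<union> E\<inverse>"
            "(r(v := Suc (r u))) x < (r(v := Suc (r u))) w" "(r(v := Suc (r u))) y < (r(v := Suc (r u))) w"
          show "x = y"
          proof (cases "w = v")
            case True
            then show ?thesis using a(1,2) v' E by auto
          next
            case False
            then have "x \<noteq> v" "y \<noteq> v" using a v' E by auto
            then show ?thesis using False a E by (intro rs(2)[of x w y]) auto
          qed
        qed
      qed
    next
      case u
      then have u': "(x, u) \<notin> E'" "(u, x) \<notin> E'" for x by (auto intro: FieldI1 FieldI2)
      show ?thesis
      proof (intro exI[of _ "r(u := Suc (r v))"] exI[of _ "s(u := dl (s v))"] conjI)
        show "\<forall>(a, b)\<in>E. ((r(u := Suc (r v))) a < (r(u := Suc (r v))) b \<and> (s(u := dl (s v))) b = dr ((s(u := dl (s v))) a)) \<or>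
            ((r(u := Suc (r v))) b < (r(u := Suc (r v))) a \<and> (s(u := dl (s v))) a = dl ((s(u := dl (s v))) b))"
          using rs(1) u' E by fastforce
        show "\<forall>w x y. (x, w) \<in> E \<union> E\<inverse> \<longrightarrow> (y, w) \<in> E \<union> E\<inverse> \<longrightarrow>
            (r(u := Suc (r v))) x < (r(u := Suc (r v))) w \<longrightarrow> (r(u := Suc (r v))) y < (r(u := Suc (r v))) w \<longrightarrow> x = y"
        proof (intro allI impI)
          fix w x y
          assume a: "(x, w) \<in> E \<union> E\<inverse>" "(y, w) \<in> E \<union> E\<inverse>"
            "(r(u := Suc (r v))) x < (r(u := Suc (r v))) w" "(r(u := Suc (r v))) y < (r(u := Suc (r v))) w"
          show "x = y"
          proof (cases "w = u")
            case True
            then show ?thesis using a(1,2) u' E by auto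
          next
            case False
            then have "x \<noteq> u" "y \<noteq> u" using a u' E by auto
            then show ?thesis using False a E by (intro rs(2)[of x w y]) auto
          qed
        qed
      qed
    qed
  qed auto
qed

lemma edge_set_irrefl: "edge_set E \<Longrightarrow> irrefl E"
  unfolding edge_set_def irrefl_def by auto

lemma forest_labellingE:
  fixes E :: "'a::linorder rel" and dl dr :: "'s \<Rightarrow> 's"
  assumes "edge_set E" "forest E"
  obtains r :: "'a \<Rightarrow> nat" and s where
    "\<And>u v. (u, v) \<in> E \<Longrightarrow> (r u < r v \<and> s v = dr (s u)) \<or> (r v < r u \<and> s u = dl (s v))"
    "\<And>w x y. (x, w) \<in> E \<union> E\<inverse> \<Longrightarrow> (y, w) \<in> E \<union> E\<inverse> \<Longrightarrow> r x < r w \<Longrightarrow> r y < r w \<Longrightarrow> x = y"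
proof -
  have "finite E" using assms(1) unfolding edge_set_def by blast
  from forest_labelling[OF this assms(2) edge_set_irrefl[OF assms(1)], of dr dl] show ?thesis
  proof (elim exE conjE)
    fix r :: "'a \<Rightarrow> nat" and s
    assume "\<forall>(u, v)\<in>E. (r u < r v \<and> s v = dr (s u)) \<or> (r v < r u \<and> s u = dl (s v))"
      "\<forall>w x y. (x, w) \<in> E \<union> E\<inverse> \<longrightarrow> (y, w) \<in> E \<union> E\<inverse> \<longrightarrow> r x < r w \<longrightarrow> r y < r w \<longrightarrow> x = y"
    then show ?thesis by (intro that[of r s]) blast+
  qed
qed

lemma strict_mono_on_Field_eqD:
  fixes f :: "'a::linorder \<Rightarrow> 'b::linorder"
  assumes "strict_mono_on (Field D) f" "f u = f v" "u \<in> Field D" "v \<in> Field D"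
  shows "u = v"
  using strict_mono_on_imp_inj_on[OF assms(1)] assms(2-4) unfolding inj_on_def by blast

lemma embeds_single_valued:
  assumes "embeds D R" "single_valued R"
  shows "single_valued D"
proof -
  obtain f where f: "strict_mono_on (Field D) f" "\<And>u v. (u, v) \<in> D \<Longrightarrow> (f u, f v) \<in> R"
    using assms(1) unfolding embeds_def by blast
  show ?thesis
  proof (rule single_valuedI)
    fix x y z assume xy: "(x, y) \<in> D" "(x, z) \<in> D"
    then have "f y = f z" using f(2) assms(2) unfolding single_valued_def by blast
    then show "y = z" using strict_mono_on_Field_eqD[OF f(1)] xy by (auto intro: FieldI2)
  qed
qed

lemma embeds_single_valued_converse:
  assumes "embeds D R" "single_valued (R\<inverse>)"
  shows "single_valued (D\<inverse>)"
proof -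
  obtain f where f: "strict_mono_on (Field D) f" "\<And>u v. (u, v) \<in> D \<Longrightarrow> (f u, f v) \<in> R"
    using assms(1) unfolding embeds_def by blast
  show ?thesis
  proof (rule single_valuedI)
    fix x y z assume xy: "(x, y) \<in> D\<inverse>" "(x, z) \<in> D\<inverse>"
    then have "f y = f z" using f(2) assms(2) unfolding single_valued_def by blast
    then show "y = z" using strict_mono_on_Field_eqD[OF f(1)] xy by (auto intro: FieldI1)
  qed
qed

lemma embeds_relcomp_empty:
  assumes "embeds D R" "R O R = {}"
  shows "D O D = {}"
  using assms unfolding embeds_def relcomp_unfold by fast

definition connected_edges :: "'a rel \<Rightarrow> bool" where
  "connected_edges D \<longleftrightarrow> (\<forall>u\<in>Field D. \<forall>v\<in>Field D. (u, v) \<in> (D \<union> D\<inverse>)\<^sup>*)"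

text \<open>An edge is red if its right end is the parent of its left end. As parents are unique, no
  vertex has two red edges to the right or two blue edges to the left.\<close>

lemma forest_arrows_single_valued:
  assumes "edge_set E" "forest E" "arrows E D D'"
  shows "single_valued D \<or> single_valued (D'\<inverse>)"
proof -
  obtain r :: "_ \<Rightarrow> nat" and s :: "_ \<Rightarrow> unit"
    where s: "\<And>u v. (u, v) \<in> E \<Longrightarrow> (r u < r v \<and> s v = id (s u)) \<or> (r v < r u \<and> s u = id (s v))"
      and uniq: "\<And>w x y. (x, w) \<in> E \<union> E\<inverse> \<Longrightarrow> (y, w) \<in> E \<union> E\<inverse> \<Longrightarrow> r x < r w \<Longrightarrow> r y < r w \<Longrightarrow> x = y"
    by (rule forest_labellingE[OF assms(1,2), where dr = id and dl = id]) (rule that)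
  have r: "r u < r v \<or> r v < r u" if "(u, v) \<in> E" for u v using s[OF that] by blast
  define R where "R = {(u, v) \<in> E. r v < r u}"
  have "single_valued R" unfolding R_def single_valued_def using uniq by blast
  moreover have "single_valued ((E - R)\<inverse>)"
    unfolding R_def single_valued_def using r uniq by blast
  moreover have "R \<subseteq> E" unfolding R_def by blast
  ultimately show ?thesis
    using arrowsD[OF assms(3)] embeds_single_valued embeds_single_valued_converse by blast
qed

text \<open>Here \<open>s\<close> is a proper 2-colouring of the vertices and an edge is coloured by
  its left end, so consecutive edges of an increasing path get different colours.\<close>

lemma forest_arrows_relcomp_empty:
  assumes "edge_set E" "forest E" "arrows E D D'"
  shows "D O D = {} \<or> D' O D' = {}"
proof -
  obtain r :: "_ \<Rightarrow> nat" and s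
    where s: "\<And>u v. (u, v) \<in> E \<Longrightarrow> (r u < r v \<and> s v = (\<not> s u)) \<or> (r v < r u \<and> s u = (\<not> s v))"
    by (rule forest_labellingE[OF assms(1,2), where dr = Not and dl = Not]) blast
  define R where "R = {(u, v) \<in> E. s u}"
  have "R O R = {}" "(E - R) O (E - R) = {}" unfolding R_def using s by fast+
  moreover have "R \<subseteq> E" unfolding R_def by blast
  ultimately show ?thesis
    using arrowsD[OF assms(3), of R] embeds_relcomp_empty[of D R] embeds_relcomp_empty[of D' "E - R"] by argo
qed

text \<open>
  Call a vertex of a rooted forest an out-vertex or an in-vertex. Every left child is made an
  out-vertex, every right child an in-vertex, and an edge is red if it goes from an out-vertex
  (on the left) to an in-vertex. A blue component then has vertices of one kind only, so that the
  parent of each of its vertices always lies on the same side.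
\<close>

lemma forest_arrows_single_valued_or_relcomp_empty:
  assumes "edge_set E" "forest E" "arrows E D D'" "connected_edges D'"
  shows "D O D = {} \<or> single_valued D' \<or> single_valued (D'\<inverse>)"
proof -
  obtain r :: "_ \<Rightarrow> nat" and out
    where s: "\<And>u v. (u, v) \<in> E \<Longrightarrow> (r u < r v \<and> out v = False) \<or> (r v < r u \<and> out u = True)"
      and r: "\<And>w x y. (x, w) \<in> E \<union> E\<inverse> \<Longrightarrow> (y, w) \<in> E \<union> E\<inverse> \<Longrightarrow> r x < r w \<Longrightarrow> r y < r w \<Longrightarrow> x = y"
    by (rule forest_labellingE[OF assms(1,2), where dr = "\<lambda>_. False" and dl = "\<lambda>_. True"]) (rule that)
  define R where "R = {(u, v) \<in> E. out u \<and> \<not> out v}"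
  have "R \<subseteq> E" unfolding R_def by blast
  then consider "embeds D R" | "embeds D' (E - R)" using arrowsD[OF assms(3)] by blast
  then show ?thesis
  proof cases
    case 1
    moreover have "R O R = {}" unfolding R_def by auto
    ultimately show ?thesis using embeds_relcomp_empty by blast
  next
    case 2
    then obtain f where f: "strict_mono_on (Field D') f" "\<And>u v. (u, v) \<in> D' \<Longrightarrow> (f u, f v) \<in> E - R"
      unfolding embeds_def by blast
    have same: "out (f u) = out (f v)" if "(u, v) \<in> D'" for u v
      using f(2)[OF that] s unfolding R_def by blast
    have const: "out (f u) = out (f v)" if "u \<in> Field D'" "v \<in> Field D'" for u v
    proof -
      have "(u, v) \<in> (D' \<union> D'\<inverse>)\<^sup>*" using assms(4) that unfolding connected_edges_def by blast
      then show ?thesis by (induction rule: rtrancl_induct) (use same in auto)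
    qed
    let ?A = "{(u, v) \<in> E. r u < r v}" and ?B = "{(u, v) \<in> E. r v < r u}"
    have "embeds D' ?A \<or> embeds D' ?B"
    proof (cases "\<exists>u\<in>Field D'. out (f u)")
      case True
      then have "r (f v) < r (f u)" if "(u, v) \<in> D'" for u v
        using s[of "f u" "f v"] f(2)[OF that] const that by (meson DiffD1 FieldI2)
      then have "embeds D' ?B" unfolding embeds_def using f by (intro exI[of _ f]) auto
      then show ?thesis by blast
    next
      case False
      then have "r (f u) < r (f v)" if "(u, v) \<in> D'" for u v
        using s[of "f u" "f v"] f(2)[OF that] that by (meson DiffD1 FieldI1)
      then have "embeds D' ?A" unfolding embeds_def using f by (intro exI[of _ f]) auto
      then show ?thesis by blast
    qed
    moreover have "single_valued (?A\<inverse>)" "single_valued ?B" unfolding single_valued_def using r by blast+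
    ultimately show ?thesis using embeds_single_valued embeds_single_valued_converse by blast
  qed
qed

lemma right_star_edges:
  assumes "D O D = {}" "single_valued (D\<inverse>)" "connected_edges D" "D \<noteq> {}" "edge_set D"
  shows "\<exists>c. D = {c} \<times> (Field D - {c})"
proof -
  obtain c x where cx: "(c, x) \<in> D" using assms(4) by auto
  have left: "c \<in> Field D" using cx by (auto intro: FieldI1)
  have reach: "y = c \<or> (c, y) \<in> D" if y: "y \<in> Field D" for y
  proof -
    have "(c, y) \<in> (D \<union> D\<inverse>)\<^sup>*" using assms(3) y left unfolding connected_edges_def by blast
    then show ?thesis
    proof (induction rule: rtrancl_induct)
      case (step y z)
      then show ?case using assms(1,2) cx unfolding single_valued_def relcomp_unfold by blast
    qed simp
  qed
  have "D = {c} \<times> (Field D - {c})"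
  proof (intro equalityI subrelI)
    fix u v assume uv: "(u, v) \<in> D"
    then have "u < v" using assms(5) unfolding edge_set_def by auto
    have "u = c" using reach[of u] uv assms(1) by (auto intro: FieldI1)
    then show "(u, v) \<in> {c} \<times> (Field D - {c})" using uv \<open>u < v\<close> by (auto intro: FieldI2)
  next
    fix u v assume "(u, v) \<in> {c} \<times> (Field D - {c})"
    then show "(u, v) \<in> D" using reach by auto
  qed
  then show ?thesis by blast
qed

lemma left_star_edges:
  assumes "D O D = {}" "single_valued D" "connected_edges D" "D \<noteq> {}" "edge_set D"
  shows "\<exists>c. D = (Field D - {c}) \<times> {c}"
proof -
  obtain c x where cx: "(x, c) \<in> D" using assms(4) by auto
  have left: "c \<in> Field D" using cx by (auto intro: FieldI2)
  have reach: "y = c \<or> (y, c) \<in> D" if y: "y \<in> Field D" for y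
  proof -
    have "(c, y) \<in> (D \<union> D\<inverse>)\<^sup>*" using assms(3) y left unfolding connected_edges_def by blast
    then show ?thesis
    proof (induction rule: rtrancl_induct)
      case (step y z)
      then show ?case using assms(1,2) cx unfolding single_valued_def relcomp_unfold by blast
    qed simp
  qed
  have "D = (Field D - {c}) \<times> {c}"
  proof (intro equalityI subrelI)
    fix u v assume uv: "(u, v) \<in> D"
    then have "u < v" using assms(5) unfolding edge_set_def by auto
    have "v = c" using reach[of v] uv assms(1) by (auto intro: FieldI2)
    then show "(u, v) \<in> (Field D - {c}) \<times> {c}" using uv \<open>u < v\<close> by (auto intro: FieldI1)
  next
    fix u v assume "(u, v) \<in> (Field D - {c}) \<times> {c}"
    then show "(u, v) \<in> D" using reach by auto
  qed
  then show ?thesis by blast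
qed

lemma single_valued_relcomp_nonempty:
  assumes "single_valued D" "single_valued (D\<inverse>)" "connected_edges D" "edge_set D" "card D \<ge> 2"
  shows "D O D \<noteq> {}"
proof
  assume "D O D = {}"
  moreover have "D \<noteq> {}" using assms(5) by auto
  ultimately obtain c where c: "D = {c} \<times> (Field D - {c})" using right_star_edges assms by blast
  then have "y = z" if "y \<in> D" "z \<in> D" for y z
    using that assms(1) unfolding single_valued_def by (metis SigmaE singletonD)
  then have "card D \<le> 1" by (metis card.infinite card_le_Suc0_iff_eq One_nat_def zero_le)
  then show False using assms(5) by simp
qed

text \<open>The first two colourings settle everything unless one of the graphs is an increasing
  path, that is, single-valued in both directions. Such a path has two consecutive edges, so the
  other graph has none; the third colouring then makes that one single-valued in some direction,
  hence a star.\<close>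

theorem forest_arrows_stars:
  assumes "edge_set E" "forest E" "arrows E D D'"
    and D: "connected_edges D" "edge_set D" "card D \<ge> 2"
    and D': "connected_edges D'" "edge_set D'" "card D' \<ge> 2"
  shows "(\<exists>c. D = {c} \<times> (Field D - {c})) \<and> single_valued (D'\<inverse>) \<or>
         (\<exists>c. D' = {c} \<times> (Field D' - {c})) \<and> single_valued (D\<inverse>) \<or>
         (\<exists>c. D = (Field D - {c}) \<times> {c}) \<and> single_valued D' \<or>
         (\<exists>c. D' = (Field D' - {c}) \<times> {c}) \<and> single_valued D"
proof -
  note E = assms(1,2)
  have arr: "arrows E D' D" using assms(3) arrows_commute by blast
  have ne: "D \<noteq> {}" "D' \<noteq> {}" using D(3) D'(3) by auto
  show ?thesis
    using forest_arrows_single_valued[OF E assms(3)] forest_arrows_single_valued[OF E arr]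
      forest_arrows_relcomp_empty[OF E assms(3)]
      forest_arrows_single_valued_or_relcomp_empty[OF E assms(3) D'(1)]
      forest_arrows_single_valued_or_relcomp_empty[OF E arr D(1)]
      right_star_edges[OF _ _ D(1) ne(1) D(2)] right_star_edges[OF _ _ D'(1) ne(2) D'(2)]
      left_star_edges[OF _ _ D(1) ne(1) D(2)] left_star_edges[OF _ _ D'(1) ne(2) D'(2)]
      single_valued_relcomp_nonempty[OF _ _ D] single_valued_relcomp_nonempty[OF _ _ D']
    by argo
qed

section \<open>Forks in unavoidable graphs\<close>

definition shift_graph :: "nat \<Rightarrow> (nat \<times> nat) rel" where
  "shift_graph n = {((i, j), (j, k)) | i j k. i < j \<and> j < k \<and> k < n}"

lemma edge_set_shift_graph: "edge_set (shift_graph n)"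
proof -
  have "shift_graph n \<subseteq> ({..<n} \<times> {..<n}) \<times> ({..<n} \<times> {..<n})"
    unfolding shift_graph_def by auto
  then have "finite (shift_graph n)" by (rule finite_subset) auto
  then show ?thesis unfolding edge_set_def shift_graph_def by auto
qed

text \<open>Let \<open>S i\<close> be the set of colours of pairs starting with \<open>i\<close>.
  For \<open>i < j\<close> the colour of \<open>(i, j)\<close> is in \<open>S i\<close> but cannot
  be in \<open>S j\<close>, so \<open>2 ^ k + 1\<close> different subsets of \<open>k\<close>
  colours would arise.\<close>

lemma shift_graph_not_colorable: "\<not> colorable k (shift_graph (Suc (2 ^ k)))"
proof
  let ?n = "Suc (2 ^ k)"
  assume "colorable k (shift_graph ?n)"
  then obtain c where c: "\<And>v. c v < k" "\<And>u v. (u, v) \<in> shift_graph ?n \<Longrightarrow> c u \<noteq> c v"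
    unfolding colorable_def by blast
  define S where "S i = {c (i, j) | j. i < j \<and> j < ?n}" for i
  have neq: "S i \<noteq> S j" if ij: "i < j" "j < ?n" for i j
  proof
    assume "S i = S j"
    moreover have "c (i, j) \<in> S i" using ij unfolding S_def by blast
    ultimately obtain l where l: "c (i, j) = c (j, l)" "j < l" "l < ?n" unfolding S_def by auto
    then have "((i, j), (j, l)) \<in> shift_graph ?n" using ij unfolding shift_graph_def by blast
    then show False using c(2) l(1) by blast
  qed
  have "inj_on S {..<?n}"
    by (rule linorder_inj_onI) (use neq in auto)
  moreover have "S ` {..<?n} \<subseteq> Pow {..<k}" using c(1) unfolding S_def by auto
  ultimately have "card {..<?n} \<le> card (Pow {..<k})" by (intro card_inj_on_le) auto
  then show False by (simp add: card_Pow)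
qed

section \<open>Zykov graphs with nested forks\<close>

text \<open>The opposite of the behaviour of shift graphs, where every right neighbour
  \<open>x\<close> of \<open>a\<close> lies beyond every right neighbour \<open>b\<close> of
  \<open>v\<close>.\<close>

definition nested_forks :: "'a::linorder rel \<Rightarrow> bool" where
  "nested_forks E \<longleftrightarrow>
     (\<forall>v a b x. (v, a) \<in> E \<longrightarrow> (v, b) \<in> E \<longrightarrow> (a, x) \<in> E \<longrightarrow> a < b \<longrightarrow> x < b)"

lemma nested_forks_map:
  assumes "nested_forks E" "strict_mono_on (Field E) g"
  shows "nested_forks (map_prod g g ` E)"
  unfolding nested_forks_def
proof (intro allI impI)
  fix v' a' b' x'
  assume *: "(v', a') \<in> map_prod g g ` E" "(v', b') \<in> map_prod g g ` E"
    "(a', x') \<in> map_prod g g ` E" "a' < b'"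
  obtain v a where va: "(v, a) \<in> E" "v' = g v" "a' = g a" using *(1) by auto
  obtain w b where wb: "(w, b) \<in> E" "v' = g w" "b' = g b" using *(2) by auto
  obtain d x where dx: "(d, x) \<in> E" "a' = g d" "x' = g x" using *(3) by auto
  have F: "v \<in> Field E" "a \<in> Field E" "w \<in> Field E" "b \<in> Field E" "d \<in> Field E" "x \<in> Field E"
    using va wb dx by (auto intro: FieldI1 FieldI2)
  have "v = w" "a = d"
    using strict_mono_on_Field_eqD[OF assms(2)] F va wb dx by metis+
  moreover have "a < b"
    using assms(2) F *(4) va wb unfolding strict_mono_on_def by (metis linorder_neqE order_less_asym)
  ultimately have "x < b" using assms(1) va wb dx unfolding nested_forks_def by blast
  then show "x' < b'" using assms(2) F wb dx unfolding strict_mono_on_def by blast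
qed

text \<open>Zykov's construction, with the new vertices placed to the left of the copies.\<close>

lemma ex_nested_forks_not_colorable:
  "\<exists>E :: nat rel. edge_set E \<and> nested_forks E \<and> \<not> colorable k E"
proof (induction k)
  case 0
  have "edge_set ({} :: nat rel)" "nested_forks ({} :: nat rel)" "\<not> colorable 0 ({} :: nat rel)"
    unfolding edge_set_def nested_forks_def colorable_def by auto
  then show ?case by blast
next
  case (Suc k)
  then obtain E :: "nat rel" where E: "edge_set E" "nested_forks E" "\<not> colorable k E" by blast
  \<comment> \<open>Adding \<open>0\<close> keeps \<open>W\<close> nonempty, so that tuples exist
    even if \<open>E\<close> has no edges.\<close>
  define W where "W = insert 0 (Field E)"
  have finW: "finite W" using finite_Field_edge_set E(1) unfolding W_def by simp
  define L where "L = {xs. set xs \<subseteq> W \<and> length xs = Suc k}"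
  have finL: "finite L" using finW unfolding L_def by (rule finite_lists_length_eq)
  define A where "A = {((0 :: nat, to_nat xs), (Suc i, xs ! i)) | xs i. xs \<in> L \<and> i \<le> k}"
  define B where "B = {((Suc i, x), (Suc i, y)) | i x y. i \<le> k \<and> (x, y) \<in> E}"
  have "A = (\<lambda>(xs, i). ((0, to_nat xs), (Suc i, xs ! i))) ` (L \<times> {..k})" unfolding A_def by auto
  then have finA: "finite A" using finL by simp
  have "B = (\<lambda>(i, (x, y)). ((Suc i, x), (Suc i, y))) ` ({..k} \<times> E)" unfolding B_def by force
  then have finB: "finite B" using E(1) unfolding edge_set_def by simp
  have edge: "edge_set (A \<union> B)"
    using finA finB E(1) unfolding edge_set_def A_def B_def by auto
  have nested: "nested_forks (A \<union> B)"
    unfolding nested_forks_def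
  proof (intro allI impI)
    fix v a b x
    assume *: "(v, a) \<in> A \<union> B" "(v, b) \<in> A \<union> B" "(a, x) \<in> A \<union> B" "a < b"
    have ax: "(a, x) \<in> B" using *(1,3) unfolding A_def B_def by auto
    show "x < b"
    proof (cases "(v, a) \<in> A")
      case True
      then have "(v, b) \<in> A" using *(2) unfolding A_def B_def by auto
      with True obtain xs i j where xs: "a = (Suc i, xs ! i)" "b = (Suc j, xs ! j)"
        unfolding A_def by auto
      \<comment> \<open>A new vertex has one neighbour in each copy, so \<open>a\<close> and
        \<open>b\<close> lie in different copies, and the copy of \<open>a\<close>, which contains
        \<open>x\<close>, precedes \<open>b\<close> as a whole.\<close>
      then have "i < j" using *(4) by (cases "i = j") auto
      then show ?thesis using ax xs unfolding B_def by auto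
    next
      case False
      then have "(v, a) \<in> B" "(v, b) \<in> B" using * unfolding A_def B_def by auto
      then show ?thesis using ax *(4) E(2) unfolding B_def nested_forks_def by auto
    qed
  qed
  have "\<not> colorable (Suc k) (A \<union> B)"
  proof
    assume "colorable (Suc k) (A \<union> B)"
    then obtain c where c: "\<And>v. c v < Suc k" "\<And>u v. (u, v) \<in> A \<union> B \<Longrightarrow> c u \<noteq> c v"
      unfolding colorable_def by blast
    \<comment> \<open>Colour \<open>i\<close> occurs in copy \<open>i\<close>: otherwise closing the
      gap at \<open>i\<close> by \<open>sq\<close> would colour \<open>E\<close> with
      \<open>k\<close> colours. The new vertex attached to the tuple of these vertices has no colour
      left.\<close>
    have "\<exists>x\<in>W. c (Suc i, x) = i" if i: "i \<le> k" for i
    proof (rule ccontr)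
      assume no: "\<not> ?thesis"
      define sq where "sq a = (if a > i then a - 1 else a)" for a :: nat
      define d where "d v = sq (c (Suc i, if v \<in> W then v else 0))" for v
      have W: "(if v \<in> W then v else 0) \<in> W" for v unfolding W_def by auto
      have lt: "c (Suc i, if v \<in> W then v else 0) < Suc k" "c (Suc i, if v \<in> W then v else 0) \<noteq> i" for v
        using c(1) no W[of v] by blast+
      have "d v < k" for v using lt[of v] i unfolding d_def sq_def by auto
      moreover have "d u \<noteq> d v" if uv: "(u, v) \<in> E" for u v
      proof -
        have "u \<in> W" "v \<in> W" using uv unfolding W_def by (auto intro: FieldI1 FieldI2)
        moreover have "c (Suc i, u) \<noteq> c (Suc i, v)" using c(2) uv i unfolding B_def by blast
        ultimately show ?thesis using lt(2)[of u] lt(2)[of v] unfolding d_def sq_def by auto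
      qed
      ultimately have "colorable k E" unfolding colorable_def by blast
      then show False using E(3) by contradiction
    qed
    then obtain x where x: "\<And>i. i \<le> k \<Longrightarrow> x i \<in> W \<and> c (Suc i, x i) = i" by metis
    define xs where "xs = map x [0..<Suc k]"
    have nth: "xs ! i = x i" if "i \<le> k" for i
      using that unfolding xs_def by (simp del: upt_Suc)
    have "xs \<in> L" using x unfolding L_def xs_def by (auto simp del: upt_Suc)
    define i where "i = c (0, to_nat xs)"
    have "i \<le> k" using c(1)[of "(0, to_nat xs)"] unfolding i_def by simp
    then have "((0, to_nat xs), (Suc i, xs ! i)) \<in> A \<union> B" using \<open>xs \<in> L\<close> unfolding A_def by blast
    then show False using c(2) x[OF \<open>i \<le> k\<close>] nth[OF \<open>i \<le> k\<close>] unfolding i_def by fastforce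
  qed
  moreover obtain g :: "nat \<times> nat \<Rightarrow> nat" where g: "strict_mono_on (Field (A \<union> B)) g"
    using ex_strict_mono_nat finite_Field_edge_set edge by blast
  moreover have "colorable (Suc k) (A \<union> B)" if col: "colorable (Suc k) (map_prod g g ` (A \<union> B))"
  proof -
    obtain c where c: "\<And>v. c v < Suc k" "\<And>u v. (u, v) \<in> map_prod g g ` (A \<union> B) \<Longrightarrow> c u \<noteq> c v"
      using col unfolding colorable_def by blast
    have "c (g u) \<noteq> c (g v)" if "(u, v) \<in> A \<union> B" for u v
      using c(2)[of "g u" "g v"] that by (metis map_prod_imageI)
    then show ?thesis using c(1) unfolding colorable_def by (intro exI[of _ "c \<circ> g"]) auto
  qed
  ultimately show ?case using edge_set_map[OF edge g] nested_forks_map[OF nested g] by blast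
qed

text \<open>If \<open>a < b\<close>, the copies of \<open>D\<close> in a shift graph and in a graph
  with nested forks put \<open>x\<close> on different sides of \<open>b\<close>, although both
  respect the order.\<close>

theorem unavoidable_fork:
  assumes "unavoidable D" "(v, a) \<in> D" "(v, b) \<in> D" "(a, x) \<in> D"
  shows "\<not> a < b"
proof
  assume "a < b"
  have F: "a \<in> Field D" "b \<in> Field D" "x \<in> Field D" using assms by (auto intro: FieldI1 FieldI2)
  obtain k where k: "\<And>E :: nat rel. edge_set E \<Longrightarrow> \<not> colorable k E \<Longrightarrow> embeds D E"
    using unavoidable_embeds[OF assms(1)] by blast
  obtain k' where k': "\<And>E :: (nat \<times> nat) rel. edge_set E \<Longrightarrow> \<not> colorable k' E \<Longrightarrow> embeds D E"
    using unavoidable_embeds[OF assms(1)] by blast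
  obtain E :: "nat rel" where E: "nested_forks E" "embeds D E"
    using k ex_nested_forks_not_colorable by blast
  obtain f where f: "strict_mono_on (Field D) f" "\<And>u v. (u, v) \<in> D \<Longrightarrow> (f u, f v) \<in> E"
    using E(2) unfolding embeds_def by blast
  have "f a < f b" using f(1) F \<open>a < b\<close> unfolding strict_mono_on_def by blast
  then have "f x < f b" using E(1) f(2) assms unfolding nested_forks_def by blast
  moreover obtain n where "embeds D (shift_graph n)"
    using k' edge_set_shift_graph shift_graph_not_colorable by blast
  then obtain g where g: "strict_mono_on (Field D) g" "\<And>u v. (u, v) \<in> D \<Longrightarrow> (g u, g v) \<in> shift_graph n"
    unfolding embeds_def by blast
  have "g a < g b" using g(1) F \<open>a < b\<close> unfolding strict_mono_on_def by blast
  then have "g b < g x"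
    using g(2)[OF assms(2)] g(2)[OF assms(3)] g(2)[OF assms(4)] unfolding shift_graph_def by auto
  ultimately show False
    using f(1) g(1) F unfolding strict_mono_on_def by (metis linorder_neqE order_less_asym order_less_irrefl)
qed

section \<open>Right caterpillars\<close>

text \<open>Here \<open>v\<close> is the left end of a caterpillar with \<open>m\<close> segments.
  The leftmost segment, the last one of the defining sequence, is taken off: \<open>w\<close> is its
  rightmost leaf, and any \<open>d m - 1\<close> neighbours of \<open>v\<close> before
  \<open>w\<close> serve as the other leaves. The remaining segments start at \<open>w\<close> and
  extend to its right, so the pieces are automatically disjoint.\<close>

fun caterpillar_at :: "(nat \<Rightarrow> nat) \<Rightarrow> 'a::linorder rel \<Rightarrow> nat \<Rightarrow> 'a \<Rightarrow> bool" where
  "caterpillar_at d E 0 v = True"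
| "caterpillar_at d E (Suc m) v =
     (\<exists>w. (v, w) \<in> E \<and> d m - 1 \<le> card {z. (v, z) \<in> E \<and> z < w} \<and> caterpillar_at d E m w)"

lemma caterpillar_at_cong:
  "(\<And>i. i < m \<Longrightarrow> d i = d' i) \<Longrightarrow> caterpillar_at d E m v = caterpillar_at d' E m v"
  by (induction m arbitrary: v) auto

lemma Max_Min_atLeast0AtMost: "Max {0..n :: nat} = n" "Min {0..n :: nat} = 0"
  by (auto intro: Max_eqI Min_eqI)

lemma verts_right_caterpillar [simp]: "verts (right_caterpillar ds) = {0..sum_list ds}"
proof (induction ds)
  case (Cons d ds)
  have "(\<lambda>x. sum_list ds + x) ` {0..d} = {sum_list ds..sum_list ds + d}"
    using image_add_atLeastAtMost[of "sum_list ds" 0 d] by simp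
  then have "verts (right_caterpillar (d # ds)) = {0..sum_list ds} \<union> {sum_list ds..sum_list ds + d}"
    by (simp only: right_caterpillar.simps ograph_concat_def right_star_def Let_def ograph.sel
        Cons Max_Min_atLeast0AtMost diff_zero)
  moreover have "{0..s} \<union> {s..s + d} = {0..d + s}" for s by auto
  ultimately show ?case by (simp only: sum_list.Cons)
qed (simp add: right_star_def)

lemma edges_right_caterpillar_Cons:
  "edges (right_caterpillar (d # ds)) =
     edges (right_caterpillar ds) \<union> {sum_list ds} \<times> {sum_list ds + 1..sum_list ds + d}"
proof -
  have "map_prod (\<lambda>x. sum_list ds + x) (\<lambda>x. sum_list ds + x) ` ({0} \<times> {1..d}) =
      {sum_list ds} \<times> {sum_list ds + 1..sum_list ds + d}"
  proof -
    have "map_prod (\<lambda>x. sum_list ds + x) (\<lambda>x. sum_list ds + x) ` ({0} \<times> {1..d}) =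
        (\<lambda>x. sum_list ds + x) ` {0} \<times> (\<lambda>x. sum_list ds + x) ` {1..d}"
      by (simp add: map_prod_surj_on)
    moreover have "(\<lambda>x. sum_list ds + x) ` {1..d} = {sum_list ds + 1..sum_list ds + d}"
      using image_add_atLeastAtMost[of "sum_list ds" 1 d] by (metis add.commute)
    ultimately show ?thesis by (simp only: image_insert image_empty add_0_right)
  qed
  then show ?thesis
    by (simp only: right_caterpillar.simps ograph_concat_def right_star_def Let_def ograph.sel
        verts_right_caterpillar Max_Min_atLeast0AtMost diff_zero)
qed

lemma edges_right_caterpillar_Nil: "edges (right_caterpillar []) = {}"
  by (simp add: right_star_def)

text \<open>The definition recurses on the rightmost segment, \<open>caterpillar_at\<close> on the
  leftmost one; this equation passes from one end to the other.\<close>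

lemma edges_right_caterpillar_snoc:
  "edges (right_caterpillar (ds @ [d])) =
     {0} \<times> {1..d} \<union> map_prod (\<lambda>x. d + x) (\<lambda>x. d + x) ` edges (right_caterpillar ds)"
proof (induction ds)
  case Nil
  show ?case by (simp add: edges_right_caterpillar_Cons edges_right_caterpillar_Nil del: right_caterpillar.simps)
next
  case (Cons a ds)
  let ?s = "sum_list ds"
  have "map_prod (\<lambda>x. d + x) (\<lambda>x. d + x) ` ({?s} \<times> {?s + 1..?s + a}) =
      (\<lambda>x. d + x) ` {?s} \<times> (\<lambda>x. d + x) ` {?s + 1..?s + a}"
    by (simp add: map_prod_surj_on)
  also have "\<dots> = {?s + d} \<times> {?s + d + 1..?s + d + a}"
    using image_add_atLeastAtMost[of d "?s + 1" "?s + a"] by (simp add: ac_simps)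
  finally show ?case using Cons
    by (simp add: edges_right_caterpillar_Cons image_Un Un_assoc del: right_caterpillar.simps)
qed

lemma edges_right_caterpillar_bounds:
  "(u, v) \<in> edges (right_caterpillar ds) \<Longrightarrow> u < v \<and> v \<le> sum_list ds"
  by (induction ds) (auto simp: edges_right_caterpillar_Cons edges_right_caterpillar_Nil simp del: right_caterpillar.simps)

lemma Field_right_caterpillar:
  assumes "sum_list ds \<ge> 1"
  shows "Field (edges (right_caterpillar ds)) = {0..sum_list ds}"
  using assms
proof (induction ds)
  case (Cons d ds)
  show ?case
  proof (cases "sum_list ds \<ge> 1")
    case True
    have "Field ({sum_list ds} \<times> {sum_list ds + 1..sum_list ds + d}) \<subseteq> {0..sum_list ds + d}"
      "{sum_list ds + 1..sum_list ds + d} \<subseteq> Field ({sum_list ds} \<times> {sum_list ds + 1..sum_list ds + d})"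
      by (auto simp: Field_def)
    moreover have "{0..sum_list ds + d} \<subseteq> {0..sum_list ds} \<union> {sum_list ds + 1..sum_list ds + d}"
      "{0..sum_list ds} \<subseteq> {0..sum_list ds + d}" by auto
    moreover have "Field (edges (right_caterpillar (d # ds))) =
        {0..sum_list ds} \<union> Field ({sum_list ds} \<times> {sum_list ds + 1..sum_list ds + d})"
      unfolding edges_right_caterpillar_Cons Field_Un Cons.IH[OF True] ..
    moreover have "sum_list (d # ds) = sum_list ds + d" by simp
    ultimately show ?thesis by (simp only:) blast
  next
    case False
    then have s: "sum_list ds = 0" by linarith
    have "(u, v) \<notin> edges (right_caterpillar ds)" for u v
      using edges_right_caterpillar_bounds[of u v ds] s by auto
    then have "edges (right_caterpillar ds) = {}" by auto
    moreover have d: "d \<ge> 1" using s Cons.prems unfolding sum_list.Cons by linarith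
    have "insert 0 {1..d} = {0..d}" by auto
    moreover have "Field ({0} \<times> {1..d}) = insert 0 {1..d}"
    proof
      show "insert 0 {1..d} \<subseteq> Field ({0} \<times> {1..d})"
        using d unfolding Field_def by auto
    qed (auto simp: Field_def)
    ultimately show ?thesis
      unfolding edges_right_caterpillar_Cons sum_list.Cons s by simp
  qed
qed simp

lemma ex_strict_mono_enumeration:
  assumes "finite (A :: 'a::linorder set)"
  shows "\<exists>h :: nat \<Rightarrow> 'a. strict_mono_on {..<card A} h \<and> h ` {..<card A} = A"
proof (intro exI conjI)
  let ?h = "\<lambda>i. sorted_list_of_set A ! i"
  show "strict_mono_on {..<card A} ?h"
    using assms by (auto simp: strict_mono_on_def intro!: sorted_wrt_nth_less[OF strict_sorted_list_of_set])
  have "set (sorted_list_of_set A) = A" using assms by simp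
  then show "?h ` {..<card A} = A"
    using assms by (force simp: set_conv_nth)
qed

text \<open>Prescribing the left end \<open>v\<close> of the copy lets the induction attach a new
  leftmost star to a copy that starts at \<open>w\<close>.\<close>

lemma right_caterpillar_copy_iff:
  assumes "edge_set E" "\<forall>d\<in>set ds. d \<ge> 1"
  shows "(\<exists>f. strict_mono_on {0..sum_list ds} f \<and>
             (\<forall>(u, w)\<in>edges (right_caterpillar ds). (f u, f w) \<in> E) \<and> f 0 = v) \<longleftrightarrow>
         caterpillar_at (\<lambda>i. ds ! i) E (length ds) v"
  using assms(2)
proof (induction ds arbitrary: v rule: rev_induct)
  case Nil
  have "\<exists>f :: nat \<Rightarrow> 'a. strict_mono_on {0..0} f \<and> f 0 = v"
    by (intro exI[of _ "\<lambda>_. v"]) (auto simp: strict_mono_on_def)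
  then show ?case by (simp add: edges_right_caterpillar_Nil del: right_caterpillar.simps)
next
  case (snoc d ds)
  let ?n = "sum_list ds"
  have d: "d \<ge> 1" and ds: "\<forall>d\<in>set ds. d \<ge> 1" using snoc.prems by auto
  note IH = snoc.IH[OF ds]
  have cat: "caterpillar_at (\<lambda>i. (ds @ [d]) ! i) E (length (ds @ [d])) v \<longleftrightarrow>
      (\<exists>w. (v, w) \<in> E \<and> d - 1 \<le> card {z. (v, z) \<in> E \<and> z < w} \<and> caterpillar_at (\<lambda>i. ds ! i) E (length ds) w)"
    using caterpillar_at_cong[of "length ds" "\<lambda>i. (ds @ [d]) ! i" "\<lambda>i. ds ! i" E] by (simp add: nth_append)
  show ?case
  proof
    assume "\<exists>f. strict_mono_on {0..sum_list (ds @ [d])} f \<and>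
        (\<forall>(u, w)\<in>edges (right_caterpillar (ds @ [d])). (f u, f w) \<in> E) \<and> f 0 = v"
    then obtain f where f: "strict_mono_on {0..?n + d} f"
      "\<And>u w. (u, w) \<in> edges (right_caterpillar (ds @ [d])) \<Longrightarrow> (f u, f w) \<in> E" "f 0 = v"
      by auto
    have "strict_mono_on {0..?n} (\<lambda>x. f (d + x))"
      using f(1) unfolding strict_mono_on_def by auto
    moreover have "(f (d + u), f (d + w)) \<in> E" if "(u, w) \<in> edges (right_caterpillar ds)" for u w
      using that by (intro f(2)) (force simp: edges_right_caterpillar_snoc)
    ultimately have "caterpillar_at (\<lambda>i. ds ! i) E (length ds) (f d)"
      unfolding IH[symmetric] by (intro exI[of _ "\<lambda>x. f (d + x)"]) auto
    moreover have star: "(v, f i) \<in> E" if "1 \<le> i" "i \<le> d" for i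
      using f(2)[of 0 i] f(3) that by (simp add: edges_right_caterpillar_snoc)
    moreover have "d - 1 \<le> card {z. (v, z) \<in> E \<and> z < f d}"
    proof -
      have "f i < f j" if "i < j" "j \<le> d" for i j
        using f(1) that unfolding strict_mono_on_def by auto
      then have sub: "f ` {1..<d} \<subseteq> {z. (v, z) \<in> E \<and> z < f d}" using star by auto
      have "inj_on f {1..<d}"
        using \<open>\<And>i j. i < j \<Longrightarrow> j \<le> d \<Longrightarrow> f i < f j\<close> by (intro linorder_inj_onI) (auto, fastforce)
      then have "card (f ` {1..<d}) = d - 1" by (simp add: card_image)
      moreover have "finite {z. (v, z) \<in> E \<and> z < f d}"
        by (rule finite_subset[of _ "snd ` E"]) (use assms(1) in \<open>force simp: edge_set_def\<close>)+
      ultimately show ?thesis using card_mono sub by metis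
    qed
    ultimately show "caterpillar_at (\<lambda>i. (ds @ [d]) ! i) E (length (ds @ [d])) v"
      unfolding cat using d by blast
  next
    assume "caterpillar_at (\<lambda>i. (ds @ [d]) ! i) E (length (ds @ [d])) v"
    then obtain w where w: "(v, w) \<in> E" "d - 1 \<le> card {z. (v, z) \<in> E \<and> z < w}"
      "caterpillar_at (\<lambda>i. ds ! i) E (length ds) w"
      unfolding cat by blast
    obtain g where g: "strict_mono_on {0..?n} g"
      "\<And>u w. (u, w) \<in> edges (right_caterpillar ds) \<Longrightarrow> (g u, g w) \<in> E" "g 0 = w"
      using w(3) unfolding IH[symmetric] by auto
    obtain Z where Z: "Z \<subseteq> {z. (v, z) \<in> E \<and> z < w}" "card Z = d - 1" "finite Z"
      using obtain_subset_with_card_n[OF w(2)] by auto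
    obtain h where h: "strict_mono_on {..<d - 1} h" "h ` {..<d - 1} = Z"
      using ex_strict_mono_enumeration[OF Z(3)] Z(2) by auto
    have hZ: "(v, h i) \<in> E" "h i < w" if "i < d - 1" for i
      using h(2) Z(1) that by auto
    have less: "x < y" if "(x, y) \<in> E" for x y
      using that assms(1) unfolding edge_set_def by auto
    have gw: "w \<le> g x" if "x \<le> ?n" for x
      using g(1,3) that unfolding strict_mono_on_def by (cases "x = 0") (auto intro: less_imp_le)
    \<comment> \<open>The positions \<open>1..<d\<close> go to the chosen leaves before
      \<open>w\<close>, and position \<open>d\<close> goes to \<open>g 0 = w\<close>, where the star
      and the rest meet.\<close>
    define f where "f x = (if x = 0 then v else if x < d then h (x - 1) else g (x - d))" for x
    have f: "f 0 = v" "f (d + x) = g x" for x using d by (auto simp: f_def)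
    have f_less: "f x < f y" if xy: "x < y" "y \<le> ?n + d" for x y
    proof -
      consider "x = 0" "y < d" | "x = 0" "d \<le> y" | "0 < x" "y < d" | "0 < x" "x < d" "d \<le> y" | "d \<le> x"
        using xy by linarith
      then show ?thesis
      proof cases
        case 1
        then show ?thesis using xy hZ(1)[of "y - 1"] less unfolding f_def by auto
      next
        case 2
        then have "y - d \<le> ?n" using xy by linarith
        then have "v < g (y - d)" using less[OF w(1)] gw by (metis order_less_le_trans)
        then show ?thesis using 2 d unfolding f_def by auto
      next
        case 3
        then have "x - 1 < y - 1" "y - 1 < d - 1" using xy by linarith+
        then have "h (x - 1) < h (y - 1)" using h(1) unfolding strict_mono_on_def by simp
        then show ?thesis using 3 xy unfolding f_def by simp
      next
        case 4
        then have "y - d \<le> ?n" "x - 1 < d - 1" using xy by linarith+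
        then have "h (x - 1) < g (y - d)" using hZ(2) gw by (metis order_less_le_trans)
        then show ?thesis using 4 unfolding f_def by auto
      next
        case 5
        then have "x - d < y - d" "y - d \<le> ?n" using xy by linarith+
        then have "g (x - d) < g (y - d)" using g(1) unfolding strict_mono_on_def by simp
        then show ?thesis using 5 xy d unfolding f_def by simp
      qed
    qed
    have "(f x, f y) \<in> E" if "(x, y) \<in> edges (right_caterpillar (ds @ [d]))" for x y
    proof -
      consider "x = 0" "1 \<le> y" "y \<le> d" | x' y' where "x = d + x'" "y = d + y'" "(x', y') \<in> edges (right_caterpillar ds)"
        using \<open>(x, y) \<in> edges (right_caterpillar (ds @ [d]))\<close> by (auto simp: edges_right_caterpillar_snoc)
      then show ?thesis
      proof cases
        case 1
        then show ?thesis using hZ(1)[of "y - 1"] f g(3) w(1) unfolding f_def by (cases "y = d") auto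
      next
        case 2
        then show ?thesis using g(2) f(2) by simp
      qed
    qed
    then show "\<exists>f. strict_mono_on {0..sum_list (ds @ [d])} f \<and>
        (\<forall>(u, w)\<in>edges (right_caterpillar (ds @ [d])). (f u, f w) \<in> E) \<and> f 0 = v"
      using f(1) f_less by (intro exI[of _ f]) (auto simp: strict_mono_on_def)
  qed
qed

lemma sum_list_ge_1:
  "ds \<noteq> [] \<Longrightarrow> \<forall>d\<in>set ds. d \<ge> 1 \<Longrightarrow> sum_list ds \<ge> (1 :: nat)"
  by (cases ds) auto

lemma embeds_right_caterpillar_iff:
  assumes "edge_set E" "\<forall>d\<in>set ds. d \<ge> 1" "ds \<noteq> []"
  shows "embeds (edges (right_caterpillar ds)) E \<longleftrightarrow> (\<exists>v. caterpillar_at (\<lambda>i. ds ! i) E (length ds) v)"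
  unfolding embeds_def Field_right_caterpillar[OF sum_list_ge_1[OF assms(3,2)]]
    right_caterpillar_copy_iff[OF assms(1,2), symmetric] by blast

lemma embeds_map_left:
  assumes g: "strict_mono_on (Field D) g"
  shows "embeds (map_prod g g ` D) E \<longleftrightarrow> embeds D E"
proof
  assume "embeds (map_prod g g ` D) E"
  then obtain f where f: "strict_mono_on (g ` Field D) f" "\<And>u v. (u, v) \<in> map_prod g g ` D \<Longrightarrow> (f u, f v) \<in> E"
    unfolding embeds_def Field_map_prod by blast
  have "strict_mono_on (Field D) (f \<circ> g)"
    using f(1) g unfolding strict_mono_on_def by simp
  moreover have "(f (g u), f (g v)) \<in> E" if "(u, v) \<in> D" for u v
    using f(2) that by (metis map_prod_imageI)
  ultimately show "embeds D E" unfolding embeds_def by (intro exI[of _ "f \<circ> g"]) auto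
next
  assume "embeds D E"
  then obtain f where f: "strict_mono_on (Field D) f" "\<And>u v. (u, v) \<in> D \<Longrightarrow> (f u, f v) \<in> E"
    unfolding embeds_def by blast
  define h where "h = inv_into (Field D) g"
  have inj: "inj_on g (Field D)" using g strict_mono_on_imp_inj_on by blast
  have h: "h (g x) = x" if "x \<in> Field D" for x using inj that unfolding h_def by simp
  have "x < y" if "x \<in> Field D" "y \<in> Field D" "g x < g y" for x y
    using g that unfolding strict_mono_on_def by (metis linorder_neqE order_less_asym)
  then have "strict_mono_on (g ` Field D) (f \<circ> h)"
    using f(1) h unfolding strict_mono_on_def by auto
  moreover have "(f (h u), f (h v)) \<in> E" if uv: "(u, v) \<in> map_prod g g ` D" for u v
  proof -
    obtain x y where xy: "(x, y) \<in> D" "u = g x" "v = g y" using uv by auto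
    then show ?thesis using f(2)[OF xy(1)] h[OF FieldI1[OF xy(1)]] h[OF FieldI2[OF xy(1)]] by simp
  qed
  then have "case p of (u, v) \<Rightarrow> ((f \<circ> h) u, (f \<circ> h) v) \<in> E" if "p \<in> map_prod g g ` D" for p
    using that by (cases p) simp
  ultimately show "embeds (map_prod g g ` D) E"
    unfolding embeds_def Field_map_prod by blast
qed

lemma embeds_right_star_iff:
  assumes "finite C" "C \<noteq> {}" "\<And>x. x \<in> C \<Longrightarrow> c < x" "edge_set E"
  shows "embeds ({c} \<times> C) E \<longleftrightarrow> (\<exists>v. card C \<le> card (E `` {v}))"
proof
  have F: "Field ({c} \<times> C) = insert c C" using assms(2) by (auto simp: Field_def)
  assume "embeds ({c} \<times> C) E"
  then obtain f where f: "strict_mono_on (insert c C) f" "\<And>x. x \<in> C \<Longrightarrow> (f c, f x) \<in> E"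
    unfolding embeds_def F by auto
  have "inj_on f C" using strict_mono_on_imp_inj_on[OF f(1)] by (auto intro: inj_on_subset)
  moreover have "f ` C \<subseteq> E `` {f c}" using f(2) by auto
  moreover have "finite (E `` {f c})" using assms(4) unfolding edge_set_def by (blast intro: finite_Image)
  ultimately show "\<exists>v. card C \<le> card (E `` {v})" using card_inj_on_le by blast
next
  assume "\<exists>v. card C \<le> card (E `` {v})"
  then obtain v Z where Z: "Z \<subseteq> E `` {v}" "card Z = card C" "finite Z"
    using obtain_subset_with_card_n by metis
  obtain h where h: "strict_mono_on {..<card C} h" "h ` {..<card C} = Z"
    using ex_strict_mono_enumeration[OF Z(3)] Z(2) by auto
  define f where "f x = (if x = c then v else h (card {y \<in> C. y < x}))" for x
  have lt: "card {y \<in> C. y < x} < card C" if "x \<in> C" for x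
    using that assms(1) by (intro psubset_card_mono) auto
  have mono: "card {y \<in> C. y < x} < card {y \<in> C. y < x'}" if "x \<in> C" "x < x'" for x x'
    using that assms(1) by (intro psubset_card_mono) auto
  have E: "(v, h i) \<in> E" if "i < card C" for i using h(2) Z(1) that by auto
  have F: "Field ({c} \<times> C) = insert c C" using assms(2) by (auto simp: Field_def)
  have ord: "x < y" if "(x, y) \<in> E" for x y using that assms(4) unfolding edge_set_def by auto
  have c: "c \<notin> C" using assms(3) by blast
  have "f x < f y" if "x \<in> insert c C" "y \<in> insert c C" "x < y" for x y
  proof (cases "x = c")
    case True
    then show ?thesis using that ord[OF E[OF lt]] c unfolding f_def by auto
  next
    case False
    then have "x \<in> C" "y \<in> C" using that assms(3) by (auto dest: order_less_asym)
    then show ?thesis using that mono lt h(1) c unfolding f_def strict_mono_on_def by auto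
  qed
  moreover have "(f c, f x) \<in> E" if "x \<in> C" for x
    using that E[OF lt] c unfolding f_def by auto
  ultimately show "embeds ({c} \<times> C) E"
    unfolding embeds_def F strict_mono_on_def by (intro exI[of _ f]) auto
qed

section \<open>Recognizing right caterpillars\<close>

text \<open>Let \<open>b\<close> be the last right neighbour of \<open>0\<close>. By the fork
  condition no earlier one has right neighbours. Hence \<open>1..b\<close> are all joined to
  \<open>0\<close>, every other edge starts at \<open>b\<close> or later, and the star at
  \<open>0\<close> can be split off.\<close>

lemma ex_right_caterpillar_nat:
  assumes "\<And>u v. (u, v) \<in> D \<Longrightarrow> u < v \<and> v \<le> n"
    and "\<And>v. 1 \<le> v \<Longrightarrow> v \<le> n \<Longrightarrow> \<exists>u. (u, v) \<in> D"
    and "single_valued (D\<inverse>)"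
    and "\<And>v a b x. (v, a) \<in> D \<Longrightarrow> (v, b) \<in> D \<Longrightarrow> (a, x) \<in> D \<Longrightarrow> \<not> a < b"
  shows "\<exists>ds. (\<forall>d\<in>set ds. d \<ge> 1) \<and> sum_list ds = n \<and> D = edges (right_caterpillar ds)"
  using assms
proof (induction n arbitrary: D rule: less_induct)
  case (less n)
  note ord = less.prems(1) and par = less.prems(2) and uniq = less.prems(3) and fork = less.prems(4)
  show ?case
  proof (cases "n = 0")
    case True
    then have "D = {}" using ord by fastforce
    then show ?thesis using True by (intro exI[of _ "[]"]) (simp add: edges_right_caterpillar_Nil del: right_caterpillar.simps)
  next
    case False
    define C where "C = {v. (0, v) \<in> D}"
    have finC: "finite C" using ord unfolding C_def by (auto intro!: finite_subset[of _ "{..n}"])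
    obtain u where "(u, 1) \<in> D" using par[of 1] False by auto
    then have "1 \<in> C" using ord unfolding C_def by force
    define b where "b = Max C"
    have b: "b \<in> C" "b \<ge> 1" "b \<le> n" "\<And>v. v \<in> C \<Longrightarrow> v \<le> b"
      using finC \<open>1 \<in> C\<close> ord Max_in[OF finC] Max_ge[OF finC] unfolding b_def C_def by auto
    \<comment> \<open>If the left neighbour \<open>u\<close> of \<open>v\<close> were not
      \<open>0\<close>, it would itself be a neighbour of \<open>0\<close> before \<open>b\<close>,
      and one with a right neighbour.\<close>
    have leaf: "v \<in> C" if "1 \<le> v" "v \<le> b" for v
      using that
    proof (induction v rule: less_induct)
      case (less v)
      obtain u where u: "(u, v) \<in> D" using par[of v] less.prems b(3) by auto
      show ?case
      proof (cases "u = 0")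
        case False
        then have "u \<in> C" "u < b" using less.IH[of u] less.prems ord[OF u] by auto
        then show ?thesis using fork[of 0 u b v] u b(1) unfolding C_def by blast
      qed (use u in \<open>simp add: C_def\<close>)
    qed
    have C: "C = {1..b}" using leaf b(4) ord unfolding C_def by (force simp: C_def)
    have right: "b \<le> u" if uv: "(u, v) \<in> D" "u \<noteq> 0" for u v
    proof (rule ccontr)
      assume "\<not> b \<le> u"
      then show False using fork[of 0 u b v] uv leaf[of u] b(1) unfolding C_def by simp
    qed
    define D2 where "D2 = {(u, v). (b + u, b + v) \<in> D}"
    have D: "D = {0} \<times> {1..b} \<union> map_prod (\<lambda>x. b + x) (\<lambda>x. b + x) ` D2"
    proof (intro equalityI subrelI)
      fix u v assume uv: "(u, v) \<in> D"
      show "(u, v) \<in> {0} \<times> {1..b} \<union> map_prod (\<lambda>x. b + x) (\<lambda>x. b + x) ` D2"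
      proof (cases "u = 0")
        case True
        then show ?thesis using uv C unfolding C_def by auto
      next
        case False
        then have "b \<le> u" "b \<le> v" using right uv ord[OF uv] by fastforce+
        then have "u = b + (u - b)" "v = b + (v - b)" by simp_all
        moreover then have "(u - b, v - b) \<in> D2" using uv unfolding D2_def by simp
        ultimately show ?thesis by (metis UnI2 map_prod_imageI)
      qed
    next
      fix u v assume "(u, v) \<in> {0} \<times> {1..b} \<union> map_prod (\<lambda>x. b + x) (\<lambda>x. b + x) ` D2"
      then consider "u = 0" "v \<in> C" | x y where "(x, y) \<in> D2" "u = b + x" "v = b + y"
        unfolding C by auto
      then show "(u, v) \<in> D" by cases (auto simp: C_def D2_def)
    qed
    have "\<exists>ds. (\<forall>d\<in>set ds. d \<ge> 1) \<and> sum_list ds = n - b \<and> D2 = edges (right_caterpillar ds)"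
    proof (rule less.IH)
      show "n - b < n" using b False by simp
      show "u < v \<and> v \<le> n - b" if "(u, v) \<in> D2" for u v
        using that ord[of "b + u" "b + v"] unfolding D2_def by auto
      show "\<exists>u. (u, v) \<in> D2" if v: "1 \<le> v" "v \<le> n - b" for v
      proof -
        have "1 \<le> b + v" "b + v \<le> n" using v b by linarith+
        then obtain u where u: "(u, b + v) \<in> D" using par by blast
        moreover have "u \<noteq> 0"
        proof
          assume "u = 0"
          then have "b + v \<in> C" using u unfolding C_def by simp
          then show False using b(4)[of "b + v"] v by simp
        qed
        ultimately have "b \<le> u" using right by blast
        then have "(u - b, v) \<in> D2" using u unfolding D2_def by simp
        then show ?thesis by blast
      qed
      show "single_valued (D2\<inverse>)" using uniq unfolding D2_def single_valued_def by fastforce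
      show "\<not> a < c" if "(v, a) \<in> D2" "(v, c) \<in> D2" "(a, x) \<in> D2" for v a c x
        using fork[of "b + v" "b + a" "b + c" "b + x"] that unfolding D2_def by simp
    qed
    then obtain ds where ds: "\<forall>d\<in>set ds. d \<ge> 1" "sum_list ds = n - b" "D2 = edges (right_caterpillar ds)"
      by blast
    then have "D = edges (right_caterpillar (ds @ [b]))"
      using D edges_right_caterpillar_snoc[of ds b] by simp
    moreover have "\<forall>d\<in>set (ds @ [b]). d \<ge> 1" "sum_list (ds @ [b]) = n" using ds b by auto
    ultimately show ?thesis by blast
  qed
qed

text \<open>Left neighbours are unique, so a step of the walk to the left just undoes the last step
  of the increasing path found so far.\<close>

lemma reachable_from_least:
  assumes "connected_edges D" "single_valued (D\<inverse>)" "m \<in> Field D" "\<And>u. (u, m) \<notin> D" "y \<in> Field D"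
  shows "(m, y) \<in> D\<^sup>*"
proof -
  have "(m, y) \<in> (D \<union> D\<inverse>)\<^sup>*" using assms(1,3,5) unfolding connected_edges_def by blast
  then show ?thesis
  proof (induction rule: rtrancl_induct)
    case (step y z)
    show ?case
    proof (cases "(y, z) \<in> D")
      case True
      then show ?thesis using step.IH by (rule rtrancl_into_rtrancl[rotated])
    next
      case False
      then have zy: "(z, y) \<in> D" using step by blast
      from step.IH show ?thesis
      proof (cases rule: rtranclE)
        case base
        then show ?thesis using zy assms(4) by blast
      next
        case (step y')
        then show ?thesis using zy assms(2) unfolding single_valued_def by blast
      qed
    qed
  qed simp
qed

text \<open>Numbering the vertices in increasing order moves \<open>D\<close> to an initial segment
  of \<open>nat\<close>. Connectedness provides a left neighbour for every vertex except the least
  one.\<close>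

theorem ex_right_caterpillar:
  fixes D :: "'a::linorder rel"
  assumes D: "edge_set D" "connected_edges D" "single_valued (D\<inverse>)" "D \<noteq> {}"
    and fork: "\<And>v a b x. (v, a) \<in> D \<Longrightarrow> (v, b) \<in> D \<Longrightarrow> (a, x) \<in> D \<Longrightarrow> \<not> a < b"
  shows "\<exists>ds h. ds \<noteq> [] \<and> (\<forall>d\<in>set ds. d \<ge> 1) \<and> strict_mono_on {0..sum_list ds} h \<and>
           h ` {0..sum_list ds} = Field D \<and> D = map_prod h h ` edges (right_caterpillar ds)"
proof -
  have fin: "finite (Field D)" using D(1) finite_Field_edge_set by blast
  obtain h where h: "strict_mono_on {..<card (Field D)} h" "h ` {..<card (Field D)} = Field D"
    using ex_strict_mono_enumeration[OF fin] by blast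
  have ne: "Field D \<noteq> {}" using D(4) by (auto simp: Field_def)
  define n where "n = card (Field D) - 1"
  have "card (Field D) > 0" using fin ne by (simp add: card_gt_0_iff)
  then have I: "{..<card (Field D)} = {0..n}" unfolding n_def by auto
  note h = h[unfolded I]
  define D0 where "D0 = {(i, j). i \<le> n \<and> j \<le> n \<and> (h i, h j) \<in> D}"
  have hF: "h i \<in> Field D" if "i \<le> n" for i using h(2) that by auto
  have inj: "i = j" if "h i = h j" "i \<le> n" "j \<le> n" for i j
    using strict_mono_on_imp_inj_on[OF h(1)] that unfolding inj_on_def by auto
  have ord: "u < v" if "(u, v) \<in> D" for u v using that D(1) unfolding edge_set_def by auto
  have hlt: "h i < h j \<longleftrightarrow> i < j" if "i \<le> n" "j \<le> n" for i j
    using h(1) that unfolding strict_mono_on_def by (metis atLeastAtMost_iff le0 linorder_neqE order_less_asym order_less_irrefl)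
  have DD0: "D = map_prod h h ` D0"
  proof (intro equalityI subrelI)
    fix u v assume uv: "(u, v) \<in> D"
    then have "u \<in> h ` {0..n}" "v \<in> h ` {0..n}" using h(2) by (auto intro: FieldI1 FieldI2)
    then obtain i j where "i \<le> n" "j \<le> n" "u = h i" "v = h j" by auto
    then show "(u, v) \<in> map_prod h h ` D0" using uv unfolding D0_def by auto
  qed (auto simp: D0_def)
  have least: "(u, h 0) \<notin> D" for u
  proof
    assume u: "(u, h 0) \<in> D"
    then obtain i where "u = h i" "i \<le> n" using h(2) by (force dest: FieldI1)
    then show False using ord[OF u] hlt[of i 0] by simp
  qed
  have "\<exists>ds. (\<forall>d\<in>set ds. d \<ge> 1) \<and> sum_list ds = n \<and> D0 = edges (right_caterpillar ds)"
  proof (rule ex_right_caterpillar_nat)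
    show "u < v \<and> v \<le> n" if "(u, v) \<in> D0" for u v
      using that ord hlt unfolding D0_def by blast
    show "\<exists>u. (u, v) \<in> D0" if v: "1 \<le> v" "v \<le> n" for v
    proof -
      have "(h 0, h v) \<in> D\<^sup>*" using reachable_from_least[OF D(2,3) hF least hF] v by simp
      moreover have "h v \<noteq> h 0" using inj[of v 0] v by auto
      ultimately obtain y where y: "(y, h v) \<in> D" by (metis rtranclE)
      then obtain u where "y = h u" "u \<le> n" using h(2) by (force dest: FieldI1)
      then show ?thesis using y v unfolding D0_def by blast
    qed
    show "single_valued (D0\<inverse>)"
      using D(3) inj unfolding D0_def single_valued_def by blast
    show "\<not> a < b" if "(v, a) \<in> D0" "(v, b) \<in> D0" "(a, x) \<in> D0" for v a b x
      using that fork hlt unfolding D0_def by blast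
  qed
  then obtain ds where ds: "\<forall>d\<in>set ds. d \<ge> 1" "sum_list ds = n" "D0 = edges (right_caterpillar ds)"
    by blast
  moreover have "ds \<noteq> []"
    using DD0 ds(3) D(4) edges_right_caterpillar_Nil by force
  ultimately show ?thesis using h DD0 by blast
qed

section \<open>Prolonging a caterpillar\<close>

lemma not_bounded_arrowingI:
  assumes "\<And>N. \<exists>E :: 'c::linorder rel. edge_set E \<and> arrows E D D' \<and> (\<forall>E0\<subseteq>E. card E0 \<le> N \<longrightarrow> \<not> arrows E0 D D')"
  shows "\<not> bounded_arrowing D D'"
  using bounded_arrowing_iff[where ?'c = 'c] assms by metis

definition cat_arrows :: "nat \<Rightarrow> (nat \<Rightarrow> nat) \<Rightarrow> nat \<Rightarrow> 'a::linorder rel \<Rightarrow> bool" where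
  "cat_arrows p d m E \<longleftrightarrow>
     (\<forall>R\<subseteq>E. (\<exists>v. p \<le> card (R `` {v})) \<or> (\<exists>v. caterpillar_at d (E - R) m v))"

lemma arrows_iff_cat_arrows:
  assumes "edge_set E" "p \<ge> 1" "ds \<noteq> []" "\<forall>d\<in>set ds. d \<ge> 1"
  shows "arrows E ({0} \<times> {1..p :: nat}) (edges (right_caterpillar ds)) \<longleftrightarrow>
    cat_arrows p (\<lambda>i. ds ! i) (length ds) E"
proof -
  have "embeds ({0} \<times> {1..p}) R \<longleftrightarrow> (\<exists>v. p \<le> card (R `` {v}))"
    "embeds (edges (right_caterpillar ds)) (E - R) \<longleftrightarrow> (\<exists>v. caterpillar_at (\<lambda>i. ds ! i) (E - R) (length ds) v)"
    if "R \<subseteq> E" for R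
  proof -
    have R: "edge_set R" "edge_set (E - R)" using edge_set_subset[OF assms(1)] that by auto
    show "embeds ({0} \<times> {1..p}) R \<longleftrightarrow> (\<exists>v. p \<le> card (R `` {v}))"
      using embeds_right_star_iff[of "{1..p}" 0 R] R(1) assms(2) unfolding edge_set_def by simp
    show "embeds (edges (right_caterpillar ds)) (E - R) \<longleftrightarrow> (\<exists>v. caterpillar_at (\<lambda>i. ds ! i) (E - R) (length ds) v)"
      using embeds_right_caterpillar_iff[OF R(2) assms(4,3)] .
  qed
  then show ?thesis unfolding arrows_def cat_arrows_def by simp
qed

lemma cat_arrows_mono:
  assumes "cat_arrows p d m E0" "E0 \<subseteq> E" "finite E"
  shows "cat_arrows p d m E"
proof -
  have mono: "caterpillar_at d A m v \<Longrightarrow> A \<subseteq> B \<Longrightarrow> finite B \<Longrightarrow> caterpillar_at d B m v" for A B :: "'a rel" and m v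
  proof (induction m arbitrary: v)
    case (Suc m)
    then obtain w where w: "(v, w) \<in> A" "d m - 1 \<le> card {z. (v, z) \<in> A \<and> z < w}" "caterpillar_at d A m w" by auto
    have "finite {z. (v, z) \<in> B \<and> z < w}"
      by (rule finite_subset[of _ "snd ` B"]) (use Suc.prems(3) in force)+
    then have "card {z. (v, z) \<in> A \<and> z < w} \<le> card {z. (v, z) \<in> B \<and> z < w}"
      using Suc.prems(2) by (intro card_mono) auto
    then show ?case using w Suc by fastforce
  qed simp
  show ?thesis
    unfolding cat_arrows_def
  proof (intro allI impI)
    fix R assume R: "R \<subseteq> E"
    have fin: "finite ((R \<inter> E0) `` {v})" "finite (R `` {v})" for v
      using assms(2,3) R by (meson finite_Image finite_subset inf_le1)+
    consider v where "p \<le> card ((R \<inter> E0) `` {v})" | v where "caterpillar_at d (E0 - R \<inter> E0) m v"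
      using assms(1) unfolding cat_arrows_def by blast
    then show "(\<exists>v. p \<le> card (R `` {v})) \<or> (\<exists>v. caterpillar_at d (E - R) m v)"
    proof cases
      case 1
      moreover have "card ((R \<inter> E0) `` {v}) \<le> card (R `` {v})" using fin by (intro card_mono) auto
      ultimately show ?thesis by (meson order_trans)
    next
      case 2
      then show ?thesis using mono[of "E0 - R \<inter> E0" m v "E - R"] assms(2,3) by blast
    qed
  qed
qed

text \<open>
  The last element of \<open>G\<close> outside of \<open>R `` {v}\<close> comes after all other elements of \<open>L \<union> G\<close>
  that are left.
\<close>

lemma forced_step:
  fixes E R :: "'a::linorder rel"
  assumes "finite E" "L \<union> G \<subseteq> E `` {v}" "\<And>x y. x \<in> L \<Longrightarrow> y \<in> G \<Longrightarrow> x < y"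
    and X: "card (R `` {v} \<inter> (L \<union> G)) < card G"
  shows "\<exists>w\<in>G. (v, w) \<in> E - R \<and> card L \<le> card {z. (v, z) \<in> E - R \<and> z < w}"
proof -
  let ?X = "R `` {v}"
  have finLG: "finite L" "finite G" using assms(1,2) by (meson finite_Image finite_subset le_sup_iff)+
  have "\<not> G \<subseteq> ?X"
  proof
    assume "G \<subseteq> ?X"
    then have "card G \<le> card (?X \<inter> (L \<union> G))" using finLG by (intro card_mono) auto
    then show False using X by simp
  qed
  then have "G - ?X \<noteq> {}" "finite (G - ?X)" using finLG by auto
  then have w: "Max (G - ?X) \<in> G - ?X" "\<And>x. x \<in> G - ?X \<Longrightarrow> x \<le> Max (G - ?X)" by (auto intro: Max_in simp del: Diff_iff)
  let ?w = "Max (G - ?X)"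
  have disj: "L \<inter> G = {}" using assms(3) by blast
  have "(L \<union> G) - ?X - {?w} \<subseteq> {z. (v, z) \<in> E - R \<and> z < ?w}"
  proof
    fix z assume z: "z \<in> (L \<union> G) - ?X - {?w}"
    then have "z < ?w" using assms(3) w by (cases "z \<in> L") (auto simp: less_le)
    then show "z \<in> {z. (v, z) \<in> E - R \<and> z < ?w}" using z assms(2) by auto
  qed
  moreover have "finite {z. (v, z) \<in> E - R \<and> z < ?w}"
    by (rule finite_subset[of _ "snd ` E"]) (use assms(1) in force)+
  ultimately have "card ((L \<union> G) - ?X - {?w}) \<le> card {z. (v, z) \<in> E - R \<and> z < ?w}"
    by (rule card_mono[rotated])
  moreover have "card ((L \<union> G) - ?X - {?w}) = card (L \<union> G) - card (?X \<inter> (L \<union> G)) - 1"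
  proof -
    have "card ((L \<union> G) - ?X) = card (L \<union> G) - card (?X \<inter> (L \<union> G))"
      using finLG by (metis Int_commute card_Diff_subset_Int finite_Int finite_UnI)
    then show ?thesis using w(1) finLG by (subst card_Diff_singleton) auto
  qed
  moreover have "card (L \<union> G) = card L + card G" using finLG disj by (rule card_Un_disjoint)
  ultimately have "card L \<le> card {z. (v, z) \<in> E - R \<and> z < ?w}" using X by linarith
  then show ?thesis using w(1) assms(2) by blast
qed

lemma caterpillar_at_map:
  assumes "caterpillar_at d E m v" "strict_mono f" "\<And>x y. (x, y) \<in> E \<Longrightarrow> (f x, f y) \<in> E'" "finite E'"
  shows "caterpillar_at d E' m (f v)"
  using assms(1)
proof (induction m arbitrary: v)
  case (Suc m)
  then obtain w where w: "(v, w) \<in> E" "d m - 1 \<le> card {z. (v, z) \<in> E \<and> z < w}" "caterpillar_at d E m w" by auto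
  have "finite {z. (f v, z) \<in> E' \<and> z < f w}"
    by (rule finite_subset[of _ "snd ` E'"]) (use assms(4) in force)+
  moreover have "f ` {z. (v, z) \<in> E \<and> z < w} \<subseteq> {z. (f v, z) \<in> E' \<and> z < f w}"
    using assms(2,3) by (auto simp: strict_mono_less)
  moreover have "inj_on f {z. (v, z) \<in> E \<and> z < w}"
    using strict_mono_imp_inj_on[OF assms(2)] by (rule inj_on_subset[OF _ subset_UNIV])
  ultimately have "card {z. (v, z) \<in> E \<and> z < w} \<le> card {z. (f v, z) \<in> E' \<and> z < f w}"
    using card_inj_on_le by blast
  then show ?case using w(1,2) Suc.IH[OF w(3)] assms(3) by fastforce
qed simp

text \<open>Edges that leave a point of the image of \<open>f\<close> to the right end in the image,
  so a caterpillar starting there never gets out.\<close>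

lemma caterpillar_at_vimage:
  assumes "caterpillar_at d E' m (f v)" "strict_mono f" "finite E"
    "\<And>x w. (f x, w) \<in> E' \<Longrightarrow> \<exists>y. w = f y \<and> (x, y) \<in> E"
  shows "caterpillar_at d E m v"
  using assms(1)
proof (induction m arbitrary: v)
  case (Suc m)
  then obtain w where w: "(f v, w) \<in> E'" "d m - 1 \<le> card {z. (f v, z) \<in> E' \<and> z < w}" "caterpillar_at d E' m w" by auto
  obtain y where y: "w = f y" "(v, y) \<in> E" using assms(4)[OF w(1)] by blast
  have "finite {z. (v, z) \<in> E \<and> z < y}"
    by (rule finite_subset[of _ "snd ` E"]) (use assms(3) in force)+
  moreover have "{z. (f v, z) \<in> E' \<and> z < w} \<subseteq> f ` {z. (v, z) \<in> E \<and> z < y}"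
    using assms(4) y(1) strict_mono_less[OF assms(2)] by fastforce
  ultimately have "card {z. (f v, z) \<in> E' \<and> z < w} \<le> card {z. (v, z) \<in> E \<and> z < y}"
    using surj_card_le by blast
  then show ?case using w(2,3) y Suc.IH[of y] by fastforce
qed simp

text \<open>Take \<open>p\<close> copies of a Ramsey graph for \<open>ds\<close> and, for each
  choice of one vertex per copy, a centre on the left joined to these vertices and to
  \<open>d - 1\<close> earlier leaves. If red has no star with \<open>p\<close> edges, each copy
  contains a blue caterpillar, and the centre of their left ends keeps a blue edge to one of them. A
  small subgraph has a small trace on every copy; good colourings of the traces combine, with blue
  for all other edges.\<close>

theorem not_bounded_arrowing_snoc:
  assumes p: "p \<ge> 1" and ds: "ds \<noteq> []" "\<forall>d\<in>set ds. d \<ge> 1" and d: "d \<ge> 1"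
    and unb: "\<not> bounded_arrowing ({0} \<times> {1..p :: nat}) (edges (right_caterpillar ds))"
  shows "\<not> bounded_arrowing ({0} \<times> {1..p :: nat}) (edges (right_caterpillar (ds @ [d])))"
proof (rule not_bounded_arrowingI)
  fix N
  let ?m = "length ds"
  let ?d = "\<lambda>i. ds ! i" and ?d' = "\<lambda>i. (ds @ [d]) ! i"
  have dd': "caterpillar_at ?d' E ?m v = caterpillar_at ?d E ?m v" for E :: "'z::linorder rel" and v
    by (rule caterpillar_at_cong) (simp add: nth_append)
  have m: "?m \<ge> 1" using ds(1) by (simp add: Suc_leI)
  obtain E :: "nat rel" where E: "edge_set E" "cat_arrows p ?d ?m E"
    "\<And>E0. E0 \<subseteq> E \<Longrightarrow> card E0 \<le> N \<Longrightarrow> \<not> cat_arrows p ?d ?m E0"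
    using unb arrows_iff_cat_arrows[OF edge_set_subset p ds]
    unfolding bounded_arrowing_def by (metis order_refl)
  have finE: "finite E" using E(1) unfolding edge_set_def by blast
  define Ls where "Ls = {xs. set xs \<subseteq> Field E \<and> length xs = p}"
  have finLs: "finite Ls" unfolding Ls_def
    using finite_Field_edge_set[OF E(1)] by (rule finite_lists_length_eq)
  define f where "f i x = (Suc (Suc i), x :: nat)" for i x
  define A where "A = {((0 :: nat, to_nat xs), f i (xs ! i)) | xs i. xs \<in> Ls \<and> i < p}"
  define L where "L = {((0 :: nat, to_nat xs), (Suc 0, l)) | xs l. xs \<in> Ls \<and> l < d - 1}"
  define B where "B = {(f i x, f i y) | i x y. i < p \<and> (x, y) \<in> E}"
  let ?E = "A \<union> L \<union> B"
  have f_mono: "strict_mono (f i)" for i unfolding f_def strict_mono_def by simp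
  have "A = (\<lambda>(xs, i). ((0, to_nat xs), f i (xs ! i))) ` (Ls \<times> {..<p})" unfolding A_def by auto
  then have "finite A" using finLs by simp
  moreover have "L = (\<lambda>(xs, l). ((0, to_nat xs), (Suc 0, l))) ` (Ls \<times> {..<d - 1})" unfolding L_def by auto
  then have "finite L" using finLs by simp
  moreover have "B = (\<lambda>(i, (x, y)). (f i x, f i y)) ` ({..<p} \<times> E)" unfolding B_def by force
  then have "finite B" using finE by simp
  ultimately have finE': "finite ?E" by blast
  have E': "edge_set ?E"
    using finE' E(1) unfolding edge_set_def A_def L_def B_def f_def by auto
  have arr: "cat_arrows p ?d' (Suc ?m) ?E"
    unfolding cat_arrows_def
  proof (intro allI impI)
    fix R assume R: "R \<subseteq> ?E"
    show "(\<exists>v. p \<le> card (R `` {v})) \<or> (\<exists>v. caterpillar_at ?d' (?E - R) (Suc ?m) v)"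
    proof (cases "\<exists>v. p \<le> card (R `` {v})")
      case False
      then have deg: "card (R `` {v}) < p" for v by (meson not_le)
      have finR: "finite (R `` {v})" for v using R finE' by (meson finite_Image finite_subset)
      have "\<exists>x\<in>Field E. caterpillar_at ?d (?E - R) ?m (f i x)" if i: "i < p" for i
      proof -
        define Ri where "Ri = {(x, y) \<in> E. (f i x, f i y) \<in> R}"
        have "card (Ri `` {v}) < p" for v
        proof -
          have "inj_on (f i) (Ri `` {v})" "f i ` (Ri `` {v}) \<subseteq> R `` {f i v}"
            unfolding Ri_def f_def inj_on_def by auto
          then have "card (Ri `` {v}) \<le> card (R `` {f i v})" using card_inj_on_le finR by blast
          then show ?thesis using deg[of "f i v"] by linarith
        qed
        moreover have "Ri \<subseteq> E" unfolding Ri_def by blast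
        ultimately obtain x where x: "caterpillar_at ?d (E - Ri) ?m x"
          using E(2) unfolding cat_arrows_def by (meson not_le)
        \<comment> \<open>There is at least one segment, so \<open>x\<close> lies on an edge and
          tuples over \<open>Field E\<close> suffice.\<close>
        obtain y where "(x, y) \<in> E" using x m by (cases ?m) auto
        moreover have "caterpillar_at ?d (?E - R) ?m (f i x)"
          by (rule caterpillar_at_map[OF x f_mono]) (use i finE' in \<open>auto simp: Ri_def B_def\<close>)
        ultimately show ?thesis by (meson FieldI1)
      qed
      then obtain x where x: "\<And>i. i < p \<Longrightarrow> x i \<in> Field E \<and> caterpillar_at ?d (?E - R) ?m (f i (x i))" by metis
      define xs where "xs = map x [0..<p]"
      have nth: "xs ! i = x i" if "i < p" for i using that unfolding xs_def by simp
      have xs: "xs \<in> Ls" using x unfolding Ls_def xs_def by auto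
      let ?v = "(0, to_nat xs)" and ?L = "(\<lambda>l. (Suc 0, l)) ` {..<d - 1}" and ?G = "(\<lambda>i. f i (x i)) ` {..<p}"
      have card: "card ?L = d - 1" "card ?G = p" by (auto simp: card_image inj_on_def f_def)
      have "\<exists>w\<in>?G. (?v, w) \<in> ?E - R \<and> card ?L \<le> card {z. (?v, z) \<in> ?E - R \<and> z < w}"
      proof (rule forced_step[OF finE'])
        show "?L \<union> ?G \<subseteq> ?E `` {?v}"
          using xs nth unfolding A_def L_def by force
        show "card (R `` {?v} \<inter> (?L \<union> ?G)) < card ?G"
          using deg[of ?v] card_mono[OF finR[of ?v], of "R `` {?v} \<inter> (?L \<union> ?G)"] card(2) by simp
      qed (auto simp: f_def)
      then obtain i where i: "i < p" "(?v, f i (x i)) \<in> ?E - R"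
        "card ?L \<le> card {z. (?v, z) \<in> ?E - R \<and> z < f i (x i)}" by blast
      have "?d' ?m - 1 = card ?L" using card(1) by simp
      then have "?d' ?m - 1 \<le> card {z. (?v, z) \<in> ?E - R \<and> z < f i (x i)}" using i(3) by (rule ord_eq_le_trans)
      moreover have "caterpillar_at ?d' (?E - R) ?m (f i (x i))" unfolding dd' using x[OF i(1)] by blast
      ultimately have "caterpillar_at ?d' (?E - R) (Suc ?m) ?v"
        unfolding caterpillar_at.simps using i(2) by (intro exI[of _ "f i (x i)"] conjI)
      then show ?thesis by blast
    qed simp
  qed
  have small: "\<not> cat_arrows p ?d' (Suc ?m) E0" if E0: "E0 \<subseteq> ?E" "card E0 \<le> N" for E0
  proof -
    have finE0: "finite E0" using E0(1) finE' finite_subset by blast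
    define F where "F i = {(x, y). (f i x, f i y) \<in> E0}" for i
    have F: "\<exists>R\<subseteq>F i. (\<forall>v. card (R `` {v}) < p) \<and> (\<forall>v. \<not> caterpillar_at ?d (F i - R) ?m v)" for i
    proof -
      have sub: "F i \<subseteq> E" using E0(1) unfolding F_def A_def L_def B_def f_def by auto
      have "inj_on (map_prod (f i) (f i)) (F i)" "map_prod (f i) (f i) ` F i \<subseteq> E0"
        unfolding F_def f_def inj_on_def by auto
      then have "card (F i) \<le> card E0" using card_inj_on_le finE0 by blast
      then show ?thesis using E(3)[OF sub] E0(2) unfolding cat_arrows_def by (meson not_le order_trans)
    qed
    then obtain Q where Q: "\<And>i. Q i \<subseteq> F i" "\<And>i v. card (Q i `` {v}) < p"
      "\<And>i v. \<not> caterpillar_at ?d (F i - Q i) ?m v" by metis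
    define R where "R = {(f i x, f i y) | i x y. (x, y) \<in> Q i}"
    have "(f i x, f i y) \<in> E0" if "(x, y) \<in> Q i" for i x y
      using Q(1)[of i] that unfolding F_def by blast
    then have "R \<subseteq> E0" unfolding R_def by blast
    moreover have "card (R `` {v}) < p" for v
    proof (cases "\<exists>i x. v = f i x")
      case True
      then obtain i x where v: "v = f i x" by blast
      then have "R `` {v} = f i ` (Q i `` {x})" unfolding R_def f_def by auto
      moreover have "inj_on (f i) (Q i `` {x})" unfolding f_def inj_on_def by auto
      ultimately show ?thesis using Q(2)[of i x] by (simp add: card_image)
    next
      case False
      then have "R `` {v} = {}" unfolding R_def by auto
      then show ?thesis using p by simp
    qed
    moreover have "\<not> caterpillar_at ?d' (E0 - R) (Suc ?m) v" for v
    proof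
      assume "caterpillar_at ?d' (E0 - R) (Suc ?m) v"
      then obtain w where w: "(v, w) \<in> E0" "caterpillar_at ?d (E0 - R) ?m w" unfolding caterpillar_at.simps dd' by blast
      \<comment> \<open>The vertex \<open>w\<close> has a left and a right neighbour. Centres lack
        the former and leaves the latter, so \<open>w\<close> lies in a copy.\<close>
      obtain u where "(w, u) \<in> E0" using w(2) m by (cases ?m) auto
      then have "(v, w) \<in> ?E" "(w, u) \<in> ?E" using E0(1) w(1) by blast+
      then have "\<exists>i x. w = f i x" unfolding A_def L_def B_def f_def by auto
      then obtain i x where x: "w = f i x" by blast
      have "caterpillar_at ?d (F i - Q i) ?m x"
      proof (rule caterpillar_at_vimage[OF _ f_mono])
        show "caterpillar_at ?d (E0 - R) ?m (f i x)" using w(2) x by simp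
        have "F i \<subseteq> E" using E0(1) unfolding F_def A_def L_def B_def f_def by auto
        then show "finite (F i - Q i)" using finE finite_subset by blast
        fix y z assume yz: "(f i y, z) \<in> E0 - R"
        then have "(f i y, z) \<in> ?E" using E0(1) by blast
        then obtain u where u: "z = f i u" unfolding A_def L_def B_def f_def by auto
        then show "\<exists>u. z = f i u \<and> (y, u) \<in> F i - Q i"
          using yz unfolding F_def R_def by auto
      qed
      then show False using Q(3) by blast
    qed
    ultimately show ?thesis unfolding cat_arrows_def by (meson not_le)
  qed
  have ds': "ds @ [d] \<noteq> []" "\<forall>d\<in>set (ds @ [d]). d \<ge> 1" using ds d by auto
  have "arrows ?E ({0} \<times> {1..p}) (edges (right_caterpillar (ds @ [d])))"
    using arrows_iff_cat_arrows[OF E' p ds'] arr by simp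
  moreover have "\<not> arrows E0 ({0} \<times> {1..p}) (edges (right_caterpillar (ds @ [d])))"
    if "E0 \<subseteq> ?E" "card E0 \<le> N" for E0
    using arrows_iff_cat_arrows[OF edge_set_subset[OF E' that(1)] p ds'] small[OF that] by simp
  ultimately show "\<exists>E :: (nat \<times> nat) rel. edge_set E \<and> arrows E ({0} \<times> {1..p}) (edges (right_caterpillar (ds @ [d]))) \<and>
      (\<forall>E0\<subseteq>E. card E0 \<le> N \<longrightarrow> \<not> arrows E0 ({0} \<times> {1..p}) (edges (right_caterpillar (ds @ [d]))))"
    using E' by blast
qed

section \<open>Chains of forced caterpillars\<close>

text \<open>Since \<open>d\<close> is indexed from \<open>0\<close>, the sizes of segments
  \<open>k\<close> and \<open>k + 1\<close> are \<open>d (k - 1)\<close> and \<open>d k\<close>. The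
  length of the chain is \<open>n\<close>.\<close>

locale chain =
  fixes d :: "nat \<Rightarrow> nat" and k p n :: nat
  assumes p: "p \<ge> 2" and k: "k \<ge> 2" and d_pos: "\<And>i. d i \<ge> 1"
begin

text \<open>Levels are added on the left, hence the negative integers. The leaves \<open>L m\<close>
  occupy the odd coordinate between \<open>G m\<close> and \<open>G (m - 1)\<close>.\<close>

definition G :: "nat \<Rightarrow> nat \<Rightarrow> int \<times> nat" where
  "G m i = (- (2 * int m), i)"

definition L :: "nat \<Rightarrow> nat \<Rightarrow> int \<times> nat" where
  "L m i = (1 - 2 * int m, i)"

lemma GL_simps [simp]:
  "G m i = G m' i' \<longleftrightarrow> m = m' \<and> i = i'" "L m i = L m' i' \<longleftrightarrow> m = m' \<and> i = i'"
  "G m i \<noteq> L m' i'" "L m' i' \<noteq> G m i"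
  "G m i < G m' i' \<longleftrightarrow> m' < m \<or> m = m' \<and> i < i'"
  "L m i < L m' i' \<longleftrightarrow> m' < m \<or> m = m' \<and> i < i'"
  "G m i < L m' i' \<longleftrightarrow> m' \<le> m" "L m' i' < G m i \<longleftrightarrow> m < m'"
  unfolding G_def L_def by (auto; presburger)+

lemma card_L [simp]: "card (L m ` A) = card A"
  by (simp add: card_image inj_on_def)

lemma card_G [simp]: "card (G m ` A) = card A"
  by (simp add: card_image inj_on_def)

text \<open>
  The levels up to \<open>k\<close> form a tower in which the vertices \<open>G m i\<close> are forced to be the leftmost
  vertex of a blue caterpillar with \<open>m\<close> segments. On the levels from \<open>k\<close> to \<open>k + n\<close> there is a
  chain: if its vertex on one level starts a blue caterpillar with \<open>k\<close> segments, then so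
  does the vertex on the next level, unless that one starts a caterpillar with \<open>Suc k\<close> segments.
\<close>

definition succs :: "nat \<Rightarrow> nat \<Rightarrow> (int \<times> nat) set" where
  "succs m i =
     (if m = 0 \<or> p \<le> i then {}
      else if m \<le> k then L m ` {..<d (m - 1) - 1} \<union> G (m - 1) ` {..<p}
      else if i \<noteq> 0 then {}
      else if m \<le> k + n then
        L m ` {..<d k - 1} \<union> insert (G (m - 1) 0) (G k ` {1..<p - 1}) \<union>
        L k ` {..<d (k - 1) - d k} \<union> {G (k - 1) 0}
      else if m = Suc (k + n) then L m ` {..<d k - 1} \<union> insert (G (m - 1) 0) (G k ` {1..<p})
      else {})"

definition chain_graph :: "(int \<times> nat) rel" where
  "chain_graph = {(G m i, z) | m i z. z \<in> succs m i}"

lemma chain_graph_iff [simp]: "(G m i, z) \<in> chain_graph \<longleftrightarrow> z \<in> succs m i"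
  unfolding chain_graph_def by (cases z) auto

lemma chain_graph_L [simp]: "(L m i, z) \<notin> chain_graph"
  unfolding chain_graph_def by auto

lemma chain_graph_Image [simp]: "chain_graph `` {G m i} = succs m i"
  by auto

lemma edge_set_chain_graph: "edge_set chain_graph"
proof -
  have "chain_graph \<subseteq> (\<Union>m\<le>Suc (k + n). \<Union>i<p. {G m i} \<times> succs m i)"
    unfolding chain_graph_def by (fastforce simp: succs_def split: if_splits)
  moreover have "finite (succs m i)" for m i unfolding succs_def by auto
  ultimately have "finite chain_graph" by (auto intro: finite_subset)
  moreover have "G m i < z" if "z \<in> succs m i" for m i z
    using that k unfolding succs_def by (auto split: if_splits)
  ultimately show ?thesis unfolding edge_set_def chain_graph_def by blast
qed

lemma finite_chain_graph: "finite chain_graph"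
  using edge_set_chain_graph unfolding edge_set_def by blast

context
  fixes R :: "(int \<times> nat) rel"
  assumes R: "R \<subseteq> chain_graph" and deg: "\<And>v. card (R `` {v}) < p"
begin

lemma finite_R_Image: "finite (R `` {v})"
  using R finite_chain_graph by (meson finite_Image finite_subset)

text \<open>Fewer than \<open>p\<close> red edges cannot separate a vertex from all \<open>p\<close>
  vertices of the next lower level.\<close>

lemma tower_forced:
  assumes "m \<le> k" "i < p"
  shows "caterpillar_at d (chain_graph - R) m (G m i)"
  using assms
proof (induction m arbitrary: i)
  case (Suc m)
  let ?L = "L (Suc m) ` {..<d m - 1}" and ?G = "G m ` {..<p}"
  have "\<exists>w\<in>?G. (G (Suc m) i, w) \<in> chain_graph - R \<and>
      card ?L \<le> card {z. (G (Suc m) i, z) \<in> chain_graph - R \<and> z < w}"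
  proof (rule forced_step[OF finite_chain_graph])
    show "?L \<union> ?G \<subseteq> chain_graph `` {G (Suc m) i}"
      using Suc.prems unfolding chain_graph_Image succs_def by auto
    show "card (R `` {G (Suc m) i} \<inter> (?L \<union> ?G)) < card ?G"
      using card_mono[OF finite_R_Image Int_lower1] deg[of "G (Suc m) i"]
      unfolding card_G card_lessThan by (rule order_le_less_trans)
  qed auto
  then obtain i' where "i' < p" "(G (Suc m) i, G m i') \<in> chain_graph - R"
    "card ?L \<le> card {z. (G (Suc m) i, z) \<in> chain_graph - R \<and> z < G m i'}" by blast
  then show ?case using Suc.IH[of i'] Suc.prems unfolding caterpillar_at.simps card_L card_lessThan
    by (meson Suc_leD)
qed simp

text \<open>The set \<open>?G\<close> consists of \<open>p - 1\<close> starts of \<open>k\<close>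
  blue segments: the previous chain vertex and \<open>p - 2\<close> tower vertices. Avoiding
  \<open>Suc k\<close> segments requires \<open>p - 1\<close> red edges into
  \<open>?L \<union> ?G\<close>, which is all that red may have. So the edge to \<open>?y\<close> is
  blue, with \<open>(d k - 1) + (d (k - 1) - d k) \<ge> d (k - 1) - 1\<close> blue edges before it.
  This is a segment of size \<open>d (k - 1)\<close> in front of the \<open>k - 1\<close> segments
  starting at \<open>?y\<close>.\<close>

lemma chain_forced:
  assumes "a \<le> n" "\<And>v. \<not> caterpillar_at d (chain_graph - R) (Suc k) v"
  shows "caterpillar_at d (chain_graph - R) k (G (k + a) 0)"
  using assms(1)
proof (induction a)
  case 0
  then show ?case using tower_forced[of k 0] p by simp
next
  case (Suc a)
  let ?m = "Suc (k + a)"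
  let ?v = "G ?m 0" and ?L = "L ?m ` {..<d k - 1}" and ?G = "insert (G (k + a) 0) (G k ` {1..<p - 1})"
    and ?M = "L k ` {..<d (k - 1) - d k}" and ?y = "G (k - 1) 0"
  have s: "chain_graph `` {?v} = ?L \<union> ?G \<union> ?M \<union> {?y}"
    using Suc.prems p k unfolding chain_graph_Image succs_def by simp
  have cG: "card ?G = p - 1" using p by (subst card_insert_disjoint) auto
  have fin: "finite (?L \<union> ?G \<union> ?M)" by simp
  have cat: "caterpillar_at d (chain_graph - R) k w" if "w \<in> ?G" for w
    using that Suc tower_forced[of k] by auto
  have "\<not> card (R `` {?v} \<inter> (?L \<union> ?G)) < card ?G"
  proof
    assume "card (R `` {?v} \<inter> (?L \<union> ?G)) < card ?G"
    then have "\<exists>w\<in>?G. (?v, w) \<in> chain_graph - R \<and> card ?L \<le> card {z. (?v, z) \<in> chain_graph - R \<and> z < w}"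
      by (intro forced_step[OF finite_chain_graph]) (use s in auto)
    then obtain w where "w \<in> ?G" "(?v, w) \<in> chain_graph - R"
      "card ?L \<le> card {z. (?v, z) \<in> chain_graph - R \<and> z < w}" by blast
    then have "caterpillar_at d (chain_graph - R) (Suc k) ?v"
      using cat unfolding caterpillar_at.simps card_L card_lessThan by meson
    then show False using assms(2) by blast
  qed
  then have "card (R `` {?v}) \<le> card (R `` {?v} \<inter> (?L \<union> ?G))" using deg[of ?v] cG by linarith
  then have RLG: "R `` {?v} \<subseteq> ?L \<union> ?G"
    using finite_R_Image card_seteq by (metis Int_lower1 Int_lower2)
  have "?y \<notin> ?L \<union> ?G" using k by auto
  then have y: "(?v, ?y) \<in> chain_graph - R" using RLG s by auto
  have "(?L \<union> ?G \<union> ?M) - R `` {?v} \<subseteq> {z. (?v, z) \<in> chain_graph - R \<and> z < ?y}"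
    using s k by auto
  moreover have "finite {z. (?v, z) \<in> chain_graph - R \<and> z < ?y}"
    by (rule finite_subset[OF _ finite_Image[OF finite_chain_graph, of "{?v}"]]) auto
  ultimately have "card ((?L \<union> ?G \<union> ?M) - R `` {?v}) \<le> card {z. (?v, z) \<in> chain_graph - R \<and> z < ?y}"
    by (rule card_mono[rotated])
  moreover have "card (?L \<union> ?G \<union> ?M) - card (R `` {?v}) \<le> card ((?L \<union> ?G \<union> ?M) - R `` {?v})"
    by (rule diff_card_le_card_Diff[OF finite_R_Image])
  moreover have "card (?L \<union> ?G \<union> ?M) = (d k - 1) + (p - 1) + (d (k - 1) - d k)"
  proof -
    have "card (?L \<union> ?G) = (d k - 1) + (p - 1)"
      using cG by (subst card_Un_disjoint) auto
    moreover have "(?L \<union> ?G) \<inter> ?M = {}" by auto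
    ultimately show ?thesis by (subst card_Un_disjoint) (auto simp del: card_insert_disjoint)
  qed
  ultimately have "d (k - 1) - 1 \<le> card {z. (?v, z) \<in> chain_graph - R \<and> z < ?y}"
    using deg[of ?v] d_pos[of k] by linarith
  moreover have "caterpillar_at d (chain_graph - R) (k - 1) ?y" using tower_forced[of "k - 1" 0] p by simp
  ultimately have "caterpillar_at d (chain_graph - R) (Suc (k - 1)) ?v"
    using y unfolding caterpillar_at.simps by blast
  then show ?case using k by simp
qed

text \<open>The top vertex is joined to \<open>p\<close> starts of \<open>k\<close> blue segments
  instead of \<open>p - 1\<close>, one more than red can block.\<close>

lemma top_forced: "\<exists>v. caterpillar_at d (chain_graph - R) (Suc k) v"
proof (rule ccontr)
  assume no: "\<not> ?thesis"
  let ?m = "Suc (k + n)"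
  let ?v = "G ?m 0" and ?L = "L ?m ` {..<d k - 1}" and ?G = "insert (G (k + n) 0) (G k ` {1..<p})"
  have s: "chain_graph `` {?v} = ?L \<union> ?G"
    using p k unfolding chain_graph_Image succs_def by simp
  have cG: "card ?G = p" using p by (subst card_insert_disjoint) auto
  have cat: "caterpillar_at d (chain_graph - R) k w" if "w \<in> ?G" for w
    using that chain_forced[of n] no tower_forced[of k] by auto
  have "card (R `` {?v} \<inter> (?L \<union> ?G)) \<le> card (R `` {?v})"
    using finite_R_Image by (intro card_mono) auto
  then have "card (R `` {?v} \<inter> (?L \<union> ?G)) < card ?G" using deg[of ?v] cG by linarith
  then have "\<exists>w\<in>?G. (?v, w) \<in> chain_graph - R \<and> card ?L \<le> card {z. (?v, z) \<in> chain_graph - R \<and> z < w}"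
    by (intro forced_step[OF finite_chain_graph]) (use s in auto)
  then obtain w where "w \<in> ?G" "(?v, w) \<in> chain_graph - R"
    "card ?L \<le> card {z. (?v, z) \<in> chain_graph - R \<and> z < w}" by blast
  then have "caterpillar_at d (chain_graph - R) (Suc k) ?v"
    using cat unfolding caterpillar_at.simps card_L card_lessThan by meson
  then show False using no by blast
qed

end

lemma cat_arrows_chain_graph: "cat_arrows p d (Suc k) chain_graph"
  unfolding cat_arrows_def using top_forced by (meson not_le)

text \<open>Up to level \<open>j\<close> red blocks all \<open>p - 1\<close> starts of
  \<open>k\<close> segments. Beyond the cut the link stays blue, and the red edge saved there blocks
  \<open>G (k - 1) 0\<close>. At the top red blocks everything but the link and the leaves.\<close>

definition red :: "nat \<Rightarrow> nat \<Rightarrow> nat \<Rightarrow> (int \<times> nat) set" where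
  "red j m i =
     (if i \<noteq> 0 \<or> m \<le> k then {}
      else if m \<le> j then insert (G (m - 1) 0) (G k ` {1..<p - 1})
      else if m \<le> k + n then insert (G (k - 1) 0) (G k ` {1..<p - 1})
      else G k ` {1..<p})"

text \<open>Beyond the cut no chain vertex starts \<open>k\<close> blue segments. Its only blue
  neighbour that is not a leaf can be the previous chain vertex, with at most \<open>d k - 1\<close>
  blue edges before it, too few if \<open>d k < d (k - 1)\<close>. Otherwise \<open>k = 2\<close>
  and \<open>d 1 \<le> d 2 < d 0\<close>; then the previous chain vertex has at most
  \<open>d 2\<close> blue edges and cannot carry the final segment of size
  \<open>d 0\<close>.\<close>

lemma not_cat_arrows_delete:
  assumes j: "k \<le> j" "j < k + n" and order: "d k < d (k - 1) \<or> k = 2 \<and> d 2 < d 0"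
  shows "\<not> cat_arrows p d (Suc k) (chain_graph - {(G (Suc j) 0, G j 0)})"
proof -
  let ?E = "chain_graph - {(G (Suc j) 0, G j 0)}"
  define R where "R = {(G m i, z) | m i z. z \<in> red j m i} \<inter> ?E"
  define B where "B = ?E - R"
  have finB: "finite {z. (v, z) \<in> B \<and> P z}" for v P
    by (rule finite_subset[OF _ finite_Image[OF finite_chain_graph, of "{v}"]]) (auto simp: B_def)
  have B: "(G m i, z) \<in> B \<longleftrightarrow> z \<in> succs m i - red j m i \<and> \<not> (m = Suc j \<and> i = 0 \<and> z = G j 0)" for m i z
    unfolding B_def R_def by (cases z) auto
  have BL: "caterpillar_at d B q (L m i) \<Longrightarrow> q = 0" for q m i
    unfolding B_def by (cases q) auto
  have Bsrc: "\<exists>m i. v = G m i \<and> z \<in> succs m i" if "(v, z) \<in> B" for v z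
    using that unfolding B_def chain_graph_def by auto
  have deg: "card (R `` {v}) < p" for v
  proof (cases "\<exists>m i. v = G m i")
    case True
    then obtain m i where v: "v = G m i" by blast
    have "R `` {v} \<subseteq> red j m i" unfolding R_def v by auto
    moreover have "finite (red j m i)" unfolding red_def by auto
    ultimately have "card (R `` {v}) \<le> card (red j m i)" by (rule card_mono[rotated])
    moreover have ins: "card (insert x (G k ` {1..<p - 1})) < p" for x
      using card_insert_le_m1[of "p - 1" "G k ` {1..<p - 1}" x] p by simp
    have "card (red j m i) < p"
      using p ins[of "G (m - 1) 0"] ins[of "G (k - 1) 0"] unfolding red_def by simp
    ultimately show ?thesis by linarith
  next
    case False
    then have "R `` {v} = {}" unfolding R_def by auto
    then show ?thesis using p by simp
  qed
  \<comment> \<open>Edges from a tower level end in leaves or one level lower, so no more than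
    \<open>m\<close> segments fit.\<close>
  have tower: "q \<le> m" if "m \<le> k" "caterpillar_at d B q (G m i)" for q m i
    using that
  proof (induction m arbitrary: q i)
    case 0
    then show ?case by (cases q) (auto simp: B succs_def)
  next
    case (Suc m)
    show ?case
    proof (cases q)
      case (Suc q')
      then obtain w where w: "(G (Suc m) i, w) \<in> B" "caterpillar_at d B q' w" using Suc.prems by auto
      then consider l where "w = L (Suc m) l" | i' where "w = G m i'"
        using Suc.prems(1) unfolding B succs_def by (auto split: if_splits)
      then show ?thesis
      proof cases
        case 1
        then show ?thesis using BL w(2) Suc by auto
      next
        case 2
        then show ?thesis using Suc.IH[of q' i'] w(2) Suc.prems Suc by simp
      qed
    qed simp
  qed
  \<comment> \<open>Up to \<open>j\<close> the blue edges of the chain lead to leaves and to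
    \<open>G (k - 1) 0\<close>, which starts at most \<open>k - 1\<close> segments.\<close>
  have lower: "\<not> caterpillar_at d B (Suc k) (G m 0)" if m: "k < m" "m \<le> j" for m
  proof
    assume "caterpillar_at d B (Suc k) (G m 0)"
    then obtain w where w: "(G m 0, w) \<in> B" "caterpillar_at d B k w" by auto
    then consider l m' where "w = L m' l" | "w = G (k - 1) 0"
      using m j unfolding B succs_def red_def by (auto split: if_splits)
    then show False
    proof cases
      case 1
      then show ?thesis using BL w(2) k by fastforce
    next
      case 2
      then show ?thesis using tower[of "k - 1" k 0] w(2) k by simp
    qed
  qed
  have upper_succs: "z \<in> L m ` {..<d k - 1} \<union> L k ` {..<d (k - 1) - d k} \<or> (z = G (m - 1) 0 \<and> j < m - 1)"
    if "j < m" "m \<le> k + n" "(G m 0, z) \<in> B" for m z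
    using that j k p unfolding B succs_def red_def by (auto split: if_splits)
  \<comment> \<open>The additional leaves \<open>L k\<close> come after \<open>G (m - 1) 0\<close>,
    because \<open>m - 1 > j \<ge> k\<close>.\<close>
  have before: "card {z. (G m 0, z) \<in> B \<and> z < G (m - 1) 0} \<le> d k - 1"
    if m: "j < m - 1" "m \<le> k + n" for m
  proof -
    have "{z. (G m 0, z) \<in> B \<and> z < G (m - 1) 0} \<subseteq> L m ` {..<d k - 1}"
      using upper_succs[of m] m j by fastforce
    then show ?thesis using card_mono[of "L m ` {..<d k - 1}"] by simp
  qed
  \<comment> \<open>If \<open>d (k - 1) \<le> d k\<close>, there are no additional leaves
    \<open>L k\<close>, and the blue degree is at most \<open>(d k - 1) + 1\<close>.\<close>
  have no_one: "\<not> caterpillar_at d B 1 (G m 0)" if m: "j < m" "m \<le> k + n" and less: "d (k - 1) \<le> d k" "d k < d 0" for m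
  proof
    assume "caterpillar_at d B 1 (G m 0)"
    then obtain w where w: "(G m 0, w) \<in> B" "d 0 - 1 \<le> card {z. (G m 0, z) \<in> B \<and> z < w}" by auto
    have "z \<in> insert (G (m - 1) 0) (L m ` {..<d k - 1})" if "(G m 0, z) \<in> B" for z
      using upper_succs[OF m that] less(1) by auto
    then have "insert w {z. (G m 0, z) \<in> B \<and> z < w} \<subseteq> insert (G (m - 1) 0) (L m ` {..<d k - 1})"
      using w(1) by blast
    then have "card (insert w {z. (G m 0, z) \<in> B \<and> z < w}) \<le> card (insert (G (m - 1) 0) (L m ` {..<d k - 1}))"
      by (rule card_mono[rotated]) simp
    also have "\<dots> = Suc (d k - 1)" by (subst card_insert_disjoint) auto
    finally have "Suc (card {z. (G m 0, z) \<in> B \<and> z < w}) \<le> Suc (d k - 1)"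
      using finB[of "G m 0" "\<lambda>z. z < w"] by (subst (asm) card_insert_disjoint) auto
    then show False using w(2) less(2) d_pos[of k] by linarith
  qed
  have upper: "\<not> caterpillar_at d B k (G m 0) \<and> \<not> caterpillar_at d B (Suc k) (G m 0)"
    if "j < m" "m \<le> k + n" for m
    using that
  proof (induction m rule: less_induct)
    case (less m)
    show ?case
    proof (intro conjI notI)
      assume "caterpillar_at d B (Suc k) (G m 0)"
      then obtain w where w: "(G m 0, w) \<in> B" "caterpillar_at d B k w" by auto
      have "w \<noteq> L m' l" for m' l using BL[of k m' l] w(2) k by auto
      then have "w = G (m - 1) 0 \<and> j < m - 1" using upper_succs[OF less.prems w(1)] by auto
      then show False using less.IH[of "m - 1"] less.prems w(2) by simp
    next
      assume "caterpillar_at d B k (G m 0)"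
      then have "caterpillar_at d B (Suc (k - 1)) (G m 0)" using k by simp
      then obtain w where w: "(G m 0, w) \<in> B" "d (k - 1) - 1 \<le> card {z. (G m 0, z) \<in> B \<and> z < w}"
        "caterpillar_at d B (k - 1) w" by auto
      have "w \<noteq> L m' l" for m' l using BL[of "k - 1" m' l] w(3) k by auto
      then have wG: "w = G (m - 1) 0 \<and> j < m - 1" using upper_succs[OF less.prems w(1)] by auto
      then have "d (k - 1) - 1 \<le> d k - 1" using w(2) before[of m] less.prems by simp
      then have le: "d (k - 1) \<le> d k" using d_pos[of k] d_pos[of "k - 1"] by linarith
      then have "k = 2" "d 2 < d 0" using order by auto
      then show False using no_one[of "m - 1"] wG w(3) le less.prems by auto
    qed
  qed
  have "\<not> caterpillar_at d B (Suc k) v" for v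
  proof
    assume cat: "caterpillar_at d B (Suc k) v"
    then obtain w where w: "(v, w) \<in> B" "caterpillar_at d B k w" by auto
    obtain m i where v: "v = G m i" "w \<in> succs m i" using Bsrc[OF w(1)] by blast
    consider "m \<le> k" | "k < m" "i = 0" "m \<le> j" | "j < m" "m \<le> k + n" "i = 0" | "m = Suc (k + n)" "i = 0"
      using v(2) j unfolding succs_def by (fastforce split: if_splits)
    then show False
    proof cases
      case 1
      then show ?thesis using tower[of m "Suc k" i] cat v(1) by simp
    next
      case 2
      then show ?thesis using lower cat v(1) by blast
    next
      case 3
      then show ?thesis using upper cat v(1) by blast
    next
      case 4
      then have "w \<in> L m ` {..<d k - 1} \<or> w = G (k + n) 0"
        using w(1) j unfolding v(1) B succs_def red_def by (auto split: if_splits)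
      then show ?thesis using BL w(2) k upper[of "k + n"] j by fastforce
    qed
  qed
  moreover have "R \<subseteq> ?E" unfolding R_def by blast
  ultimately show ?thesis using deg unfolding cat_arrows_def B_def by (meson not_le)
qed

end

theorem not_bounded_arrowing_chain:
  assumes "p \<ge> 2" "k \<ge> 2" "length ds = Suc k" "\<forall>d\<in>set ds. d \<ge> 1"
    and order: "ds ! k < ds ! (k - 1) \<or> k = 2 \<and> ds ! 2 < ds ! 0"
  shows "\<not> bounded_arrowing ({0} \<times> {1..p :: nat}) (edges (right_caterpillar ds))"
proof (rule not_bounded_arrowingI)
  fix N
  \<comment> \<open>The value \<open>1\<close> beyond the end of \<open>ds\<close> makes
    \<open>d\<close> positive everywhere, as the locale demands. The chain gets \<open>Suc N\<close>
    links, so that \<open>N\<close> edges cannot include them all.\<close>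
  define d where "d i = (if i < length ds then ds ! i else 1)" for i
  interpret chain d k p "Suc N"
    using assms by unfold_locales (auto simp: d_def)
  have ds: "ds \<noteq> []" "p \<ge> 1" using assms by auto
  have iff: "arrows E ({0} \<times> {1..p}) (edges (right_caterpillar ds)) \<longleftrightarrow> cat_arrows p d (Suc k) E"
    if "edge_set E" for E :: "(int \<times> nat) rel"
  proof -
    have "caterpillar_at ((!) ds) A (Suc k) = caterpillar_at d A (Suc k)" for A :: "(int \<times> nat) rel"
      by (rule ext, rule caterpillar_at_cong) (simp add: d_def assms(3))
    note eq = this
    show ?thesis
      unfolding arrows_iff_cat_arrows[OF that ds(2,1) assms(4)] assms(3) cat_arrows_def eq ..
  qed
  have order': "d k < d (k - 1) \<or> k = 2 \<and> d 2 < d 0" using order assms(3) unfolding d_def by auto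
  have "\<not> cat_arrows p d (Suc k) E0" if E0: "E0 \<subseteq> chain_graph" "card E0 \<le> N" for E0
  proof
    assume cat: "cat_arrows p d (Suc k) E0"
    let ?S = "(\<lambda>j. (G (Suc j) 0, G j 0)) ` {k..<k + Suc N}"
    have "card ?S = Suc N" by (subst card_image) (auto simp: inj_on_def)
    moreover have "finite E0" using E0(1) finite_chain_graph finite_subset by blast
    ultimately have "\<not> ?S \<subseteq> E0" using card_mono[of E0 ?S] E0(2) by auto
    then have "\<exists>j\<in>{k..<k + Suc N}. (G (Suc j) 0, G j 0) \<notin> E0" by blast
    then obtain j where j: "k \<le> j" "j < k + Suc N" "(G (Suc j) 0, G j 0) \<notin> E0"
      by (metis atLeastLessThan_iff)
    \<comment> \<open>Arrowing is monotone, so it would pass from \<open>E0\<close> to the whole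
      graph without the missing link.\<close>
    have "E0 \<subseteq> chain_graph - {(G (Suc j) 0, G j 0)}" using E0(1) j(3) by blast
    then have "cat_arrows p d (Suc k) (chain_graph - {(G (Suc j) 0, G j 0)})"
      by (rule cat_arrows_mono[OF cat _ finite_Diff[OF finite_chain_graph]])
    then show False using not_cat_arrows_delete[OF j(1,2) order'] by contradiction
  qed
  then show "\<exists>E :: (int \<times> nat) rel. edge_set E \<and> arrows E ({0} \<times> {1..p}) (edges (right_caterpillar ds)) \<and>
      (\<forall>E0\<subseteq>E. card E0 \<le> N \<longrightarrow> \<not> arrows E0 ({0} \<times> {1..p}) (edges (right_caterpillar ds)))"
    using edge_set_chain_graph iff edge_set_subset[OF edge_set_chain_graph] cat_arrows_chain_graph
    by (intro exI[of _ chain_graph]) blast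
qed

text \<open>A violation at \<open>k\<close> concerns only the \<open>Suc k\<close> rightmost
  segments, a prefix of \<open>ds\<close>. The chain deals with this prefix, and the other segments
  are added on the left one by one.\<close>

theorem bounded_arrowing_almost_increasing:
  assumes "p \<ge> 2" "ds \<noteq> []" "\<forall>d\<in>set ds. d \<ge> 1"
    and "bounded_arrowing ({0} \<times> {1..p :: nat}) (edges (right_caterpillar ds))"
  shows "almost_increasing ds"
proof (rule ccontr)
  assume no: "\<not> almost_increasing ds"
  then have len: "length ds \<ge> 3" unfolding almost_increasing_def by linarith
  have "\<exists>k. k \<ge> 2 \<and> k < length ds \<and> (ds ! k < ds ! (k - 1) \<or> k = 2 \<and> ds ! 2 < ds ! 0)"
  proof (cases "ds ! 0 \<le> ds ! 2")
    case True
    then have "\<not> sorted (tl ds)" using no len unfolding almost_increasing_def by simp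
    then obtain i where i: "Suc i < length (tl ds)" "tl ds ! Suc i < tl ds ! i"
      unfolding sorted_iff_nth_Suc by (meson not_le)
    \<comment> \<open>Position \<open>i\<close> of \<open>tl ds\<close> is position
      \<open>Suc i\<close> of \<open>ds\<close>, so the descent ends at
      \<open>k = Suc (Suc i)\<close>.\<close>
    then show ?thesis using len by (intro exI[of _ "Suc (Suc i)"]) (auto simp: nth_tl)
  next
    case False
    then show ?thesis using len by (intro exI[of _ 2]) auto
  qed
  then obtain k where k: "k \<ge> 2" "k < length ds" "ds ! k < ds ! (k - 1) \<or> k = 2 \<and> ds ! 2 < ds ! 0" by blast
  have "\<not> bounded_arrowing ({0} \<times> {1..p}) (edges (right_caterpillar (take m ds)))"
    if "Suc k \<le> m" "m \<le> length ds" for m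
    using that
  proof (induction m rule: dec_induct)
    case base
    show ?case
    proof (rule not_bounded_arrowing_chain[OF assms(1) k(1)])
      show "length (take (Suc k) ds) = Suc k" using k(2) by simp
      show "\<forall>d\<in>set (take (Suc k) ds). d \<ge> 1" using assms(3) by (meson in_set_takeD)
      show "take (Suc k) ds ! k < take (Suc k) ds ! (k - 1) \<or> k = 2 \<and> take (Suc k) ds ! 2 < take (Suc k) ds ! 0"
        using k by auto
    qed
  next
    case (step m)
    have "\<not> bounded_arrowing ({0} \<times> {1..p}) (edges (right_caterpillar (take m ds @ [ds ! m])))"
    proof (rule not_bounded_arrowing_snoc)
      show "\<forall>d\<in>set (take m ds). d \<ge> 1" using assms(3) by (meson in_set_takeD)
      show "ds ! m \<ge> 1" using assms(3) step by auto
      show "take m ds \<noteq> []" using step assms(2) by auto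
    qed (use step assms in auto)
    then show ?case using step.prems by (simp add: take_Suc_conv_app_nth)
  qed
  from this[of "length ds"] show False using k(2) assms(4) by simp
qed

section \<open>Ordered graphs and reflection\<close>

lemma ordered_graph_edge_set:
  assumes "ordered_graph H"
  shows "edge_set (edges H)"
proof -
  have "edges H \<subseteq> verts H \<times> verts H" "finite (verts H)" using assms unfolding ordered_graph_def by auto
  then show ?thesis using assms unfolding edge_set_def ordered_graph_def
    by (auto intro: finite_subset)
qed

text \<open>An edge provides a second vertex, and the path from \<open>v\<close> to it leaves
  \<open>v\<close> along an edge.\<close>

lemma verts_eq_Field:
  assumes "ordered_graph H" "connected_ograph H" "card (edges H) \<ge> 2"
  shows "verts H = Field (edges H)"
proof (intro equalityI subsetI)
  fix v assume v: "v \<in> verts H"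
  have "edges H \<noteq> {}" using assms(3) by auto
  then obtain a b where ab: "(a, b) \<in> edges H" by auto
  then have "a < b" "a \<in> verts H" "b \<in> verts H" using assms(1) unfolding ordered_graph_def by auto
  then obtain u where u: "u \<noteq> v" "u \<in> verts H" by (metis order_less_irrefl)
  then have "(v, u) \<in> (edges H \<union> (edges H)\<inverse>)\<^sup>*" using assms(2) v unfolding connected_ograph_def by blast
  then show "v \<in> Field (edges H)" using u(1)
    by (cases rule: converse_rtranclE) (auto intro: FieldI1 FieldI2)
next
  fix v assume "v \<in> Field (edges H)"
  then show "v \<in> verts H" using assms(1) unfolding ordered_graph_def Field_def by auto
qed

lemma ordered_graph_Field: "edge_set E \<Longrightarrow> ordered_graph (OGraph (Field E) E)"
  using finite_Field_edge_set unfolding ordered_graph_def edge_set_def by (auto intro: FieldI1 FieldI2)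

text \<open>With a colour class for \<open>S\<close>, this turns monochromatic copies into
  embeddings.\<close>

lemma copy_iff_embeds:
  assumes "ordered_graph F" "S \<subseteq> edges F" "ordered_graph H" "verts H = Field (edges H)"
  shows "(\<exists>C. is_copy C H F \<and> edges C \<subseteq> S) \<longleftrightarrow> embeds (edges H) S"
proof
  assume "\<exists>C. is_copy C H F \<and> edges C \<subseteq> S"
  then obtain C f where "edges C \<subseteq> S" "strict_mono_on (verts H) f" "edges C = map_prod f f ` edges H"
    unfolding is_copy_def ograph_iso_def by blast
  then show "embeds (edges H) S" unfolding embeds_def assms(4)[symmetric] by auto
next
  assume "embeds (edges H) S"
  then obtain f where f: "strict_mono_on (verts H) f" "\<And>u v. (u, v) \<in> edges H \<Longrightarrow> (f u, f v) \<in> S"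
    unfolding embeds_def assms(4)[symmetric] by blast
  let ?C = "OGraph (f ` verts H) (map_prod f f ` edges H)"
  have sub: "map_prod f f ` edges H \<subseteq> S" using f(2) by auto
  have "f v \<in> verts F" if "v \<in> verts H" for v
  proof -
    have "\<exists>w. (v, w) \<in> edges H \<or> (w, v) \<in> edges H" using that unfolding assms(4) Field_def by auto
    then show ?thesis using f(2) assms(1,2) unfolding ordered_graph_def by blast
  qed
  moreover have "ordered_graph ?C"
    using assms(3) f(1) unfolding ordered_graph_def strict_mono_on_def by fastforce
  ultimately have "subgraph ?C F" using sub assms(2) unfolding subgraph_def by auto
  moreover have "ograph_iso H ?C"
    using f(1) strict_mono_on_imp_inj_on unfolding ograph_iso_def
    by (intro exI[of _ f]) (auto simp: bij_betw_def)
  ultimately show "\<exists>C. is_copy C H F \<and> edges C \<subseteq> S"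
    using sub unfolding is_copy_def by (intro exI[of _ ?C]) auto
qed

lemma ramsey_graphs_iff:
  assumes "ordered_graph H" "verts H = Field (edges H)" "ordered_graph H'" "verts H' = Field (edges H')"
  shows "F \<in> ramsey_graphs H H' \<longleftrightarrow> ordered_graph F \<and> arrows (edges F) (edges H) (edges H')"
proof (cases "ordered_graph F")
  case True
  have red: "(\<exists>C. is_copy C H F \<and> (\<forall>e\<in>edges C. c e = Red)) \<longleftrightarrow> embeds (edges H) {e \<in> edges F. c e = Red}" for c
    using copy_iff_embeds[OF True, of "{e \<in> edges F. c e = Red}", OF _ assms(1,2)]
    unfolding is_copy_def subgraph_def by blast
  have blue: "(\<exists>C. is_copy C H' F \<and> (\<forall>e\<in>edges C. c e = Blue)) \<longleftrightarrow> embeds (edges H') {e \<in> edges F. c e = Blue}" for c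
    using copy_iff_embeds[OF True, of "{e \<in> edges F. c e = Blue}", OF _ assms(3,4)]
    unfolding is_copy_def subgraph_def by blast
  have "(\<forall>c. embeds (edges H) {e \<in> edges F. c e = Red} \<or> embeds (edges H') {e \<in> edges F. c e = Blue}) \<longleftrightarrow>
      arrows (edges F) (edges H) (edges H')"
    unfolding arrows_def
  proof (intro iffI allI impI)
    fix R assume *: "\<forall>c. embeds (edges H) {e \<in> edges F. c e = Red} \<or> embeds (edges H') {e \<in> edges F. c e = Blue}"
      and R: "R \<subseteq> edges F"
    define c where "c e = (if e \<in> R then Red else Blue)" for e
    have "{e \<in> edges F. c e = Red} = R" "{e \<in> edges F. c e = Blue} = edges F - R"
      using R unfolding c_def by auto
    then show "embeds (edges H) R \<or> embeds (edges H') (edges F - R)" using spec[OF *, of c] by simp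
  next
    fix c :: "nat \<times> nat \<Rightarrow> color" assume *: "\<forall>R\<subseteq>edges F. embeds (edges H) R \<or> embeds (edges H') (edges F - R)"
    have "c e \<noteq> Red \<longleftrightarrow> c e = Blue" for e by (cases "c e") auto
    then have "edges F - {e \<in> edges F. c e = Red} = {e \<in> edges F. c e = Blue}" by auto
    then show "embeds (edges H) {e \<in> edges F. c e = Red} \<or> embeds (edges H') {e \<in> edges F. c e = Blue}"
      using *[rule_format, of "{e \<in> edges F. c e = Red}"] by auto
  qed
  then show ?thesis unfolding ramsey_graphs_def using True red blue by simp
qed (simp add: ramsey_graphs_def)

section \<open>Minimal Ramsey graphs and the bound on edges\<close>

lemma card_edges_iso:
  assumes "ordered_graph G" "ograph_iso G G'"
  shows "card (edges G') = card (edges G)"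
proof -
  obtain f where f: "bij_betw f (verts G) (verts G')" "edges G' = map_prod f f ` edges G"
    using assms(2) unfolding ograph_iso_def by blast
  have "inj_on (map_prod f f) (verts G \<times> verts G)"
    using f(1) unfolding bij_betw_def by (intro map_prod_inj_on) auto
  moreover have "edges G \<subseteq> verts G \<times> verts G" using assms(1) unfolding ordered_graph_def by auto
  ultimately have "inj_on (map_prod f f) (edges G)" by (rule inj_on_subset)
  then show ?thesis using f(2) by (simp add: card_image)
qed

lemma ograph_iso_refl: "ograph_iso G G"
  unfolding ograph_iso_def by (intro exI[of _ "\<lambda>x. x"]) (auto simp: strict_mono_on_def bij_betw_def map_prod_def)

text \<open>All graphs in the class of \<open>F\<close> have as many edges as \<open>F\<close>.
  Hence the representative chosen by \<open>g\<close> does not matter, and finitely many classes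
  give finitely many edge numbers.\<close>

lemma ramsey_finite_bounded:
  assumes "ramsey_finite H H'"
  shows "\<exists>N. \<forall>F\<in>minimal_ramsey_graphs H H'. card (edges F) \<le> N"
proof -
  let ?M = "minimal_ramsey_graphs H H'" and ?r = "{(F, G :: nat ograph). ograph_iso F G}"
  define g where "g X = card (edges (SOME F. F \<in> X))" for X :: "nat ograph set"
  have "card (edges F) \<in> g ` (?M // ?r)" if F: "F \<in> ?M" for F
  proof -
    let ?X = "?r `` {F}"
    have "F \<in> ?X" using ograph_iso_refl by auto
    then have "(SOME G. G \<in> ?X) \<in> ?X" using someI[of "\<lambda>G. G \<in> ?X" F] by simp
    then have "ograph_iso F (SOME G. G \<in> ?X)" by auto
    moreover have "ordered_graph F" using F unfolding minimal_ramsey_graphs_def ramsey_graphs_def by auto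
    ultimately have "g ?X = card (edges F)" unfolding g_def using card_edges_iso by blast
    moreover have "?X \<in> ?M // ?r" using F by (rule quotientI)
    ultimately show ?thesis by (metis image_eqI)
  qed
  then have "(\<lambda>F. card (edges F)) ` ?M \<subseteq> g ` (?M // ?r)" by blast
  then have "finite ((\<lambda>F. card (edges F)) ` ?M)"
    using assms unfolding ramsey_finite_def by (meson finite_imageI finite_subset)
  then show ?thesis by (intro exI[of _ "Max ((\<lambda>F. card (edges F)) ` ?M)"]) auto
qed

lemma ex_minimal_ramsey_graph:
  assumes "F \<in> ramsey_graphs H H'"
  shows "\<exists>G\<in>minimal_ramsey_graphs H H'. subgraph G F"
proof -
  define P where "P G \<longleftrightarrow> subgraph G F \<and> G \<in> ramsey_graphs H H'" for G
  \<comment> \<open>Vertices are counted too, since dropping an isolated vertex already gives a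
    proper subgraph.\<close>
  define \<mu> where "\<mu> G = card (verts G) + card (edges G)" for G :: "nat ograph"
  have "P F" using assms unfolding P_def subgraph_def ramsey_graphs_def by auto
  then obtain G where G: "P G" "\<And>G'. P G' \<Longrightarrow> \<mu> G \<le> \<mu> G'"
    using ex_has_least_nat[of P F \<mu>] by blast
  have "G' \<notin> ramsey_graphs H H'" if G': "subgraph G' G" "G' \<noteq> G" for G'
  proof
    assume "G' \<in> ramsey_graphs H H'"
    then have "P G'" using G'(1) G(1) unfolding P_def subgraph_def by auto
    have ord: "ordered_graph G" using G(1) unfolding P_def subgraph_def by blast
    then have fin: "finite (verts G)" "finite (edges G)"
      using ordered_graph_edge_set unfolding ordered_graph_def edge_set_def by blast+
    have sub: "verts G' \<subseteq> verts G" "edges G' \<subseteq> edges G" using G'(1) unfolding subgraph_def by auto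
    have "card (verts G') \<le> card (verts G)" "card (edges G') \<le> card (edges G)"
      using fin sub card_mono by blast+
    then have "card (verts G') = card (verts G)" "card (edges G') = card (edges G)"
      using G(2)[OF \<open>P G'\<close>] unfolding \<mu>_def by linarith+
    then have "verts G' = verts G" "edges G' = edges G" using fin sub card_subset_eq by blast+
    then show False using G'(2) by (simp add: ograph.expand)
  qed
  then show ?thesis using G(1) unfolding minimal_ramsey_graphs_def P_def by blast
qed

lemma ramsey_finite_bounded_arrowing:
  assumes "ordered_graph H" "verts H = Field (edges H)" "ordered_graph H'" "verts H' = Field (edges H')"
    and "ramsey_finite H H'"
  shows "bounded_arrowing (edges H) (edges H')"
proof -
  obtain N where N: "\<And>F. F \<in> minimal_ramsey_graphs H H' \<Longrightarrow> card (edges F) \<le> N"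
    using ramsey_finite_bounded[OF assms(5)] by blast
  have "\<exists>E0\<subseteq>E. card E0 \<le> N \<and> arrows E0 (edges H) (edges H')"
    if E: "edge_set E" "arrows E (edges H) (edges H')" for E :: "nat rel"
  proof -
    have "OGraph (Field E) E \<in> ramsey_graphs H H'"
      using E ordered_graph_Field unfolding ramsey_graphs_iff[OF assms(1-4)] by simp
    then obtain G where G: "G \<in> minimal_ramsey_graphs H H'" "subgraph G (OGraph (Field E) E)"
      using ex_minimal_ramsey_graph by blast
    have "G \<in> ramsey_graphs H H'" using G(1) unfolding minimal_ramsey_graphs_def by blast
    then have "arrows (edges G) (edges H) (edges H')" unfolding ramsey_graphs_iff[OF assms(1-4)] by blast
    moreover have "edges G \<subseteq> E" using G(2) unfolding subgraph_def by simp
    ultimately show ?thesis using N[OF G(1)] by blast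
  qed
  then show ?thesis unfolding bounded_arrowing_def by blast
qed

lemma chi_unavoidable_unavoidable:
  assumes "ordered_graph H" "verts H = Field (edges H)" "chi_unavoidable H"
  shows "unavoidable (edges H)"
proof -
  obtain k where k: "\<And>F :: nat ograph. ordered_graph F \<Longrightarrow> chromatic_number F \<ge> k \<Longrightarrow> \<exists>C. is_copy C H F"
    using assms(3) unfolding chi_unavoidable_def by blast
  have "embeds (edges H) E" if E: "edge_set E" "\<not> colorable k E" for E :: "nat rel"
  proof -
    let ?F = "OGraph (Field E) E"
    have ord: "ordered_graph ?F" using ordered_graph_Field[OF E(1)] .
    have "chromatic_number ?F \<ge> k"
    proof (rule ccontr)
      assume less: "\<not> ?thesis"
      let ?Q = "\<lambda>q. \<exists>c. c ` verts ?F \<subseteq> {..<q} \<and> proper_coloring ?F c"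
      \<comment> \<open>\<open>LEAST\<close> is meaningful only if some proper colouring exists;
        here every vertex is its own colour.\<close>
      obtain q where "Field E \<subseteq> {..<q}" using finite_Field_edge_set[OF E(1)] unfolding finite_nat_set_iff_bounded by blast
      moreover have "proper_coloring ?F id"
        using E(1) unfolding proper_coloring_def edge_set_def by auto
      ultimately have "?Q q" by (intro exI[of _ id]) auto
      then have "?Q (chromatic_number ?F)" unfolding chromatic_number_def by (rule LeastI)
      then obtain c where c0: "c ` verts ?F \<subseteq> {..<chromatic_number ?F}" "proper_coloring ?F c" by (elim exE conjE)
      then have c: "c ` Field E \<subseteq> {..<chromatic_number ?F}" "\<And>u v. (u, v) \<in> E \<Longrightarrow> c u \<noteq> c v"
        unfolding proper_coloring_def by auto
      \<comment> \<open>The bound must hold outside of \<open>Field E\<close> as well;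
        \<open>0\<close> is a legal colour because the chromatic number is assumed to be below
        \<open>k\<close>.\<close>
      define c' where "c' v = (if v \<in> Field E then c v else 0)" for v
      have "c' v < k" for v using c(1) less unfolding c'_def by auto
      moreover have "c' u \<noteq> c' v" if "(u, v) \<in> E" for u v
        using c(2)[OF that] that unfolding c'_def by (auto intro: FieldI1 FieldI2)
      ultimately have "colorable k E" unfolding colorable_def by blast
      then show False using E(2) by contradiction
    qed
    then obtain C where C: "is_copy C H ?F" using k[OF ord] by blast
    then have "edges C \<subseteq> edges ?F" unfolding is_copy_def subgraph_def by blast
    then show ?thesis using copy_iff_embeds[OF ord order_refl assms(1,2)] C by auto
  qed
  then show ?thesis unfolding unavoidable_def by blast
qed

lemma bounded_arrowing_stars:
  fixes D :: "'a::linorder rel" and D' :: "'b::linorder rel"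
  assumes D: "edge_set D" "connected_edges D" "card D \<ge> 2" "unavoidable D"
    and D': "edge_set D'" "connected_edges D'" "card D' \<ge> 2" "unavoidable D'"
    and "bounded_arrowing D D'"
  shows "(\<exists>c. D = {c} \<times> (Field D - {c})) \<and> single_valued (D'\<inverse>) \<or>
         (\<exists>c. D' = {c} \<times> (Field D' - {c})) \<and> single_valued (D\<inverse>) \<or>
         (\<exists>c. D = (Field D - {c}) \<times> {c}) \<and> single_valued D' \<or>
         (\<exists>c. D' = (Field D' - {c}) \<times> {c}) \<and> single_valued D"
proof -
  obtain N where N: "\<And>E :: nat rel. edge_set E \<Longrightarrow> arrows E D D' \<Longrightarrow> \<exists>E0\<subseteq>E. card E0 \<le> N \<and> arrows E0 D D'"
    using assms(9) unfolding bounded_arrowing_def by blast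
  obtain k k' where k: "\<And>E :: nat rel. edge_set E \<Longrightarrow> \<not> colorable k E \<Longrightarrow> embeds D E"
    "\<And>E :: nat rel. edge_set E \<Longrightarrow> \<not> colorable k' E \<Longrightarrow> embeds D' E"
    using D(4) D'(4) unfolding unavoidable_def by blast
  obtain E :: "nat rel" where E: "edge_set E" "\<not> colorable (k * k') E"
    "\<And>E0. E0 \<subseteq> E \<Longrightarrow> card E0 \<le> N \<Longrightarrow> forest E0"
    using ex_locally_forest[of "k * k'" N] by blast
  have "arrows E D D'" using arrows_if_not_colorable[OF k E(1,2)] by blast
  then obtain E0 where E0: "E0 \<subseteq> E" "card E0 \<le> N" "arrows E0 D D'" using N E(1) by blast
  show ?thesis
    using forest_arrows_stars[OF edge_set_subset[OF E(1) E0(1)] E(3)[OF E0(1,2)] E0(3) D(2,1,3) D'(2,1,3)] .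
qed

lemma bounded_arrowing_right:
  fixes D :: "'a::linorder rel" and D' :: "'b::linorder rel"
  assumes D: "edge_set D" "card D \<ge> 2" "D = {c} \<times> (Field D - {c})"
    and D': "edge_set D'" "connected_edges D'" "card D' \<ge> 2" "unavoidable D'" "single_valued (D'\<inverse>)"
    and bounded: "bounded_arrowing D D'"
  shows "\<exists>ds h. ds \<noteq> [] \<and> (\<forall>d\<in>set ds. d \<ge> 1) \<and> almost_increasing ds \<and>
           strict_mono_on {0..sum_list ds} h \<and> h ` {0..sum_list ds} = Field D' \<and>
           D' = map_prod h h ` edges (right_caterpillar ds)"
proof -
  have "D' \<noteq> {}" using D'(3) by auto
  then obtain ds h where ds: "ds \<noteq> []" "\<forall>d\<in>set ds. d \<ge> 1" "strict_mono_on {0..sum_list ds} h"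
    "h ` {0..sum_list ds} = Field D'" "D' = map_prod h h ` edges (right_caterpillar ds)"
    using ex_right_caterpillar[OF D'(1,2,5)] unavoidable_fork[OF D'(4)] by blast
  define C where "C = Field D - {c}"
  have C: "D = {c} \<times> C" "finite C" "\<And>x. x \<in> C \<Longrightarrow> c < x"
    using D finite_Field_edge_set[OF D(1)] unfolding C_def edge_set_def by auto
  then have p: "card C \<ge> 2" using D(2) by (simp add: card_cartesian_product_singleton)
  \<comment> \<open>Embedding a right star only asks for a large right degree, so \<open>D\<close>
    can be exchanged for the standard star over \<open>nat\<close>.\<close>
  have "embeds D E \<longleftrightarrow> embeds ({0} \<times> {1..card C}) E" if "edge_set E" for E :: "nat rel"
  proof -
    have "C \<noteq> {}" "finite E" using p that unfolding edge_set_def by auto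
    then have "embeds D E \<longleftrightarrow> (\<exists>v. card C \<le> card (E `` {v}))"
      unfolding C(1) using C(2,3) that by (intro embeds_right_star_iff)
    moreover have "embeds ({0} \<times> {1..card C}) E \<longleftrightarrow> (\<exists>v. card {1..card C} \<le> card (E `` {v}))"
      using p that \<open>finite E\<close> by (intro embeds_right_star_iff) auto
    ultimately show ?thesis by simp
  qed
  moreover have "embeds D' E \<longleftrightarrow> embeds (edges (right_caterpillar ds)) E" for E :: "nat rel"
    unfolding ds(5) using ds(3) Field_right_caterpillar[OF sum_list_ge_1[OF ds(1,2)]]
    by (intro embeds_map_left) simp
  ultimately have arr: "arrows E D D' \<longleftrightarrow> arrows E ({0} \<times> {1..card C}) (edges (right_caterpillar ds))"
    if "edge_set E" for E :: "nat rel"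
    using edge_set_subset[OF that] unfolding arrows_def by simp
  have "bounded_arrowing ({0} \<times> {1..card C}) (edges (right_caterpillar ds))"
    using bounded arr edge_set_subset unfolding bounded_arrowing_def by meson
  then have "almost_increasing ds" using bounded_arrowing_almost_increasing[OF p ds(1,2)] by blast
  then show ?thesis using ds by blast
qed

section \<open>Reversing the vertex order\<close>

instance dual :: (linorder) linorder
  by standard (simp add: dual_less_eq_iff linear)

text \<open>In the reversed order the larger end comes first, so each pair is swapped to remain
  increasing.\<close>

definition flip :: "'a rel \<Rightarrow> 'a dual rel" where
  "flip E = (\<lambda>(u, v). (dual v, dual u)) ` E"

lemma flip_iff [simp]: "(u, v) \<in> flip E \<longleftrightarrow> (undual v, undual u) \<in> E"
proof
  assume "(undual v, undual u) \<in> E"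
  then have "(\<lambda>(u, v). (dual v, dual u)) (undual v, undual u) \<in> flip E" unfolding flip_def by (rule imageI)
  then show "(u, v) \<in> flip E" by simp
qed (auto simp: flip_def)

lemma card_flip: "card (flip E) = card E"
  unfolding flip_def by (intro card_image) (auto simp: inj_on_def)

lemma Field_flip: "Field (flip E) = dual ` Field E"
  unfolding flip_def Field_def by force

lemma edge_set_flip: "edge_set (flip E) \<longleftrightarrow> edge_set E"
proof -
  have "finite (flip E) \<longleftrightarrow> finite E"
    unfolding flip_def by (intro finite_image_iff) (auto simp: inj_on_def)
  moreover have "(\<forall>(u, v)\<in>flip E. u < v) \<longleftrightarrow> (\<forall>(u, v)\<in>E. u < v)"
    unfolding flip_def by auto
  ultimately show ?thesis unfolding edge_set_def by simp
qed

lemma undual_less_iff: "undual x < undual y \<longleftrightarrow> y < x"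
  by (simp add: dual_less_iff)

text \<open>Conjugating the embedding by the reversal moves \<open>flip\<close> to the other side,
  which avoids iterated \<open>dual\<close> types.\<close>

lemma embeds_flip:
  fixes D :: "'a::linorder rel" and E :: "'b::linorder rel"
  shows "embeds (flip D) E \<longleftrightarrow> embeds D (flip E)"
proof
  assume "embeds (flip D) E"
  then obtain f where f: "strict_mono_on (dual ` Field D) f" "\<And>u v. (u, v) \<in> flip D \<Longrightarrow> (f u, f v) \<in> E"
    unfolding embeds_def Field_flip by blast
  have "strict_mono_on (Field D) (\<lambda>x. dual (f (dual x)))"
    using f(1) unfolding strict_mono_on_def by simp
  moreover have "(dual (f (dual u)), dual (f (dual v))) \<in> flip E" if "(u, v) \<in> D" for u v
    using f(2)[of "dual v" "dual u"] that by simp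
  ultimately show "embeds D (flip E)" unfolding embeds_def by blast
next
  assume "embeds D (flip E)"
  then obtain f where f: "strict_mono_on (Field D) f" "\<And>u v. (u, v) \<in> D \<Longrightarrow> (f u, f v) \<in> flip E"
    unfolding embeds_def by blast
  have "strict_mono_on (Field (flip D)) (\<lambda>x. undual (f (undual x)))"
    using f(1) unfolding strict_mono_on_def Field_flip by (auto simp: undual_less_iff)
  moreover have "(undual (f (undual u)), undual (f (undual v))) \<in> E" if "(u, v) \<in> flip D" for u v
    using f(2)[of "undual v" "undual u"] that by simp
  ultimately show "embeds (flip D) E" unfolding embeds_def by blast
qed

lemma flip_Diff: "flip (A - B) = flip A - flip B"
  by auto

lemma subset_flip_iff: "S \<subseteq> flip E \<longleftrightarrow> (\<exists>R\<subseteq>E. S = flip R)"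
  unfolding flip_def by (rule subset_image_iff)

lemma arrows_flip:
  "arrows (flip E) D D' \<longleftrightarrow> arrows E (flip D) (flip D')"
proof -
  have "(\<forall>S\<subseteq>flip E. P S) \<longleftrightarrow> (\<forall>R\<subseteq>E. P (flip R))" for P
    unfolding subset_flip_iff by blast
  then show ?thesis unfolding arrows_def embeds_flip flip_Diff by simp
qed

lemma bounded_arrowing_flip:
  assumes "bounded_arrowing D D'"
  shows "bounded_arrowing (flip D) (flip D')"
proof -
  obtain N where N: "\<And>E :: nat dual rel. edge_set E \<Longrightarrow> arrows E D D' \<Longrightarrow> \<exists>E0\<subseteq>E. card E0 \<le> N \<and> arrows E0 D D'"
    using bounded_arrowing_iff[OF assms] by blast
  have "\<exists>E0\<subseteq>E. card E0 \<le> N \<and> arrows E0 (flip D) (flip D')"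
    if E: "edge_set E" "arrows E (flip D) (flip D')" for E :: "nat rel"
  proof -
    have "edge_set (flip E)" "arrows (flip E) D D'"
      using E edge_set_flip[of E] arrows_flip[of E D D'] by simp_all
    then obtain S where S: "S \<subseteq> flip E" "card S \<le> N" "arrows S D D'"
      using N by blast
    obtain E0 where "E0 \<subseteq> E" "S = flip E0" using S(1) unfolding subset_flip_iff by blast
    then show ?thesis using S(2,3) arrows_flip card_flip by metis
  qed
  then show ?thesis unfolding bounded_arrowing_def by blast
qed

lemma unavoidable_flip:
  assumes "unavoidable D"
  shows "unavoidable (flip D)"
proof -
  obtain k where k: "\<And>E :: nat dual rel. edge_set E \<Longrightarrow> \<not> colorable k E \<Longrightarrow> embeds D E"
    using unavoidable_embeds[OF assms] by blast
  have "embeds (flip D) E" if E: "edge_set E" "\<not> colorable k E" for E :: "nat rel"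
  proof -
    have "\<not> colorable k (flip E)"
    proof
      assume "colorable k (flip E)"
      then obtain c where c: "\<And>v. c v < k" "\<And>u v. (u, v) \<in> flip E \<Longrightarrow> c u \<noteq> c v"
        unfolding colorable_def by blast
      have "c (dual u) \<noteq> c (dual v)" if "(u, v) \<in> E" for u v
        using c(2)[of "dual v" "dual u"] that by simp
      then have "colorable k E" unfolding colorable_def using c(1) by (intro exI[of _ "c \<circ> dual"]) auto
      then show False using E(2) by contradiction
    qed
    moreover have "edge_set (flip E)" using E(1) edge_set_flip[of E] by simp
    ultimately show ?thesis using k[of "flip E"] embeds_flip[of D E] by simp
  qed
  then show ?thesis unfolding unavoidable_def by blast
qed

lemma connected_edges_flip:
  assumes "connected_edges D"
  shows "connected_edges (flip D)"
  unfolding connected_edges_def Field_flip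
proof (intro ballI)
  fix u v assume "u \<in> dual ` Field D" "v \<in> dual ` Field D"
  then obtain a b where ab: "u = dual a" "v = dual b" "(a, b) \<in> (D \<union> D\<inverse>)\<^sup>*"
    using assms unfolding connected_edges_def by blast
  from ab(3) have "(dual a, dual b) \<in> (flip D \<union> (flip D)\<inverse>)\<^sup>*"
  proof (induction rule: rtrancl_induct)
    case (step y z)
    then have "(dual y, dual z) \<in> flip D \<union> (flip D)\<inverse>" by auto
    then show ?case using step.IH by (rule rtrancl_into_rtrancl[rotated])
  qed simp
  then show "(u, v) \<in> (flip D \<union> (flip D)\<inverse>)\<^sup>*" using ab by simp
qed

section \<open>Conclusions for both orientations\<close>

lemma right_conclusion:
  assumes H: "ordered_graph H" "connected_ograph H" "card (edges H) \<ge> 2"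
    and H': "ordered_graph H'" "connected_ograph H'" "card (edges H') \<ge> 2" "chi_unavoidable H'"
    and bounded: "bounded_arrowing (edges H) (edges H')"
    and star: "edges H = {c} \<times> (Field (edges H) - {c})" and sv: "single_valued ((edges H')\<inverse>)"
  shows "is_right_star H \<and> almost_increasing_right_caterpillar H'"
proof -
  have V: "verts H = Field (edges H)" and V': "verts H' = Field (edges H')"
    using verts_eq_Field H H' by blast+
  have conn: "connected_edges (edges H')"
    using H'(2) unfolding connected_edges_def connected_ograph_def V' by blast
  obtain ds h where ds: "ds \<noteq> []" "\<forall>d\<in>set ds. d \<ge> 1" "almost_increasing ds"
    "strict_mono_on {0..sum_list ds} h" "h ` {0..sum_list ds} = Field (edges H')"
    "edges H' = map_prod h h ` edges (right_caterpillar ds)"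
    using bounded_arrowing_right[OF ordered_graph_edge_set[OF H(1)] H(3) star
        ordered_graph_edge_set[OF H'(1)] conn H'(3) chi_unavoidable_unavoidable[OF H'(1) V' H'(4)] sv bounded]
    by blast
  have "ograph_iso (right_caterpillar ds) H'"
    unfolding ograph_iso_def V' verts_right_caterpillar
    using ds(4-6) strict_mono_on_imp_inj_on[OF ds(4)] by (intro exI[of _ h]) (auto simp: bij_betw_def)
  then have "almost_increasing_right_caterpillar H'"
    using ds(1-3) unfolding almost_increasing_right_caterpillar_def is_right_caterpillar_def by blast
  moreover have "c \<in> verts H"
  proof -
    have "edges H \<noteq> {}" using H(3) by auto
    then obtain u v where "(u, v) \<in> edges H" by auto
    then have "(c, v) \<in> edges H" using star by blast
    then show ?thesis unfolding V by (rule FieldI1)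
  qed
  then have "is_right_star H" using H(1) star unfolding is_right_star_def V by blast
  ultimately show ?thesis by blast
qed

lemma left_conclusion:
  assumes H: "ordered_graph H" "connected_ograph H" "card (edges H) \<ge> 2"
    and H': "ordered_graph H'" "connected_ograph H'" "card (edges H') \<ge> 2" "chi_unavoidable H'"
    and bounded: "bounded_arrowing (edges H) (edges H')"
    and star: "edges H = (Field (edges H) - {c}) \<times> {c}" and sv: "single_valued (edges H')"
  shows "is_left_star H \<and> almost_increasing_left_caterpillar H'"
proof -
  have V: "verts H = Field (edges H)" and V': "verts H' = Field (edges H')"
    using verts_eq_Field H H' by blast+
  have conn: "connected_edges (edges H')"
    using H'(2) unfolding connected_edges_def connected_ograph_def V' by blast
  have star': "flip (edges H) = {dual c} \<times> (Field (flip (edges H)) - {dual c})"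
  proof -
    have "flip (edges H) = flip ((Field (edges H) - {c}) \<times> {c})" using star by (rule arg_cong)
    also have "\<dots> = {dual c} \<times> (dual ` Field (edges H) - {dual c})"
      unfolding flip_def by force
    finally show ?thesis unfolding Field_flip .
  qed
  have sv': "single_valued ((flip (edges H'))\<inverse>)"
    using sv unfolding single_valued_def by (auto simp: dual_eq_iff)
  have e: "edge_set (flip (edges H))" "card (flip (edges H)) \<ge> 2"
    "edge_set (flip (edges H'))" "card (flip (edges H')) \<ge> 2"
    using H H' ordered_graph_edge_set by (auto simp: edge_set_flip card_flip)
  obtain ds h where ds: "ds \<noteq> []" "\<forall>d\<in>set ds. d \<ge> 1" "almost_increasing ds"
    "strict_mono_on {0..sum_list ds} h" "h ` {0..sum_list ds} = Field (flip (edges H'))"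
    "flip (edges H') = map_prod h h ` edges (right_caterpillar ds)"
    using bounded_arrowing_right[OF e(1,2) star' e(3) connected_edges_flip[OF conn] e(4)
        unavoidable_flip[OF chi_unavoidable_unavoidable[OF H'(1) V' H'(4)]] sv' bounded_arrowing_flip[OF bounded]]
    by blast
  let ?s = "sum_list ds"
  \<comment> \<open>Two reversals cancel, of the positions by \<open>?s - x\<close> and of the
    values by \<open>undual\<close>; so \<open>g\<close> is increasing and maps the mirrored
    caterpillar onto \<open>H'\<close>.\<close>
  define g where "g x = undual (h (?s - x))" for x
  have rev: "(\<lambda>x. ?s - x) ` {0..?s} = {0..?s}"
  proof (intro equalityI subsetI)
    fix y assume "y \<in> {0..?s}"
    then show "y \<in> (\<lambda>x. ?s - x) ` {0..?s}" by (intro image_eqI[of _ _ "?s - y"]) auto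
  qed auto
  have verts: "verts (mirror (right_caterpillar ds)) = {0..?s}"
    unfolding mirror_def Let_def ograph.sel verts_right_caterpillar Max_Min_atLeast0AtMost by (rule rev)
  have "strict_mono_on {0..?s} g"
    using ds(4) unfolding g_def strict_mono_on_def by (simp add: undual_less_iff diff_less_mono2)
  moreover have "g ` {0..?s} = Field (edges H')"
  proof -
    have "g ` {0..?s} = undual ` h ` (\<lambda>x. ?s - x) ` {0..?s}" unfolding g_def by (simp add: image_image)
    also have "\<dots> = undual ` dual ` Field (edges H')"
      using rev ds(5) unfolding Field_flip by simp
    finally show ?thesis by (simp add: image_image)
  qed
  moreover have "edges H' = map_prod g g ` edges (mirror (right_caterpillar ds))"
  proof -
    have g: "g (?s - x) = undual (h x)" if "x \<le> ?s" for x using that unfolding g_def by simp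
    have "map_prod g g ` edges (mirror (right_caterpillar ds)) =
        (\<lambda>(u, v). (g (?s - v), g (?s - u))) ` edges (right_caterpillar ds)"
      unfolding mirror_def Let_def ograph.sel verts_right_caterpillar Max_Min_atLeast0AtMost image_image
      by (rule image_cong) auto
    also have "\<dots> = (\<lambda>(u, v). (undual (h v), undual (h u))) ` edges (right_caterpillar ds)"
    proof (rule image_cong[OF refl])
      fix e assume "e \<in> edges (right_caterpillar ds)"
      then show "(case e of (u, v) \<Rightarrow> (g (?s - v), g (?s - u))) = (case e of (u, v) \<Rightarrow> (undual (h v), undual (h u)))"
        using edges_right_caterpillar_bounds[of "fst e" "snd e" ds] g by (cases e) auto
    qed
    also have "\<dots> = (\<lambda>(u, v). (undual v, undual u)) ` flip (edges H')"
      unfolding ds(6) image_image by (rule image_cong) auto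
    also have "\<dots> = edges H'" unfolding flip_def image_image by (simp add: case_prod_beta)
    finally show ?thesis by simp
  qed
  ultimately have "ograph_iso (mirror (right_caterpillar ds)) H'"
    unfolding ograph_iso_def V' verts
    using strict_mono_on_imp_inj_on by (intro exI[of _ g]) (auto simp: bij_betw_def)
  then have "almost_increasing_left_caterpillar H'"
    using ds(1-3) unfolding almost_increasing_left_caterpillar_def is_left_caterpillar_def by blast
  moreover have "c \<in> verts H"
  proof -
    have "edges H \<noteq> {}" using H(3) by auto
    then obtain u v where "(u, v) \<in> edges H" by auto
    then have "(u, c) \<in> edges H" using star by blast
    then show ?thesis unfolding V by (rule FieldI2)
  qed
  then have "is_left_star H" using H(1) star unfolding is_left_star_def V by blast
  ultimately show ?thesis by blast
qed

lemma bounded_arrowing_commute: "bounded_arrowing D D' \<Longrightarrow> bounded_arrowing D' D"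
  unfolding bounded_arrowing_def using arrows_commute by meson

theorem theorem13:
  fixes H :: "'a::linorder ograph" and H' :: "'b::linorder ograph"
  assumes "ordered_graph H" and "ordered_graph H'"
    and "connected_ograph H" and "connected_ograph H'"
    and "card (edges H) \<ge> 2" and "card (edges H') \<ge> 2"
    and "chi_unavoidable H" and "chi_unavoidable H'"
    and "ramsey_finite H H'"
  shows "((is_right_star H \<and> almost_increasing_right_caterpillar H') \<or>
          (is_right_star H' \<and> almost_increasing_right_caterpillar H)) \<or>
         ((is_left_star H \<and> almost_increasing_left_caterpillar H') \<or>
          (is_left_star H' \<and> almost_increasing_left_caterpillar H))"
proof -
  have V: "verts H = Field (edges H)" and V': "verts H' = Field (edges H')"
    using verts_eq_Field assms by blast+
  have b: "bounded_arrowing (edges H) (edges H')"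
    using ramsey_finite_bounded_arrowing[OF assms(1) V assms(2) V' assms(9)] .
  note b' = bounded_arrowing_commute[OF b]
  have conn: "connected_edges (edges H)" "connected_edges (edges H')"
    using assms(3,4) unfolding connected_edges_def connected_ograph_def V V' by blast+
  note right = right_conclusion[OF assms(1,3,5) assms(2,4,6,8) b]
    right_conclusion[OF assms(2,4,6) assms(1,3,5,7) b']
  note left = left_conclusion[OF assms(1,3,5) assms(2,4,6,8) b]
    left_conclusion[OF assms(2,4,6) assms(1,3,5,7) b']
  show ?thesis
    using bounded_arrowing_stars[OF ordered_graph_edge_set[OF assms(1)] conn(1) assms(5)
        chi_unavoidable_unavoidable[OF assms(1) V assms(7)]
        ordered_graph_edge_set[OF assms(2)] conn(2) assms(6)
        chi_unavoidable_unavoidable[OF assms(2) V' assms(8)] b]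
      right left by blast
qed

end
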